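(* Let $\Omega\subset\mathbb{R}^3$ be a bounded, smooth domain. If $\mathsf{B}\in W^{2,3}(\Omega)^{3\times3}$ and $\det\mathsf{B}=1$ almost everywhere on $\Omega$, then $\mathsf{B}^{-1}\in W^{2,3}(\Omega)^{3\times3}$. If, moreover, $\mu_1,\mu_2,\mu_3\in W^{1,\infty}(\Omega)\cap W^{2,3}(\Omega)$, then $\mathcal{A}(\mathsf{B})\in W^{2,3}(\Omega)^{3\times3}$.
   Context: $\mathsf{B}$ is a $3\times3$-matrix-valued function on $\Omega$, $\mathsf{B}^{-1}$ is its pointwise matrix inverse, and $\mathcal{A}(\mathsf{B})=\mu_1\mathsf{I}+\mu_2\mathsf{B}+\mu_3\mathsf{B}^{-1}$, where $\mathsf{I}$ is the identity matrix and $\mu_1,\mu_2,\mu_3$ are scalar fields on $\Omega$. *)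

theory Defs
  imports "HOL-Analysis.Analysis"
begin

definition partial_deriv :: "'a::euclidean_space \<Rightarrow> ('a \<Rightarrow> real) \<Rightarrow> 'a \<Rightarrow> real" where
  "partial_deriv b f x = frechet_derivative f (at x) b"

text \<open>Multi-indices are represented by lists of coordinate directions (elements of
  \<^term>\<open>Basis\<close>), the order of the derivative being the length of the list. Each
  multi-index corresponds to several lists, which give the same derivative of a smooth
  function because mixed partial derivatives commute.\<close>

primrec iterated_partial :: "'a::euclidean_space list \<Rightarrow> ('a \<Rightarrow> real) \<Rightarrow> 'a \<Rightarrow> real" where
  "iterated_partial [] f = f"
| "iterated_partial (b # bs) f = partial_deriv b (iterated_partial bs f)"

text \<open>Differentiability of all iterated partial derivatives makes all of them continuous, so
  this is membership in the space of infinitely often continuously differentiable functions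
  on the whole space.\<close>

definition smooth :: "('a::euclidean_space \<Rightarrow> real) \<Rightarrow> bool" where
  "smooth f \<longleftrightarrow> (\<forall>bs\<in>lists Basis. \<forall>x. iterated_partial bs f differentiable (at x))"

definition test_functions :: "'a::euclidean_space set \<Rightarrow> ('a \<Rightarrow> real) set" where
  "test_functions \<Omega> =
     {\<phi>. smooth \<phi> \<and> compact (closure {x. \<phi> x \<noteq> 0}) \<and> closure {x. \<phi> x \<noteq> 0} \<subseteq> \<Omega>}"

text \<open>Elements of the function spaces below are represented by functions on the whole space,
  whose values outside \<open>\<Omega>\<close> are irrelevant and which are not identified when they agree
  almost everywhere in \<open>\<Omega>\<close>.\<close>

definition Lp_space :: "ennreal \<Rightarrow> 'a::euclidean_space set \<Rightarrow> ('a \<Rightarrow> real) set" where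
  "Lp_space p \<Omega> = {u \<in> borel_measurable (lebesgue_on \<Omega>).
     if p = \<infinity> then \<exists>C. AE x in lebesgue_on \<Omega>. \<bar>u x\<bar> \<le> C
     else integrable (lebesgue_on \<Omega>) (\<lambda>x. \<bar>u x\<bar> powr enn2real p)}"

definition locally_integrable :: "'a::euclidean_space set \<Rightarrow> ('a \<Rightarrow> real) \<Rightarrow> bool" where
  "locally_integrable \<Omega> u \<longleftrightarrow> (\<forall>K. compact K \<and> K \<subseteq> \<Omega> \<longrightarrow> integrable (lebesgue_on K) u)"

definition weak_derivative ::
    "'a::euclidean_space set \<Rightarrow> 'a list \<Rightarrow> ('a \<Rightarrow> real) \<Rightarrow> ('a \<Rightarrow> real) \<Rightarrow> bool" where
  "weak_derivative \<Omega> bs u v \<longleftrightarrow>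
     locally_integrable \<Omega> u \<and> locally_integrable \<Omega> v \<and>
     (\<forall>\<phi>\<in>test_functions \<Omega>.
        (LINT x|lebesgue_on \<Omega>. u x * iterated_partial bs \<phi> x) =
        (-1) ^ length bs * (LINT x|lebesgue_on \<Omega>. v x * \<phi> x))"

definition sobolev_space :: "nat \<Rightarrow> ennreal \<Rightarrow> 'a::euclidean_space set \<Rightarrow> ('a \<Rightarrow> real) set" where
  "sobolev_space k p \<Omega> = {u \<in> Lp_space p \<Omega>.
     \<forall>bs\<in>lists Basis. length bs \<le> k \<longrightarrow> (\<exists>v\<in>Lp_space p \<Omega>. weak_derivative \<Omega> bs u v)}"

definition sobolev_matrix_space ::
    "nat \<Rightarrow> ennreal \<Rightarrow> 'a::euclidean_space set \<Rightarrow> ('a \<Rightarrow> real^'n^'m) set" where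
  "sobolev_matrix_space k p \<Omega> = {M. \<forall>i j. (\<lambda>x. M x $ i $ j) \<in> sobolev_space k p \<Omega>}"

definition domain :: "'a::euclidean_space set \<Rightarrow> bool" where
  "domain \<Omega> \<longleftrightarrow> open \<Omega> \<and> connected \<Omega> \<and> \<Omega> \<noteq> {}"

text \<open>Near each boundary point, \<open>\<Omega>\<close> is the region on one side of the graph of a smooth function
  over a hyperplane. The unit vector \<open>e\<close> is the normal of that hyperplane (the vertical axis of
  rotated Cartesian coordinates), and a function on the hyperplane is represented by its extension
  to the whole space that is constant in direction \<open>e\<close>.\<close>

definition smooth_boundary :: "'a::euclidean_space set \<Rightarrow> bool" where
  "smooth_boundary \<Omega> \<longleftrightarrow> (\<forall>z\<in>frontier \<Omega>. \<exists>r>0. \<exists>e \<gamma>.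
     norm e = 1 \<and> smooth \<gamma> \<and> (\<forall>x t. \<gamma> (x + t *\<^sub>R e) = \<gamma> x) \<and>
     \<Omega> \<inter> ball z r = {x \<in> ball z r. \<gamma> x < x \<bullet> e})"

definition response ::
    "('a \<Rightarrow> real) \<Rightarrow> ('a \<Rightarrow> real) \<Rightarrow> ('a \<Rightarrow> real) \<Rightarrow> ('a \<Rightarrow> real^3^3) \<Rightarrow> 'a \<Rightarrow> real^3^3" where
  "response \<mu>\<^sub>1 \<mu>\<^sub>2 \<mu>\<^sub>3 B x =
     \<mu>\<^sub>1 x *\<^sub>R mat 1 + \<mu>\<^sub>2 x *\<^sub>R B x + \<mu>\<^sub>3 x *\<^sub>R matrix_inv (B x)"

end

theory Submission
  imports Defs
begin

text \<open>
  If \<open>det B = 1\<close>, the inverse of \<open>B\<close> is its adjugate, whose entries are differences of products of two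
  entries of \<open>B\<close>. The response function is a sum of products of such functions as well. So the theorem
  holds because \<open>W\<^sup>2\<^sup>,\<^sup>3(\<Omega>)\<close> is closed under multiplication (\<open>sobolev_space_2_3_mult\<close>). For
  \<open>u, v\<close> in this space, the second derivatives of \<open>u v\<close> consist of terms \<open>u \<partial>\<partial>v\<close>, which require \<open>u\<close> to be
  bounded, and of terms \<open>\<partial>u \<partial>v\<close>, which require gradients in \<open>L\<^sup>6\<close>. Both are instances of Sobolev's
  embedding theorem in dimension three: a gradient in \<open>L\<^sup>3\<close> makes a function \<open>L\<^sup>6\<close>
  (\<open>sobolev_embedding_L6\<close>), and a gradient in \<open>L\<^sup>6\<close> makes it bounded (\<open>sobolev_embedding_bounded\<close>).

  Everything is based on one description of weak derivatives: \<open>g\<close> is the weak derivative of \<open>u\<close> in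
  direction \<open>y\<close> if and only if the increments of \<open>u\<close> along almost all segments parallel to \<open>y\<close> inside \<open>\<Omega>\<close>
  are the integrals of \<open>g\<close> (\<open>weak_partial_lines\<close>, \<open>weak_partial_if_lines\<close>). One direction moves test
  functions along the segments and uses the fundamental lemma of the calculus of variations
  (\<open>fundamental_lemma\<close>); the other one is a limit of difference quotients. The product rule
  (\<open>weak_partial_mult\<close>) then reduces to the Leibniz rule for indefinite integrals in one variable, and
  this takes the place of an approximation by smooth functions.

  For the embeddings, a smooth boundary provides a ball \<open>P\<close>, locally independent of \<open>x\<close>, such that
  the segments from \<open>x\<close> to all points of \<open>x + P\<close> stay in \<open>\<Omega>\<close> (\<open>smooth_boundary_cone_property\<close>). Averaging
  the increments over \<open>P\<close> bounds \<open>|u x|\<close> by the norm of \<open>u\<close> in \<open>L\<^sup>1\<close> and the integral of \<open>|\<nabla>u|\<close> over a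
  cone with vertex \<open>x\<close> (\<open>cone_representation\<close>). With the position on the segments parametrized
  by \<open>s\<^sup>2\<close>, this cone potential is estimated by Jensen's inequality and scaling alone: the factor
  \<open>s\<^sup>6\<close> from the substitution compensates the Jacobian of the dilation by \<open>s\<^sup>2\<close> in dimension three
  (\<open>cone_potential_bounded\<close>, \<open>cone_potential_L6\<close>). Finally, compactness of the closure of \<open>\<Omega>\<close> passes
  from local to global bounds.
\<close>

section \<open>Smooth bump functions and the fundamental lemma of the calculus of variations\<close>

text \<open>The functions \<open>t\<^sup>-\<^sup>k exp (-1/t)\<close>, extended by zero to \<open>t \<le> 0\<close>. Starting from \<open>exp (-1/t)\<close> alone,
differentiation produces polynomials in \<open>1/t\<close> as factors; with all \<open>k\<close> present the family is closed under
differentiation up to linear combinations.\<close>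

definition flat :: "nat \<Rightarrow> real \<Rightarrow> real" where
  "flat k t = (if t > 0 then inverse t ^ k * exp (- inverse t) else 0)"

lemma flat_tendsto_0: "(flat k \<longlongrightarrow> 0) (at 0)"
proof -
  have "((\<lambda>t. inverse t ^ k / exp (inverse t)) \<longlongrightarrow> 0) (at_right (0::real))"
    by (rule filterlim_compose[OF tendsto_power_div_exp_0 filterlim_inverse_at_top_right])
  moreover have "eventually (\<lambda>t. inverse t ^ k / exp (inverse t) = flat k t) (at_right (0::real))"
    by (auto simp: eventually_at_filter flat_def exp_minus divide_simps)
  ultimately have "(flat k \<longlongrightarrow> 0) (at_right 0)"
    by (rule Lim_transform_eventually)
  moreover have "(flat k \<longlongrightarrow> 0) (at_left 0)"
    by (rule tendsto_eventually) (auto simp: eventually_at_filter flat_def)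
  ultimately show ?thesis
    by (simp add: filterlim_split_at)
qed

lemma flat_has_real_derivative:
  "(flat k has_real_derivative (flat (k + 2) t - real k * flat (k + 1) t)) (at t)"
proof -
  consider "t > 0" | "t < 0" | "t = 0" by linarith
  then show ?thesis
  proof cases
    case 1
    have "((\<lambda>t. inverse t ^ k * exp (- inverse t)) has_real_derivative
        (flat (k + 2) t - real k * flat (k + 1) t)) (at t)"
      using 1 by (auto intro!: derivative_eq_intros simp: flat_def)
        (cases k; simp add: field_simps power2_eq_square)
    then show ?thesis
      by (rule has_field_derivative_transform_within_open[of _ _ _ "{0<..}"])
        (use 1 in \<open>auto simp: flat_def\<close>)
  next
    case 2
    have "((\<lambda>t. 0::real) has_real_derivative (flat (k + 2) t - real k * flat (k + 1) t)) (at t)"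
      using 2 by (auto simp: flat_def)
    then show ?thesis
      by (rule has_field_derivative_transform_within_open[of _ _ _ "{..<0}"])
        (use 2 in \<open>auto simp: flat_def\<close>)
  next
    case 3
    have "(flat k y - flat k 0) / (y - 0) = flat (Suc k) y" for y
      by (auto simp: flat_def field_simps)
    then have "((\<lambda>y. (flat k y - flat k 0) / (y - 0)) \<longlongrightarrow> 0) (at 0)"
      using flat_tendsto_0[of "Suc k"] by (simp only:)
    then show ?thesis
      using 3 unfolding has_field_derivative_iff by (simp add: flat_def[of _ 0])
  qed
qed

text \<open>A set of functions that is closed under partial derivatives by construction, so that smoothness
of its members is a structural induction instead of a formula for higher derivatives.\<close>

inductive_set flat_algebra :: "('a::euclidean_space \<Rightarrow> real) set" where
  flat: "(\<lambda>x. flat k (x \<bullet> a + c)) \<in> flat_algebra"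
| const: "(\<lambda>x. c) \<in> flat_algebra"
| add: "f \<in> flat_algebra \<Longrightarrow> g \<in> flat_algebra \<Longrightarrow> (\<lambda>x. f x + g x) \<in> flat_algebra"
| mult: "f \<in> flat_algebra \<Longrightarrow> g \<in> flat_algebra \<Longrightarrow> (\<lambda>x. f x * g x) \<in> flat_algebra"

lemma partial_deriv_eq:
  assumes "(f has_derivative f') (at x)"
  shows "partial_deriv b f x = f' b"
  using assms by (simp add: partial_deriv_def frechet_derivative_at[symmetric])

lemma flat_algebra_derivative:
  "f \<in> flat_algebra \<Longrightarrow>
    (\<forall>x. f differentiable (at x)) \<and> (\<forall>b. partial_deriv b f \<in> flat_algebra)"
proof (induction rule: flat_algebra.induct)
  case (flat k a c)
  have D: "((\<lambda>x. flat k (x \<bullet> a + c)) has_derivative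
      (\<lambda>h. (h \<bullet> a) * (flat (k + 2) (x \<bullet> a + c) - real k * flat (k + 1) (x \<bullet> a + c)))) (at x)" for x
    by (rule has_derivative_compose[OF _ flat_has_real_derivative[unfolded has_field_derivative_def], THEN has_derivative_eq_rhs])
      (auto intro!: derivative_eq_intros)
  have "partial_deriv b (\<lambda>x. flat k (x \<bullet> a + c)) =
      (\<lambda>x. (b \<bullet> a) * (flat (k + 2) (x \<bullet> a + c) + (- real k) * flat (k + 1) (x \<bullet> a + c)))" for b
    using partial_deriv_eq[OF D] by (auto simp: fun_eq_iff)
  then have "partial_deriv b (\<lambda>x. flat k (x \<bullet> a + c)) \<in> flat_algebra" for b
    by (simp only:) (intro flat_algebra.intros)
  then show ?case
    using D by (auto simp: differentiable_def)
next
  case (const c)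
  have D: "((\<lambda>x. c) has_derivative (\<lambda>h. 0)) (at x)" for x :: 'a by simp
  have "partial_deriv b (\<lambda>x. c) = (\<lambda>x. 0)" for b :: 'a
    using partial_deriv_eq[OF D] by (auto simp: fun_eq_iff)
  then show ?case using flat_algebra.const[of 0] by simp
next
  case (add f g)
  have D: "((\<lambda>x. f x + g x) has_derivative (\<lambda>h. frechet_derivative f (at x) h + frechet_derivative g (at x) h)) (at x)" for x
    using add by (auto intro!: has_derivative_add simp: frechet_derivative_works[symmetric])
  have "partial_deriv b (\<lambda>x. f x + g x) = (\<lambda>x. partial_deriv b f x + partial_deriv b g x)" for b
    using partial_deriv_eq[OF D] by (auto simp: fun_eq_iff partial_deriv_def)
  then show ?case using add D by (auto simp: differentiable_def intro!: flat_algebra.intros)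
next
  case (mult f g)
  have D: "((\<lambda>x. f x * g x) has_derivative (\<lambda>h. f x * frechet_derivative g (at x) h + frechet_derivative f (at x) h * g x)) (at x)" for x
    using mult by (auto intro!: has_derivative_mult simp: frechet_derivative_works[symmetric])
  have "partial_deriv b (\<lambda>x. f x * g x) = (\<lambda>x. f x * partial_deriv b g x + partial_deriv b f x * g x)" for b
    using partial_deriv_eq[OF D] by (auto simp: fun_eq_iff partial_deriv_def)
  then show ?case using mult D by (auto simp: differentiable_def intro!: flat_algebra.intros)
qed

lemma flat_algebra_smooth:
  assumes "f \<in> flat_algebra"
  shows "smooth f"
proof -
  have "iterated_partial bs f \<in> flat_algebra" for bs
    using assms by (induction bs) (auto simp: flat_algebra_derivative)
  then show ?thesis by (auto simp: smooth_def flat_algebra_derivative)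
qed

lemma flat_algebra_prod:
  assumes "finite I" "\<And>i. i \<in> I \<Longrightarrow> f i \<in> flat_algebra"
  shows "(\<lambda>x. \<Prod>i\<in>I. f i x) \<in> flat_algebra"
  using assms by (induction I rule: finite_induct) (auto intro: flat_algebra.intros)

text \<open>The scaling by \<open>n + 1\<close> turns each factor \<open>exp (-1/t)\<close> into its root of order \<open>n + 1\<close>, which tends
to \<open>1\<close> where \<open>t > 0\<close>; the support stays the same box.\<close>

definition box_bump :: "'a::euclidean_space \<Rightarrow> 'a \<Rightarrow> nat \<Rightarrow> 'a \<Rightarrow> real" where
  "box_bump a b n x = (\<Prod>i\<in>Basis. flat 0 (real (Suc n) * (x \<bullet> i - a \<bullet> i)) * flat 0 (real (Suc n) * (b \<bullet> i - x \<bullet> i)))"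

lemma box_bump_range: "0 \<le> box_bump a b n x" "box_bump a b n x \<le> 1"
proof -
  have *: "0 \<le> flat 0 t" "flat 0 t \<le> 1" for t by (auto simp: flat_def)
  show "0 \<le> box_bump a b n x" unfolding box_bump_def by (intro prod_nonneg ballI mult_nonneg_nonneg *)
  show "box_bump a b n x \<le> 1" unfolding box_bump_def by (intro prod_le_1 conjI mult_nonneg_nonneg mult_le_one *)
qed

lemma box_bump_test:
  assumes "cbox a b \<subseteq> G"
  shows "box_bump a b n \<in> test_functions G"
proof -
  have "flat 0 (r * (x \<bullet> i - t)) = flat 0 (x \<bullet> (r *\<^sub>R i) + (- r * t))"
     "flat 0 (r * (t - x \<bullet> i)) = flat 0 (x \<bullet> (- r *\<^sub>R i) + r * t)" for x i :: 'a and r t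
    by (auto simp: algebra_simps)
  then have "(\<lambda>x. flat 0 (r * (x \<bullet> i - t))) \<in> flat_algebra"
     "(\<lambda>x. flat 0 (r * (t - x \<bullet> i))) \<in> flat_algebra" for i :: 'a and r t
    by (simp_all only:) (rule flat_algebra.flat)+
  then have "box_bump a b n \<in> flat_algebra"
    unfolding box_bump_def by (intro flat_algebra_prod flat_algebra.mult finite_Basis)
  moreover have "{x. box_bump a b n x \<noteq> 0} \<subseteq> cbox a b"
    by (auto simp: box_bump_def flat_def mem_box zero_less_mult_iff split: if_splits; fastforce)
  then have "closure {x. box_bump a b n x \<noteq> 0} \<subseteq> cbox a b" "bounded {x. box_bump a b n x \<noteq> 0}"
    using closure_minimal[OF _ closed_cbox] bounded_subset[OF bounded_cbox] by blast+
  ultimately show ?thesis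
    using assms flat_algebra_smooth unfolding test_functions_def compact_closure by blast
qed

lemma box_bump_tendsto: "(\<lambda>n. box_bump a b n x) \<longlonglongrightarrow> indicator (box a b) x"
proof (cases "x \<in> box a b")
  case True
  have *: "(\<lambda>n. flat 0 (real (Suc n) * t)) \<longlonglongrightarrow> 1" if "t > 0" for t
  proof -
    have "(\<lambda>n. exp (- (inverse (real (Suc n)) * inverse t))) \<longlonglongrightarrow> exp (- (0 * inverse t))"
      by (intro tendsto_intros LIMSEQ_inverse_real_of_nat)
    then show ?thesis using that by (simp add: flat_def zero_less_mult_iff)
  qed
  have "(\<lambda>n. box_bump a b n x) \<longlonglongrightarrow> (\<Prod>i\<in>(Basis::'a set). 1 * 1)"
    unfolding box_bump_def using True by (intro tendsto_intros *) (auto simp: mem_box)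
  then show ?thesis using True by simp
next
  case False
  then obtain i where i: "i \<in> Basis" "x \<bullet> i \<le> a \<bullet> i \<or> b \<bullet> i \<le> x \<bullet> i" by (auto simp: mem_box not_less)
  then have "box_bump a b n x = 0" for n
    by (auto simp: box_bump_def flat_def zero_less_mult_iff intro!: bexI[of _ i])
  then show ?thesis using False by simp
qed

lemma test_smooth: "\<phi> \<in> test_functions G \<Longrightarrow> smooth \<phi>"
  by (simp add: test_functions_def)

lemma continuous_iterated_partial:
  assumes "smooth \<phi>" "bs \<in> lists Basis"
  shows "continuous_on UNIV (iterated_partial bs \<phi>)"
  using assms
  by (auto simp: smooth_def continuous_on_eq_continuous_within
      intro!: differentiable_imp_continuous_within)

text \<open>The sets over which \<open>f\<close> integrates to zero form a Dynkin system; the boxes generate the Borel sets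
and are stable under intersection, so the sets \<open>f > 0\<close> and \<open>f < 0\<close> are among them.\<close>

lemma AE_zero_if_box_integrals_zero:
  fixes f :: "'a::euclidean_space \<Rightarrow> real"
  assumes f: "integrable lborel f"
    and zero: "\<And>a b. (\<integral>x. f x * indicator (box a b) x \<partial>lborel) = 0"
  shows "AE x in lborel. f x = 0"
proof -
  note [measurable] = borel_measurable_integrable[OF f]
  have int: "integrable lborel (\<lambda>x. f x * indicator A x)" if "A \<in> sets borel" for A
    using f that by (intro integrable_real_mult_indicator) auto
  have UN: "(\<Union>n. box (- (real n *\<^sub>R One)) (real n *\<^sub>R One)) = (UNIV::'a set)"
    by (rule UN_box_eq_UNIV)
  have fzero: "(\<integral>x. f x \<partial>lborel) = 0"
  proof -
    have "(\<lambda>n. \<integral>x. f x * indicator (box (- (real n *\<^sub>R One)) (real n *\<^sub>R One)) x \<partial>lborel) \<longlonglongrightarrow> (\<integral>x. f x \<partial>lborel)"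
    proof (rule integral_dominated_convergence[where w = "\<lambda>x. \<bar>f x\<bar>"])
      show "AE x in lborel. (\<lambda>n. f x * indicator (box (- (real n *\<^sub>R One)) (real n *\<^sub>R One)) x) \<longlonglongrightarrow> f x"
      proof (rule AE_I2)
        fix x :: 'a
        obtain n where n: "x \<in> box (- (real n *\<^sub>R One)) (real n *\<^sub>R One)" using UN by blast
        have "x \<in> box (- (real m *\<^sub>R One)) (real m *\<^sub>R One)" if "m \<ge> n" for m
        proof -
          have "real n \<le> real m" using that by simp
          then show ?thesis using n by (fastforce simp: mem_box)
        qed
        then have "eventually (\<lambda>m. f x * indicator (box (- (real m *\<^sub>R One)) (real m *\<^sub>R One)) x = f x) sequentially"
          by (auto simp: eventually_sequentially intro!: exI[of _ n])
        then show "(\<lambda>n. f x * indicator (box (- (real n *\<^sub>R One)) (real n *\<^sub>R One)) x) \<longlonglongrightarrow> f x"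
          by (rule tendsto_eventually)
      qed
    qed (use f in \<open>auto simp: indicator_def\<close>)
    then show ?thesis by (simp only: zero) (metis LIMSEQ_unique tendsto_const)
  qed
  have all: "(\<integral>x. f x * indicator A x \<partial>lborel) = 0" if "A \<in> sets borel" for A
  proof -
    have "Int_stable (range (\<lambda>(a, b). box a b::'a set))"
      by (auto simp: Int_stable_def box_Int_box)
    moreover have "range (\<lambda>(a, b). box a b::'a set) \<subseteq> Pow UNIV" by simp
    moreover have "A \<in> sigma_sets UNIV (range (\<lambda>(a, b). box a b))"
      using that by (simp add: borel_eq_box)
    ultimately show ?thesis
    proof (induction rule: sigma_sets_induct_disjoint)
      case (basic A) then show ?case using zero by auto
    next
      case empty then show ?case by simp
    next
      case (compl A)
      then have A: "A \<in> sets borel" by (simp add: borel_eq_box)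
      have "(\<integral>x. f x * indicator (UNIV - A) x \<partial>lborel) = (\<integral>x. f x - f x * indicator A x \<partial>lborel)"
        by (intro Bochner_Integration.integral_cong) (auto simp: indicator_def)
      then show ?case using compl f int[OF A] fzero by simp
    next
      case (union A)
      then have A: "A i \<in> sets borel" for i by (auto simp: borel_eq_box)
      have "set_lebesgue_integral lborel (\<Union>i. A i) f = (\<Sum>i. set_lebesgue_integral lborel (A i) f)"
        using A union int[of "\<Union>i. A i"] by (intro lebesgue_integral_countable_add)
          (auto simp: set_integrable_def disjoint_family_on_def mult.commute)
      then show ?case using union by (simp add: set_lebesgue_integral_def mult.commute)
    qed
  qed
  have "AE x in lborel. max 0 (f x) = 0"
  proof (subst integral_nonneg_eq_0_iff_AE[symmetric])
    have "(\<lambda>x. max 0 (f x)) = (\<lambda>x. f x * indicator {x. f x > 0} x)" by (auto simp: indicator_def max_def fun_eq_iff)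
    then show "(\<integral>x. max 0 (f x) \<partial>lborel) = 0" using all[of "{x. f x > 0}"] by simp
  qed (use f in auto)
  moreover have "AE x in lborel. max 0 (- f x) = 0"
  proof (subst integral_nonneg_eq_0_iff_AE[symmetric])
    have "(\<lambda>x. max 0 (- f x)) = (\<lambda>x. - (f x * indicator {x. f x < 0} x))" by (auto simp: indicator_def max_def fun_eq_iff)
    then show "(\<integral>x. max 0 (- f x) \<partial>lborel) = 0" using all[of "{x. f x < 0}"] by simp
  qed (use f in auto)
  ultimately show ?thesis by eventually_elim linarith
qed

lemma AE_box_cbox:
  fixes a b :: "'a::euclidean_space"
  shows "AE x in lborel. x \<in> cbox a b \<longrightarrow> x \<in> box a b"
proof -
  have "emeasure lborel (cbox a b - box a b) = 0"
  proof -
    have "emeasure lborel (cbox a b - box a b) = emeasure lborel (cbox a b) - emeasure lborel (box a b)"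
      using emeasure_lborel_box_finite[of a b] by (intro emeasure_Diff) (auto intro: box_subset_cbox[THEN subsetD])
    then show ?thesis by (simp add: emeasure_lborel_box_eq emeasure_lborel_cbox_eq)
  qed
  then show ?thesis by (intro AE_I[of _ _ "cbox a b - box a b"]) auto
qed

text \<open>Testing against the bumps \<^const>\<open>box_bump\<close> and passing to the limit shows that \<open>f\<close> integrates to
zero over every box whose closure lies in \<open>G\<close>, and \<open>G\<close> is a countable union of closed boxes.\<close>

lemma fundamental_lemma:
  fixes f :: "'a::euclidean_space \<Rightarrow> real"
  assumes f: "integrable lborel f" and G: "open G"
    and zero: "\<And>\<phi>. \<phi> \<in> test_functions G \<Longrightarrow> (\<integral>x. f x * \<phi> x \<partial>lborel) = 0"
  shows "AE x in lborel. x \<in> G \<longrightarrow> f x = 0"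
proof -
  note [measurable] = borel_measurable_integrable[OF f]
  have box0: "(\<integral>x. f x * indicator (box a b) x \<partial>lborel) = 0" if "cbox a b \<subseteq> G" for a b
  proof -
    have [measurable]: "box_bump a b n \<in> borel_measurable borel" for n
      using continuous_iterated_partial[OF test_smooth[OF box_bump_test[OF that]], of "[]" n]
      by (intro borel_measurable_continuous_onI) simp
    have "(\<lambda>n. \<integral>x. f x * box_bump a b n x \<partial>lborel) \<longlonglongrightarrow> (\<integral>x. f x * indicator (box a b) x \<partial>lborel)"
    proof (rule integral_dominated_convergence[where w = "\<lambda>x. \<bar>f x\<bar>"])
      show "AE x in lborel. norm (f x * box_bump a b n x) \<le> \<bar>f x\<bar>" for n
        using box_bump_range[of a b n] by (auto simp: abs_mult intro!: mult_left_le)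
    qed (use f in \<open>auto intro!: tendsto_intros box_bump_tendsto\<close>)
    then show ?thesis by (simp only: zero[OF box_bump_test[OF that]]) (metis LIMSEQ_unique tendsto_const)
  qed
  have cbox: "AE x in lborel. x \<in> cbox c d \<longrightarrow> f x = 0" if cd: "cbox c d \<subseteq> G" for c d
  proof -
    have "AE x in lborel. f x * indicator (box c d) x = 0"
    proof (rule AE_zero_if_box_integrals_zero)
      show "integrable lborel (\<lambda>x. f x * indicator (box c d) x)"
        using f by (intro integrable_real_mult_indicator) auto
      fix a b :: 'a
      obtain a' b' where ab: "box c d \<inter> box a b = box a' b'"
        unfolding box_Int_box by blast
      show "(\<integral>x. f x * indicator (box c d) x * indicator (box a b) x \<partial>lborel) = 0"
      proof (cases "box a' b' = {}")
        case True
        then have 0: "f x * indicator (box c d) x * indicator (box a b) x = 0" for x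
          unfolding mult.assoc indicator_inter_arith[symmetric] ab by simp
        show ?thesis unfolding 0 by simp
      next
        case False
        then have "cbox a' b' \<subseteq> cbox c d"
        proof -
          have "box a' b' \<subseteq> cbox c d" using ab box_subset_cbox[of c d] by blast
          then have "closure (box a' b') \<subseteq> cbox c d" by (rule closure_minimal[OF _ closed_cbox])
          then show ?thesis by (simp add: closure_box[OF False])
        qed
        then have "(\<integral>x. f x * indicator (box a' b') x \<partial>lborel) = 0"
          using cd by (intro box0) auto
        then show ?thesis by (simp add: ab[symmetric] indicator_inter_arith mult_ac)
      qed
    qed
    with AE_box_cbox[of c d] show ?thesis by eventually_elim (auto simp: indicator_def)
  qed
  obtain D where D: "countable D" "D \<subseteq> Pow G" "\<And>X. X \<in> D \<Longrightarrow> \<exists>a b. X = cbox a b" "\<Union>D = G"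
    by (rule open_countable_Union_open_cbox[OF G]) (rule that)
  have "AE x in lborel. \<forall>X\<in>D. x \<in> X \<longrightarrow> f x = 0"
    unfolding AE_ball_countable[OF D(1)]
  proof
    fix X assume X: "X \<in> D"
    then obtain c d where "X = cbox c d" using D(3) by blast
    then show "AE x in lborel. x \<in> X \<longrightarrow> f x = 0" using cbox[of c d] X D(2) by blast
  qed
  then show ?thesis by eventually_elim (use D in blast)
qed

section \<open>Averages along segments and test functions\<close>

text \<open>Lebesgue measure on \<open>[0, 1]\<close>, written as a density so that its \<open>\<sigma>\<close>-algebra is the Borel algebra of
the whole line and measurability does not have to be restated for a subspace.\<close>

definition unit_interval :: "real measure" where
  "unit_interval = density lborel (\<lambda>s. ennreal (indicator {0..1} s))"

lemma sets_unit_interval [measurable_cong, simp]: "sets unit_interval = sets borel"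
  by (simp add: unit_interval_def)

lemma space_unit_interval [simp]: "space unit_interval = UNIV"
  by (simp add: unit_interval_def)

lemma nn_integral_unit_interval:
  "f \<in> borel_measurable borel \<Longrightarrow>
    (\<integral>\<^sup>+s. f s \<partial>unit_interval) = (\<integral>\<^sup>+s. f s * indicator {0..1} s \<partial>lborel)"
  unfolding unit_interval_def
  by (subst nn_integral_density) (auto intro!: nn_integral_cong simp: indicator_def)

lemma emeasure_unit_interval_UNIV: "emeasure unit_interval UNIV = 1"
  using nn_integral_unit_interval[of "\<lambda>_. 1"] by simp

lemma AE_unit_interval:
  "(AE s in unit_interval. P s) \<longleftrightarrow> (AE s in lborel. 0 \<le> s \<longrightarrow> s \<le> 1 \<longrightarrow> P s)"
  unfolding unit_interval_def
  by (subst AE_density) (auto intro!: AE_cong simp: indicator_def split: if_splits)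

lemma integral_unit_interval:
  "f \<in> borel_measurable borel \<Longrightarrow>
    (\<integral>s. f s \<partial>unit_interval) = (\<integral>s. f s * indicator {0..1} s \<partial>lborel)" for f :: "real \<Rightarrow> real"
  unfolding unit_interval_def by (subst integral_density) (auto simp: mult.commute)

interpretation unit_interval: finite_measure unit_interval
  by standard (simp add: emeasure_unit_interval_UNIV)

interpretation line: pair_sigma_finite "lborel :: 'a::euclidean_space measure" unit_interval ..

lemma nn_integral_translate:
  fixes g :: "'a::euclidean_space \<Rightarrow> ennreal"
  assumes [measurable]: "g \<in> borel_measurable borel"
  shows "(\<integral>\<^sup>+x. g (x + c) \<partial>lborel) = (\<integral>\<^sup>+x. g x \<partial>lborel)"
  by (subst (2) lborel_distr_plus[symmetric, of c]) (simp add: nn_integral_distr add.commute)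

lemma
  fixes f :: "'a::euclidean_space \<Rightarrow> real"
  assumes [measurable]: "f \<in> borel_measurable borel"
  shows integral_translate: "(\<integral>x. f (x + c) \<partial>lborel) = (\<integral>x. f x \<partial>lborel)"
    and integrable_translate: "integrable lborel (\<lambda>x. f (x + c)) \<longleftrightarrow> integrable lborel f"
proof -
  show "(\<integral>x. f (x + c) \<partial>lborel) = (\<integral>x. f x \<partial>lborel)"
    by (subst (2) lborel_distr_plus[symmetric, of c]) (simp add: integral_distr add.commute)
  show "integrable lborel (\<lambda>x. f (x + c)) \<longleftrightarrow> integrable lborel f"
    by (subst (2) lborel_distr_plus[symmetric, of c]) (simp add: integrable_distr_eq add.commute)
qed

lemma integrable_lines:
  fixes h :: "'a::euclidean_space \<Rightarrow> real"
  assumes h: "integrable lborel h"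
  shows "integrable (lborel \<Otimes>\<^sub>M unit_interval) (\<lambda>(x, s). h (x + s *\<^sub>R y))"
proof (rule integrableI_bounded)
  note [measurable] = borel_measurable_integrable[OF h]
  show "(\<lambda>(x, s). h (x + s *\<^sub>R y)) \<in> borel_measurable (lborel \<Otimes>\<^sub>M unit_interval)"
    by measurable
  have "(\<integral>\<^sup>+z. ennreal (norm (case z of (x, s) \<Rightarrow> h (x + s *\<^sub>R y))) \<partial>(lborel \<Otimes>\<^sub>M unit_interval))
      = (\<integral>\<^sup>+s. \<integral>\<^sup>+x. ennreal (norm (h (x + s *\<^sub>R y))) \<partial>lborel \<partial>unit_interval)"
    by (subst line.nn_integral_snd[symmetric]) auto
  also have "\<dots> = (\<integral>\<^sup>+s. \<integral>\<^sup>+x. ennreal (norm (h x)) \<partial>lborel \<partial>unit_interval)"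
    by (subst nn_integral_translate[where g = "\<lambda>x. ennreal (norm (h x))"]) auto
  also have "\<dots> < \<infinity>"
    using h by (simp add: emeasure_unit_interval_UNIV integrable_iff_bounded)
  finally show "(\<integral>\<^sup>+z. ennreal (norm (case z of (x, s) \<Rightarrow> h (x + s *\<^sub>R y))) \<partial>(lborel \<Otimes>\<^sub>M unit_interval)) < \<infinity>" .
qed

lemma integrable_bounded_mult:
  fixes f g :: "'a \<Rightarrow> real"
  assumes "integrable M f" "g \<in> borel_measurable M" "\<And>x. \<bar>g x\<bar> \<le> C"
  shows "integrable M (\<lambda>x. f x * g x)"
proof (rule Bochner_Integration.integrable_bound)
  show "integrable M (\<lambda>x. C * f x)" using assms(1) by simp
  show "(\<lambda>x. f x * g x) \<in> borel_measurable M" using assms by measurable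
  have "\<bar>f x\<bar> * \<bar>g x\<bar> \<le> \<bar>f x\<bar> * \<bar>C\<bar>" for x
    using assms(3)[of x] by (intro mult_left_mono) auto
  then show "AE x in M. norm (f x * g x) \<le> norm (C * f x)"
    by (simp add: abs_mult mult.commute)
qed

text \<open>Averaging a function along the segments in direction \<open>y\<close> is adjoint to averaging along the segments
in direction \<open>-y\<close>: Fubini and a translation of the space variable. Both sides are brought into the
same form, in which the outer integral runs over the position on the segment.\<close>

lemma pairing_lines:
  fixes h \<psi> :: "'a::euclidean_space \<Rightarrow> real"
  assumes h: "integrable lborel h" and \<psi>[measurable]: "\<psi> \<in> borel_measurable borel"
    and C: "\<And>x. \<bar>\<psi> x\<bar> \<le> C"
  shows "(\<integral>x. (\<integral>s. h (x + s *\<^sub>R y) \<partial>unit_interval) * \<psi> x \<partial>lborel) =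
      (\<integral>s. (\<integral>x. h x * \<psi> (x - s *\<^sub>R y) \<partial>lborel) \<partial>unit_interval)" (is ?eq)
    and "(\<integral>x. h x * (\<integral>s. \<psi> (x - s *\<^sub>R y) \<partial>unit_interval) \<partial>lborel) =
      (\<integral>s. (\<integral>x. h x * \<psi> (x - s *\<^sub>R y) \<partial>lborel) \<partial>unit_interval)" (is ?eq2)
proof -
  note [measurable] = borel_measurable_integrable[OF h]
  have int: "integrable (lborel \<Otimes>\<^sub>M unit_interval) (\<lambda>(x, s). h (x + s *\<^sub>R y) * \<psi> x)"
    using integrable_bounded_mult[OF integrable_lines[OF h], of "\<lambda>(x, s). \<psi> x"] C
    by (auto simp: case_prod_unfold)
  have "(\<integral>x. (\<integral>s. h (x + s *\<^sub>R y) \<partial>unit_interval) * \<psi> x \<partial>lborel) =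
      (\<integral>x. (\<integral>s. h (x + s *\<^sub>R y) * \<psi> x \<partial>unit_interval) \<partial>lborel)"
    by simp
  also have "\<dots> = (\<integral>s. (\<integral>x. h (x + s *\<^sub>R y) * \<psi> x \<partial>lborel) \<partial>unit_interval)"
    using line.Fubini_integral[OF int] by simp
  also have "\<dots> = (\<integral>s. (\<integral>x. h x * \<psi> (x - s *\<^sub>R y) \<partial>lborel) \<partial>unit_interval)"
  proof (rule Bochner_Integration.integral_cong[OF refl])
    fix s
    show "(\<integral>x. h (x + s *\<^sub>R y) * \<psi> x \<partial>lborel) = (\<integral>x. h x * \<psi> (x - s *\<^sub>R y) \<partial>lborel)"
      using integral_translate[of "\<lambda>x. h x * \<psi> (x - s *\<^sub>R y)" "s *\<^sub>R y"] by simp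
  qed
  finally show ?eq .
  have int2: "integrable (lborel \<Otimes>\<^sub>M unit_interval) (\<lambda>(x, s). h x * \<psi> (x - s *\<^sub>R y))"
    using integrable_bounded_mult[OF integrable_lines[OF h, of 0], of "\<lambda>(x, s). \<psi> (x - s *\<^sub>R y)"] C
    by (auto simp: case_prod_unfold)
  show ?eq2
    using line.Fubini_integral[OF int2] by simp
qed

lemma has_derivative_smooth:
  assumes "smooth \<phi>"
  shows "(\<phi> has_derivative (\<lambda>h. partial_deriv h \<phi> x)) (at x)"
proof -
  have "\<phi> differentiable (at x)"
    using assms unfolding smooth_def
    by (auto dest: bspec[of _ _ "[]"])
  then show ?thesis by (simp add: partial_deriv_def[abs_def] frechet_derivative_works)
qed

lemma partial_deriv_smooth_linear:
  assumes "smooth \<phi>"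
  shows "partial_deriv y \<phi> x = (\<Sum>b\<in>Basis. (y \<bullet> b) * partial_deriv b \<phi> x)"
proof -
  have "linear (\<lambda>h. partial_deriv h \<phi> x)"
    using has_derivative_smooth[OF assms] has_derivative_linear by blast
  then show ?thesis
    using linear_sum[of "\<lambda>h. partial_deriv h \<phi> x" "\<lambda>b. (y \<bullet> b) *\<^sub>R b" Basis]
      linear_cmul[of "\<lambda>h. partial_deriv h \<phi> x"]
    by (simp add: euclidean_representation)
qed

lemma continuous_smooth:
  assumes "smooth \<phi>"
  shows "continuous_on S \<phi>" "continuous_on S (partial_deriv y \<phi>)"
proof -
  show "continuous_on S \<phi>"
    using continuous_on_subset[OF continuous_iterated_partial[OF assms, of "[]"] subset_UNIV] by simp
  have "continuous_on S (partial_deriv b \<phi>)" if "b \<in> Basis" for b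
    using continuous_on_subset[OF continuous_iterated_partial[OF assms, of "[b]"] subset_UNIV] that by simp
  then have "continuous_on S (\<lambda>x. \<Sum>b\<in>Basis. (y \<bullet> b) * partial_deriv b \<phi> x)"
    by (intro continuous_intros) auto
  then show "continuous_on S (partial_deriv y \<phi>)"
    by (simp only: partial_deriv_smooth_linear[OF assms, of y, symmetric])
qed

lemmas has_derivative_test = has_derivative_smooth[OF test_smooth]
  and partial_deriv_linear = partial_deriv_smooth_linear[OF test_smooth]
  and continuous_test = continuous_smooth[OF test_smooth]

lemma test_support:
  assumes "\<phi> \<in> test_functions G"
  obtains K where "compact K" "K \<subseteq> G" "\<And>x. x \<notin> K \<Longrightarrow> \<phi> x = 0" "\<And>x y. x \<notin> K \<Longrightarrow> partial_deriv y \<phi> x = 0"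
proof (rule that)
  let ?K = "closure {x. \<phi> x \<noteq> 0}"
  show "compact ?K" "?K \<subseteq> G" using assms by (simp_all add: test_functions_def)
  show "\<phi> x = 0" if "x \<notin> ?K" for x
    using that closure_subset[of "{x. \<phi> x \<noteq> 0}"] by auto
  fix x y assume x: "x \<notin> ?K"
  have "((\<lambda>x. 0::real) has_derivative (\<lambda>h. 0)) (at x)" by simp
  then have "(\<phi> has_derivative (\<lambda>h. 0)) (at x)"
  proof (rule has_derivative_transform_within_open)
    show "open (- ?K)" "x \<in> - ?K" using x by auto
    show "0 = \<phi> z" if "z \<in> - ?K" for z using that closure_subset[of "{x. \<phi> x \<noteq> 0}"] by auto
  qed
  from partial_deriv_eq[OF this] show "partial_deriv y \<phi> x = 0" .
qed

lemma bounded_test: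
  assumes "\<phi> \<in> test_functions G"
  obtains C where "\<And>x. \<bar>\<phi> x\<bar> \<le> C" "\<And>x. \<bar>partial_deriv y \<phi> x\<bar> \<le> C"
proof -
  obtain K where K0: "compact K" "K \<subseteq> G" "\<And>x. x \<notin> K \<Longrightarrow> \<phi> x = 0" "\<And>x y. x \<notin> K \<Longrightarrow> partial_deriv y \<phi> x = 0"
    by (rule test_support[OF assms]) (rule that)
  note K = K0(1,3,4)
  have "bounded (\<phi> ` K)" "bounded (partial_deriv y \<phi> ` K)"
    by (intro compact_imp_bounded compact_continuous_image continuous_test[OF assms] K)+
  then obtain C1 C2 where "\<And>x. x \<in> K \<Longrightarrow> \<bar>\<phi> x\<bar> \<le> C1" "\<And>x. x \<in> K \<Longrightarrow> \<bar>partial_deriv y \<phi> x\<bar> \<le> C2"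
    by (auto simp: bounded_iff)
  then have "\<bar>\<phi> x\<bar> \<le> max 0 (max C1 C2)" "\<bar>partial_deriv y \<phi> x\<bar> \<le> max 0 (max C1 C2)" for x
    using K(2)[of x] K(3)[of x y] by (cases "x \<in> K"; fastforce simp: le_max_iff_disj)+
  then show ?thesis by (rule that)
qed

lemma iterated_partial_append:
  "iterated_partial as (iterated_partial bs f) = iterated_partial (as @ bs) f"
  by (induction as) auto

lemma partial_deriv_test:
  assumes "\<phi> \<in> test_functions G" "b \<in> Basis"
  shows "partial_deriv b \<phi> \<in> test_functions G"
proof -
  have "smooth (iterated_partial [b] \<phi>)"
    using assms unfolding test_functions_def smooth_def iterated_partial_append
    by auto
  moreover obtain K where K0: "compact K" "K \<subseteq> G" "\<And>x. x \<notin> K \<Longrightarrow> \<phi> x = 0" "\<And>x y. x \<notin> K \<Longrightarrow> partial_deriv y \<phi> x = 0"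
    by (rule test_support[OF assms(1)]) (rule that)
  note K = K0(1,2) K0(4)[of _ b]
  from K(3) have "{x. partial_deriv b \<phi> x \<noteq> 0} \<subseteq> K" by blast
  then have "closure {x. partial_deriv b \<phi> x \<noteq> 0} \<subseteq> K" "bounded {x. partial_deriv b \<phi> x \<noteq> 0}"
    using closure_minimal[OF _ compact_imp_closed[OF K(1)]] bounded_subset[OF compact_imp_bounded[OF K(1)]]
    by blast+
  ultimately show ?thesis
    using K(2) unfolding test_functions_def compact_closure by auto
qed

lemma has_derivative_translate:
  fixes f :: "'a::real_normed_vector \<Rightarrow> 'b::real_normed_vector"
  assumes "(f has_derivative f') (at (x - z))"
  shows "((\<lambda>x. f (x - z)) has_derivative f') (at x)"
proof -
  have "((\<lambda>x. x - z) has_derivative (\<lambda>h. h)) (at x)"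
    by (auto intro!: derivative_eq_intros)
  from has_derivative_compose[OF this assms] show ?thesis by simp
qed

lemma iterated_partial_translate:
  assumes "smooth \<phi>" "bs \<in> lists Basis"
  shows "iterated_partial bs (\<lambda>x. \<phi> (x - z)) = (\<lambda>x. iterated_partial bs \<phi> (x - z))"
  using assms(2)
proof (induction bs)
  case (Cons b bs)
  have D: "(iterated_partial bs \<phi> has_derivative frechet_derivative (iterated_partial bs \<phi>) (at (x - z))) (at (x - z))" for x
    using assms(1) Cons by (auto simp: smooth_def frechet_derivative_works)
  have "((\<lambda>x. iterated_partial bs \<phi> (x - z)) has_derivative
      frechet_derivative (iterated_partial bs \<phi>) (at (x - z))) (at x)" for x
    by (rule has_derivative_translate[OF D])
  note partial_deriv_eq[OF this]
  moreover have "iterated_partial bs (\<lambda>x. \<phi> (x - z)) = (\<lambda>x. iterated_partial bs \<phi> (x - z))"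
    using Cons by simp
  ultimately show ?case
    by (simp add: partial_deriv_def[of b "iterated_partial bs \<phi>"])
qed simp

text \<open>A translation carries test functions on \<open>G\<close> to test functions on any set that contains the
translate of \<open>G\<close>; this is how an identity that is tested in \<open>\<Omega>\<close> is moved along a segment.\<close>

lemma translate_test:
  assumes "\<phi> \<in> test_functions G" "\<And>x. x \<in> G \<Longrightarrow> x + z \<in> H"
  shows "(\<lambda>x. \<phi> (x - z)) \<in> test_functions H"
    and "partial_deriv y (\<lambda>x. \<phi> (x - z)) x = partial_deriv y \<phi> (x - z)"
proof -
  have sm: "smooth \<phi>" using assms by (simp add: test_functions_def)
  have "smooth (\<lambda>x. \<phi> (x - z))"
    unfolding smooth_def
  proof (intro ballI allI)
    fix bs :: "'a list" and x :: 'a assume bs: "bs \<in> lists Basis"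
    have "iterated_partial bs \<phi> differentiable at (x - z)" using sm bs by (simp add: smooth_def)
    then have "(\<lambda>x. iterated_partial bs \<phi> (x - z)) differentiable at x"
      unfolding differentiable_def by (blast intro: has_derivative_translate)
    then show "iterated_partial bs (\<lambda>x. \<phi> (x - z)) differentiable at x"
      by (simp add: iterated_partial_translate[OF sm bs])
  qed
  moreover obtain K where K0: "compact K" "K \<subseteq> G" "\<And>x. x \<notin> K \<Longrightarrow> \<phi> x = 0" "\<And>x y. x \<notin> K \<Longrightarrow> partial_deriv y \<phi> x = 0"
    by (rule test_support[OF assms(1)]) (rule that)
  note K = K0(1-3)
  have "compact ((+) z ` K)" by (rule compact_translation[OF K(1)])
  moreover have sub: "{x. \<phi> (x - z) \<noteq> 0} \<subseteq> (+) z ` K"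
  proof
    fix x assume "x \<in> {x. \<phi> (x - z) \<noteq> 0}"
    then have "x - z \<in> K" using K(3) by blast
    then show "x \<in> (+) z ` K" by (intro image_eqI[of _ _ "x - z"]) auto
  qed
  moreover have "(+) z ` K \<subseteq> H" using K(2) assms(2) by (auto simp: add.commute)
  ultimately show "(\<lambda>x. \<phi> (x - z)) \<in> test_functions H"
    using closure_minimal[OF sub compact_imp_closed] bounded_subset[OF compact_imp_bounded sub]
    unfolding test_functions_def compact_closure by (auto 0 2)
  have "((\<lambda>x. \<phi> (x - z)) has_derivative (\<lambda>h. partial_deriv h \<phi> (x - z))) (at x)"
    by (rule has_derivative_translate[OF has_derivative_test[OF assms(1)]])
  from partial_deriv_eq[OF this] show "partial_deriv y (\<lambda>x. \<phi> (x - z)) x = partial_deriv y \<phi> (x - z)" .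
qed

lemma test_FTC:
  assumes "\<phi> \<in> test_functions G"
  shows "(\<integral>s. partial_deriv y \<phi> (x - s *\<^sub>R y) \<partial>unit_interval) = \<phi> x - \<phi> (x - y)"
proof -
  have "continuous_on UNIV (\<lambda>s. x - s *\<^sub>R y)" by (intro continuous_intros)
  then have cont: "continuous_on UNIV (\<lambda>s. partial_deriv y \<phi> (x - s *\<^sub>R y))"
    by (rule continuous_on_compose2[OF continuous_test(2)[OF assms, of UNIV]]) simp
  then have c: "isCont (\<lambda>s. partial_deriv y \<phi> (x - s *\<^sub>R y)) s" for s
    by (simp add: continuous_on_eq_continuous_at)
  have lin: "linear (\<lambda>h. partial_deriv h \<phi> z)" for z
    using has_derivative_test[OF assms] has_derivative_linear by blast
  have "((\<lambda>s. - \<phi> (x - s *\<^sub>R y)) has_real_derivative partial_deriv y \<phi> (x - s *\<^sub>R y)) (at s)" for s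
  proof -
    have "((\<lambda>s. x - s *\<^sub>R y) has_derivative (\<lambda>h. - h *\<^sub>R y)) (at s)"
      by (auto intro!: derivative_eq_intros)
    from has_derivative_compose[OF this has_derivative_test[OF assms]]
    have "((\<lambda>s. - \<phi> (x - s *\<^sub>R y)) has_derivative (\<lambda>h. - partial_deriv (- h *\<^sub>R y) \<phi> (x - s *\<^sub>R y))) (at s)"
      by (rule has_derivative_minus)
    moreover have "- partial_deriv (- h *\<^sub>R y) \<phi> (x - s *\<^sub>R y) = partial_deriv y \<phi> (x - s *\<^sub>R y) * h" for h
      using linear_cmul[OF lin, of "- h" y] by simp
    ultimately show ?thesis unfolding has_field_derivative_def by simp
  qed
  then have "(\<integral>s. partial_deriv y \<phi> (x - s *\<^sub>R y) * indicator {0..1} s \<partial>lborel) =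
      - \<phi> (x - 1 *\<^sub>R y) - (- \<phi> (x - 0 *\<^sub>R y))"
    by (intro integral_FTC_Icc_real c) simp_all
  moreover have "(\<lambda>s. partial_deriv y \<phi> (x - s *\<^sub>R y)) \<in> borel_measurable borel"
    by (rule borel_measurable_continuous_onI[OF cont])
  ultimately show ?thesis by (simp add: integral_unit_interval)
qed

section \<open>Weak derivatives as increments along lines, and the product rule\<close>

text \<open>Weak first derivatives in an arbitrary direction \<open>y\<close>, for functions that are integrable on the whole
space. On a bounded \<open>\<Omega>\<close> every \<open>L\<^sup>p\<close> function, extended by zero, is of this kind, so local
integrability does not enter before the final transfer.\<close>

definition weak_partial :: "'a::euclidean_space set \<Rightarrow> 'a \<Rightarrow> ('a \<Rightarrow> real) \<Rightarrow> ('a \<Rightarrow> real) \<Rightarrow> bool" where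
  "weak_partial \<Omega> y u g \<longleftrightarrow> integrable lborel u \<and> integrable lborel g \<and>
    (\<forall>\<phi>\<in>test_functions \<Omega>. (\<integral>x. u x * partial_deriv y \<phi> x \<partial>lborel) = - (\<integral>x. g x * \<phi> x \<partial>lborel))"

definition line_domain :: "'a::euclidean_space set \<Rightarrow> 'a \<Rightarrow> 'a set" where
  "line_domain \<Omega> y = {x. \<forall>s\<in>{0..1}. x + s *\<^sub>R y \<in> \<Omega>}"

lemma open_line_domain:
  assumes "open \<Omega>"
  shows "open (line_domain \<Omega> y)"
  unfolding open_contains_ball
proof
  fix x assume x: "x \<in> line_domain \<Omega> y"
  let ?S = "(\<lambda>s. x + s *\<^sub>R y) ` {0..1}"
  have "compact ?S" by (intro compact_continuous_image continuous_intros) auto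
  moreover have "?S \<subseteq> \<Omega>" using x by (auto simp: line_domain_def)
  ultimately obtain e where e: "e > 0" "(\<Union>z\<in>?S. ball z e) \<subseteq> \<Omega>"
    using compact_subset_open_imp_ball_epsilon_subset[OF _ assms] by blast
  have "ball x e \<subseteq> line_domain \<Omega> y"
  proof
    fix z assume z: "z \<in> ball x e"
    have "z + s *\<^sub>R y \<in> ball (x + s *\<^sub>R y) e" for s using z by (simp add: dist_norm)
    then show "z \<in> line_domain \<Omega> y" using e(2) unfolding line_domain_def by blast
  qed
  then show "\<exists>e>0. ball x e \<subseteq> line_domain \<Omega> y" using e(1) by blast
qed

lemma line_domain_scale:
  assumes "0 \<le> r" "r \<le> 1"
  shows "line_domain \<Omega> y \<subseteq> line_domain \<Omega> (r *\<^sub>R y)"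
proof
  fix x assume x: "x \<in> line_domain \<Omega> y"
  have "s * r \<in> {0..1}" if "s \<in> {0..1}" for s using that assms by (auto intro: mult_le_one)
  then show "x \<in> line_domain \<Omega> (r *\<^sub>R y)" using x by (auto simp: line_domain_def)
qed

lemma measurable_test:
  assumes "\<phi> \<in> test_functions G"
  shows "\<phi> \<in> borel_measurable borel" "partial_deriv y \<phi> \<in> borel_measurable borel"
  by (rule borel_measurable_continuous_onI continuous_test[OF assms])+

lemma integrable_line_average:
  fixes h :: "'a::euclidean_space \<Rightarrow> real"
  assumes h: "integrable lborel h"
  shows "integrable lborel (\<lambda>x. \<integral>s. h (x + s *\<^sub>R y) \<partial>unit_interval)"
    and "AE x in lborel. integrable unit_interval (\<lambda>s. h (x + s *\<^sub>R y))"
  using line.integrable_fst'[OF integrable_lines[OF h]] line.AE_integrable_fst'[OF integrable_lines[OF h]]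
  by simp_all

text \<open>The weak derivative gives the increments of \<open>u\<close> along segments. For a test function \<open>\<phi>\<close> on the open
set of base points whose segment lies in \<open>\<Omega>\<close>, the fundamental theorem of calculus writes
\<open>\<phi> x - \<phi> (x - y)\<close> as an average of derivatives of translates of \<open>\<phi>\<close>. These translates are test
functions on \<open>\<Omega>\<close>, so the definition of the weak derivative applies to each of them, and the
fundamental lemma concludes.\<close>

lemma weak_partial_lines:
  fixes u g :: "'a::euclidean_space \<Rightarrow> real"
  assumes \<Omega>: "open \<Omega>" and w: "weak_partial \<Omega> y u g"
  shows "AE x in lborel. x \<in> line_domain \<Omega> y \<longrightarrow>
      u (x + y) - u x = (\<integral>s. g (x + s *\<^sub>R y) \<partial>unit_interval)"
proof -
  have u: "integrable lborel u" and g: "integrable lborel g" using w by (auto simp: weak_partial_def)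
  note [measurable] = borel_measurable_integrable[OF u] borel_measurable_integrable[OF g]
  have uy: "integrable lborel (\<lambda>x. u (x + y))" using u by (simp add: integrable_translate)
  let ?A = "\<lambda>x. \<integral>s. g (x + s *\<^sub>R y) \<partial>unit_interval"
  have "AE x in lborel. x \<in> line_domain \<Omega> y \<longrightarrow> u (x + y) - u x - ?A x = 0"
  proof (rule fundamental_lemma)
    show "integrable lborel (\<lambda>x. u (x + y) - u x - ?A x)"
      using u uy integrable_line_average[OF g, of y] by simp
    show "open (line_domain \<Omega> y)" by (rule open_line_domain[OF \<Omega>])
    fix \<phi> assume \<phi>: "\<phi> \<in> test_functions (line_domain \<Omega> y)"
    note [measurable] = measurable_test[OF \<phi>]
    obtain C where C: "\<And>x. \<bar>\<phi> x\<bar> \<le> C" "\<And>x. \<bar>partial_deriv y \<phi> x\<bar> \<le> C"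
      by (rule bounded_test[OF \<phi>, of y]) (rule that)
    have int: "integrable lborel (\<lambda>x. f x * \<phi> (x - z))" if "integrable lborel f" for f z
      using that by (rule integrable_bounded_mult) (use C in auto)
    have "(\<integral>x. (u (x + y) - u x - ?A x) * \<phi> x \<partial>lborel) =
        (\<integral>x. u (x + y) * \<phi> x \<partial>lborel) - (\<integral>x. u x * \<phi> x \<partial>lborel) - (\<integral>x. ?A x * \<phi> x \<partial>lborel)"
      using int[OF u, of 0] int[OF uy, of 0] int[OF integrable_line_average(1)[OF g, of y], of 0]
      by (simp add: left_diff_distrib)
    also have "(\<integral>x. u (x + y) * \<phi> x \<partial>lborel) = (\<integral>x. u x * \<phi> (x - y) \<partial>lborel)"
      using integral_translate[of "\<lambda>x. u x * \<phi> (x - y)" y] by simp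
    also have "(\<integral>x. u x * \<phi> (x - y) \<partial>lborel) - (\<integral>x. u x * \<phi> x \<partial>lborel) =
       - (\<integral>x. u x * (\<integral>s. partial_deriv y \<phi> (x - s *\<^sub>R y) \<partial>unit_interval) \<partial>lborel)"
      using int[OF u, of 0] int[OF u, of y] by (simp add: test_FTC[OF \<phi>] right_diff_distrib)
    also have "\<dots> = - (\<integral>s. (\<integral>x. u x * partial_deriv y \<phi> (x - s *\<^sub>R y) \<partial>lborel) \<partial>unit_interval)"
      by (subst pairing_lines(2)[OF u _ C(2)]) auto
    also have "(\<integral>s. (\<integral>x. u x * partial_deriv y \<phi> (x - s *\<^sub>R y) \<partial>lborel) \<partial>unit_interval) =
      (\<integral>s. - (\<integral>x. g x * \<phi> (x - s *\<^sub>R y) \<partial>lborel) \<partial>unit_interval)"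
    proof (rule integral_cong_AE)
      have "(\<integral>x. u x * partial_deriv y \<phi> (x - s *\<^sub>R y) \<partial>lborel) = - (\<integral>x. g x * \<phi> (x - s *\<^sub>R y) \<partial>lborel)"
        if "0 \<le> s" "s \<le> 1" for s
      proof -
        have *: "x + s *\<^sub>R y \<in> \<Omega>" if "x \<in> line_domain \<Omega> y" for x
          using that \<open>0 \<le> s\<close> \<open>s \<le> 1\<close> by (auto simp: line_domain_def)
        note t = translate_test[OF \<phi>, of "s *\<^sub>R y" \<Omega>, OF *]
        show ?thesis using w t(1) unfolding weak_partial_def by (auto simp: t(2) dest!: bspec[of _ _ "\<lambda>x. \<phi> (x - s *\<^sub>R y)"])
      qed
      then show "AE s in unit_interval. (\<integral>x. u x * partial_deriv y \<phi> (x - s *\<^sub>R y) \<partial>lborel) = - (\<integral>x. g x * \<phi> (x - s *\<^sub>R y) \<partial>lborel)"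
        by (auto simp: AE_unit_interval)
    qed measurable
    also have "(\<integral>x. ?A x * \<phi> x \<partial>lborel) = (\<integral>s. (\<integral>x. g x * \<phi> (x - s *\<^sub>R y) \<partial>lborel) \<partial>unit_interval)"
      by (rule pairing_lines(1)[OF g _ C(1)]) auto
    finally show "(\<integral>x. (u (x + y) - u x - ?A x) * \<phi> x \<partial>lborel) = 0" by simp
  qed
  then show ?thesis by eventually_elim simp
qed

lemma pairing_tendsto:
  fixes f \<psi> :: "'a::euclidean_space \<Rightarrow> real"
  assumes f: "integrable lborel f" and \<psi>: "continuous_on UNIV \<psi>" and C: "\<And>x. \<bar>\<psi> x\<bar> \<le> C"
    and t: "t \<longlonglongrightarrow> 0"
  shows "(\<lambda>n. \<integral>x. f x * (\<integral>s. \<psi> (x - s *\<^sub>R (t n *\<^sub>R y)) \<partial>unit_interval) \<partial>lborel)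
      \<longlonglongrightarrow> (\<integral>x. f x * \<psi> x \<partial>lborel)"
proof -
  note [measurable] = borel_measurable_continuous_onI[OF \<psi>] borel_measurable_integrable[OF f]
  have C0: "C \<ge> 0" using C[of 0] by linarith
  have inner: "(\<lambda>n. \<integral>s. \<psi> (x - s *\<^sub>R (t n *\<^sub>R y)) \<partial>unit_interval) \<longlonglongrightarrow> (\<integral>s. \<psi> x \<partial>unit_interval)" for x
  proof (rule integral_dominated_convergence[where w = "\<lambda>_. C"])
    have "(\<lambda>n. \<psi> (x - s *\<^sub>R (t n *\<^sub>R y))) \<longlonglongrightarrow> \<psi> x" for s
    proof (rule continuous_on_tendsto_compose[OF \<psi>])
      have "(\<lambda>n. x - s *\<^sub>R (t n *\<^sub>R y)) \<longlonglongrightarrow> x - s *\<^sub>R (0 *\<^sub>R y)" by (intro tendsto_intros t)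
      then show "(\<lambda>n. x - s *\<^sub>R (t n *\<^sub>R y)) \<longlonglongrightarrow> x" by simp
    qed auto
    then show "AE s in unit_interval. (\<lambda>n. \<psi> (x - s *\<^sub>R (t n *\<^sub>R y))) \<longlonglongrightarrow> \<psi> x" by simp
    show "AE s in unit_interval. norm (\<psi> (x - s *\<^sub>R (t n *\<^sub>R y))) \<le> C" for n using C by simp
    show "(\<lambda>s. \<psi> (x - s *\<^sub>R (t n *\<^sub>R y))) \<in> borel_measurable unit_interval" for n
    proof -
      define z where "z = t n *\<^sub>R y"
      show ?thesis unfolding z_def[symmetric] by measurable
    qed
  qed auto
  have one: "measure unit_interval UNIV = 1"
    by (simp add: measure_def emeasure_unit_interval_UNIV)
  have bound: "\<bar>\<integral>s. \<psi> (x - s *\<^sub>R z) \<partial>unit_interval\<bar> \<le> C" for x z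
  proof -
    have "\<bar>\<integral>s. \<psi> (x - s *\<^sub>R z) \<partial>unit_interval\<bar> \<le> (\<integral>s. C \<partial>unit_interval)"
      using C C0 by (intro integral_abs_bound_integral AE_I2 unit_interval.integrable_const_bound[of _ C]) auto
    then show ?thesis using one by simp
  qed
  show ?thesis
  proof (rule integral_dominated_convergence[where w = "\<lambda>x. C * \<bar>f x\<bar>"])
    show "AE x in lborel. (\<lambda>n. f x * (\<integral>s. \<psi> (x - s *\<^sub>R (t n *\<^sub>R y)) \<partial>unit_interval)) \<longlonglongrightarrow> f x * \<psi> x"
      using inner one by (auto intro!: tendsto_mult)
    show "AE x in lborel. norm (f x * (\<integral>s. \<psi> (x - s *\<^sub>R (t n *\<^sub>R y)) \<partial>unit_interval)) \<le> C * \<bar>f x\<bar>" for n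
    proof (rule AE_I2)
      fix x
      have "\<bar>f x\<bar> * \<bar>\<integral>s. \<psi> (x - s *\<^sub>R (t n *\<^sub>R y)) \<partial>unit_interval\<bar> \<le> \<bar>f x\<bar> * C"
        by (rule mult_left_mono[OF bound abs_ge_zero])
      then show "norm (f x * (\<integral>s. \<psi> (x - s *\<^sub>R (t n *\<^sub>R y)) \<partial>unit_interval)) \<le> C * \<bar>f x\<bar>"
        by (simp only: real_norm_def abs_mult mult.commute[of C])
    qed
  qed (use f in auto)
qed

text \<open>Conversely, increments along all short segments determine the weak derivative: pair the increments
with \<open>\<phi>\<close>, move the difference quotient to \<open>\<phi>\<close>, and let the length \<open>t\<close> of the segments tend to zero.
Together with the previous description this takes the place of mollification: an identity between
indefinite integrals on segments becomes an identity between weak derivatives.\<close>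

lemma weak_partial_if_lines:
  fixes u g :: "'a::euclidean_space \<Rightarrow> real"
  assumes \<Omega>: "open \<Omega>" and u: "integrable lborel u" and g: "integrable lborel g"
    and lines: "\<And>t. 0 < t \<Longrightarrow> t \<le> 1 \<Longrightarrow> AE x in lborel. x \<in> line_domain \<Omega> (t *\<^sub>R y) \<longrightarrow>
      u (x + t *\<^sub>R y) - u x = (\<integral>s. t * g (x + s *\<^sub>R (t *\<^sub>R y)) \<partial>unit_interval)"
  shows "weak_partial \<Omega> y u g"
  unfolding weak_partial_def
proof (intro conjI ballI u g)
  note [measurable] = borel_measurable_integrable[OF u] borel_measurable_integrable[OF g]
  fix \<phi> assume \<phi>: "\<phi> \<in> test_functions \<Omega>"
  note [measurable] = measurable_test[OF \<phi>]
  obtain C where C: "\<And>x. \<bar>\<phi> x\<bar> \<le> C" "\<And>x. \<bar>partial_deriv y \<phi> x\<bar> \<le> C"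
    by (rule bounded_test[OF \<phi>, of y]) (rule that)
  obtain K where K: "compact K" "K \<subseteq> \<Omega>" "\<And>x. x \<notin> K \<Longrightarrow> \<phi> x = 0"
    by (rule test_support[OF \<phi>]) (rule that)
  obtain e where e: "e > 0" "(\<Union>z\<in>K. ball z e) \<subseteq> \<Omega>"
    using compact_subset_open_imp_ball_epsilon_subset[OF K(1) \<Omega> K(2)] by blast
  have int: "integrable lborel (\<lambda>x. f x * \<phi> (x - z))" if "integrable lborel f" for f z
    using that by (rule integrable_bounded_mult) (use C in auto)
  let ?U = "\<lambda>t. \<integral>x. u x * (\<integral>s. partial_deriv y \<phi> (x - s *\<^sub>R (t *\<^sub>R y)) \<partial>unit_interval) \<partial>lborel"
  let ?G = "\<lambda>t. \<integral>x. g x * (\<integral>s. \<phi> (x - s *\<^sub>R (t *\<^sub>R y)) \<partial>unit_interval) \<partial>lborel"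
  have eq: "?U t = - ?G t" if t: "0 < t" "t \<le> 1" "t * norm y < e" for t
  proof -
    let ?z = "t *\<^sub>R y"
    have dom: "x \<in> line_domain \<Omega> ?z" if "x \<in> K" for x
      unfolding line_domain_def
    proof safe
      fix s :: real assume s: "s \<in> {0..1}"
      have "s * (t * norm y) \<le> t * norm y" using s t by (intro mult_left_le_one_le) auto
      moreover have "norm (s *\<^sub>R ?z) = s * (t * norm y)" using s t by simp
      ultimately have "norm (s *\<^sub>R ?z) < e" using t(3) by linarith
      then have "x + s *\<^sub>R ?z \<in> ball x e" by (simp add: dist_norm)
      then show "x + s *\<^sub>R ?z \<in> \<Omega>" using e that by blast
    qed
    have pt: "partial_deriv ?z \<phi> x = t * partial_deriv y \<phi> x" for x
      unfolding partial_deriv_linear[OF \<phi>, of ?z] partial_deriv_linear[OF \<phi>, of y]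
      by (simp add: sum_distrib_left mult.assoc)
    have uy: "integrable lborel (\<lambda>x. u (x + ?z))" using u by (simp add: integrable_translate)
    have "t * ?U t = (\<integral>x. u x * (\<integral>s. partial_deriv ?z \<phi> (x - s *\<^sub>R ?z) \<partial>unit_interval) \<partial>lborel)"
      by (simp add: pt mult.left_commute)
    also have "\<dots> = (\<integral>x. u x * \<phi> x \<partial>lborel) - (\<integral>x. u x * \<phi> (x - ?z) \<partial>lborel)"
      unfolding test_FTC[OF \<phi>] using int[OF u, of 0] int[OF u, of ?z] by (simp add: right_diff_distrib)
    also have "(\<integral>x. u x * \<phi> (x - ?z) \<partial>lborel) = (\<integral>x. u (x + ?z) * \<phi> x \<partial>lborel)"
      using integral_translate[of "\<lambda>x. u x * \<phi> (x - ?z)" ?z] by simp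
    also have "(\<integral>x. u x * \<phi> x \<partial>lborel) - (\<integral>x. u (x + ?z) * \<phi> x \<partial>lborel) =
       - (\<integral>x. (u (x + ?z) - u x) * \<phi> x \<partial>lborel)"
      using int[OF u, of 0] int[OF uy, of 0] by (simp add: left_diff_distrib)
    also have "(\<integral>x. (u (x + ?z) - u x) * \<phi> x \<partial>lborel) =
       (\<integral>x. (\<integral>s. t * g (x + s *\<^sub>R ?z) \<partial>unit_interval) * \<phi> x \<partial>lborel)"
    proof (rule integral_cong_AE)
      show "AE x in lborel. (u (x + ?z) - u x) * \<phi> x = (\<integral>s. t * g (x + s *\<^sub>R ?z) \<partial>unit_interval) * \<phi> x"
        using lines[OF t(1,2)]
      proof eventually_elim
        case (elim x) then show ?case using dom[of x] K(3)[of x] by (cases "x \<in> K") auto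
      qed
    qed measurable
    also have "\<dots> = t * ?G t"
      using pairing_lines[OF g measurable_test(1)[OF \<phi>] C(1), of ?z] by (simp add: mult.assoc)
    finally have "t * ?U t = t * (- ?G t)" by simp
    then show ?thesis using t(1) unfolding mult_cancel_left by linarith
  qed
  define \<tau> where "\<tau> n = inverse (real (Suc n))" for n
  have \<tau>: "\<tau> \<longlonglongrightarrow> 0" unfolding \<tau>_def by (rule LIMSEQ_inverse_real_of_nat)
  have "(\<lambda>n. \<tau> n * norm y) \<longlonglongrightarrow> 0 * norm y" by (intro tendsto_intros \<tau>)
  then have "eventually (\<lambda>n. \<tau> n * norm y < e) sequentially"
    using e(1) by (intro order_tendstoD) auto
  then have ev: "eventually (\<lambda>n. ?U (\<tau> n) = - ?G (\<tau> n)) sequentially"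
    by eventually_elim (rule eq; simp add: \<tau>_def field_simps)
  have "(\<lambda>n. ?U (\<tau> n)) \<longlonglongrightarrow> (\<integral>x. u x * partial_deriv y \<phi> x \<partial>lborel)"
    by (rule pairing_tendsto[OF u continuous_test(2)[OF \<phi>] C(2) \<tau>])
  moreover have "(\<lambda>n. - ?G (\<tau> n)) \<longlonglongrightarrow> - (\<integral>x. g x * \<phi> x \<partial>lborel)"
    by (rule tendsto_minus[OF pairing_tendsto[OF g continuous_test(1)[OF \<phi>] C(1) \<tau>]])
  ultimately show "(\<integral>x. u x * partial_deriv y \<phi> x \<partial>lborel) = - (\<integral>x. g x * \<phi> x \<partial>lborel)"
    using LIMSEQ_unique tendsto_cong[OF ev] by blast
qed

interpretation square: pair_sigma_finite unit_interval unit_interval ..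

text \<open>Leibniz rule for two indefinite integrals, in integrated form. Since the densities \<open>a\<close> and \<open>b\<close> are
functions of separate variables, the product of their integrals is an absolutely convergent double
integral; splitting the square along its diagonal gives the two terms of the rule.\<close>

lemma product_rule_unit_interval:
  fixes a b U V :: "real \<Rightarrow> real"
  assumes a: "integrable unit_interval a" and b: "integrable unit_interval b"
    and [measurable]: "U \<in> borel_measurable borel" "V \<in> borel_measurable borel"
    and U: "AE r in unit_interval. U r = U0 + (\<integral>s. a s * indicator {..r} s \<partial>unit_interval)"
    and V: "AE r in unit_interval. V r = V0 + (\<integral>s. b s * indicator {..r} s \<partial>unit_interval)"
  shows "(U0 + (\<integral>s. a s \<partial>unit_interval)) * (V0 + (\<integral>s. b s \<partial>unit_interval)) - U0 * V0 =
      (\<integral>s. U s * b s + a s * V s \<partial>unit_interval)"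
proof -
  have [measurable]: "a \<in> borel_measurable borel" "b \<in> borel_measurable borel"
    using a b by (auto dest!: borel_measurable_integrable)
  define A where "A r = (\<integral>s. a s * indicator {..r} s \<partial>unit_interval)" for r
  define B where "B r = (\<integral>s. b s * indicator {..r} s \<partial>unit_interval)" for r
  let ?A = "\<integral>s. a s \<partial>unit_interval" and ?B = "\<integral>s. b s \<partial>unit_interval"
  have [measurable]: "A \<in> borel_measurable borel" "B \<in> borel_measurable borel"
    unfolding A_def[abs_def] B_def[abs_def] indicator_def atMost_iff by measurable
  have ai: "integrable unit_interval (\<lambda>s. a s * indicator {..r} s)" for r
    by (intro integrable_real_mult_indicator a) simp
  have bound: "\<bar>\<integral>s. c s * indicator {..r} s \<partial>unit_interval\<bar> \<le> (\<integral>s. \<bar>c s\<bar> \<partial>unit_interval)"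
    if "integrable unit_interval c" for c :: "real \<Rightarrow> real" and r
    using that by (intro integral_abs_bound_integral integrable_real_mult_indicator)
       (auto simp: indicator_def)
  have Ab: "integrable unit_interval (\<lambda>r. b r * A r)"
    using bound[OF a] by (intro integrable_bounded_mult[OF b]) (measurable, simp add: A_def)
  have Ba: "integrable unit_interval (\<lambda>r. a r * B r)"
    using bound[OF b] by (intro integrable_bounded_mult[OF a]) (measurable, simp add: B_def)
  have "integrable (unit_interval \<Otimes>\<^sub>M unit_interval) (\<lambda>(s, r). a s * b r)"
  proof (rule square.Fubini_integrable)
    show "integrable unit_interval (\<lambda>s. \<integral>r. norm (case (s, r) of (s, r) \<Rightarrow> a s * b r) \<partial>unit_interval)"
      using a by (simp add: abs_mult)
  qed (use b in auto)
  then have int: "integrable (unit_interval \<Otimes>\<^sub>M unit_interval) (\<lambda>(s, r). a s * (b r * indicator {..s} r))"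
    using integrable_bounded_mult[of _ "\<lambda>(s, r). a s * b r" "\<lambda>(s, r). indicator {..s} r" 1]
    by (simp add: case_prod_unfold mult.assoc indicator_def)
  have "(\<integral>s. a s * B s \<partial>unit_interval) = (\<integral>s. \<integral>r. a s * (b r * indicator {..s} r) \<partial>unit_interval \<partial>unit_interval)"
    by (simp add: B_def)
  also have "\<dots> = (\<integral>r. \<integral>s. a s * (b r * indicator {..s} r) \<partial>unit_interval \<partial>unit_interval)"
    using square.Fubini_integral[OF int] by simp
  also have "\<dots> = (\<integral>r. b r * (?A - A r) \<partial>unit_interval)"
  proof (rule Bochner_Integration.integral_cong[OF refl])
    fix r
    have "(\<integral>s. a s * (b r * indicator {..s} r) \<partial>unit_interval) =
        (\<integral>s. b r * (a s - a s * indicator {..r} s) \<partial>unit_interval)"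
    proof (rule integral_cong_AE)
      have "AE s in lborel. s \<noteq> r" by (rule AE_lborel_singleton)
      then show "AE s in unit_interval. a s * (b r * indicator {..s} r) = b r * (a s - a s * indicator {..r} s)"
        unfolding AE_unit_interval by eventually_elim (auto simp: indicator_def)
    qed (measurable, simp add: indicator_def, measurable)
    also have "\<dots> = b r * (?A - A r)" using a ai by (simp add: A_def)
    finally show "(\<integral>s. a s * (b r * indicator {..s} r) \<partial>unit_interval) = b r * (?A - A r)" .
  qed
  also have "\<dots> = ?A * ?B - (\<integral>r. b r * A r \<partial>unit_interval)"
    using b Ab by (simp add: right_diff_distrib)
  finally have AB: "(\<integral>s. a s * B s \<partial>unit_interval) + (\<integral>r. b r * A r \<partial>unit_interval) = ?A * ?B" by simp
  have "(\<integral>s. U s * b s + a s * V s \<partial>unit_interval) =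
      (\<integral>s. (U0 * b s + b s * A s) + (V0 * a s + a s * B s) \<partial>unit_interval)"
  proof (rule integral_cong_AE)
    show "AE s in unit_interval. U s * b s + a s * V s = U0 * b s + b s * A s + (V0 * a s + a s * B s)"
      using U V by eventually_elim (simp add: A_def B_def algebra_simps)
  qed measurable
  also have "\<dots> = U0 * ?B + V0 * ?A + ?A * ?B"
    using a b Ab Ba AB by simp
  finally show ?thesis by (simp add: algebra_simps)
qed

lemma rescale_unit_interval:
  fixes a :: "real \<Rightarrow> real"
  assumes [measurable]: "a \<in> borel_measurable borel" and r: "0 < r" "r \<le> 1"
  shows "(\<integral>s. r * a (s * r) \<partial>unit_interval) = (\<integral>s. a s * indicator {..r} s \<partial>unit_interval)"
proof -
  have "(\<integral>s. a s * indicator {..r} s \<partial>unit_interval) = (\<integral>s. a s * indicator {0..r} s \<partial>lborel)"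
    using r by (subst integral_unit_interval) (auto intro!: Bochner_Integration.integral_cong simp: indicator_def)
  also have "\<dots> = \<bar>r\<bar> *\<^sub>R (\<integral>s. a (0 + r * s) * indicator {0..r} (0 + r * s) \<partial>lborel)"
    using r by (intro lborel_integral_real_affine) auto
  also have "\<dots> = (\<integral>s. r * a (s * r) * indicator {0..1} s \<partial>lborel)"
  proof -
    have "a (0 + r * s) * indicator {0..r} (0 + r * s) = a (s * r) * indicator {0..1} s" for s
      using r by (auto simp: indicator_def mult.commute[of r] zero_le_mult_iff)
    then show ?thesis using r by (simp add: mult.assoc)
  qed
  finally show ?thesis using integral_unit_interval[of "\<lambda>s. r * a (s * r)"] by simp
qed

lemma weak_partial_scale:
  assumes "weak_partial \<Omega> y u g"
  shows "weak_partial \<Omega> (t *\<^sub>R y) u (\<lambda>x. t * g x)"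
proof -
  have "partial_deriv (t *\<^sub>R y) \<phi> x = t * partial_deriv y \<phi> x" if "\<phi> \<in> test_functions \<Omega>" for \<phi> x
    unfolding partial_deriv_linear[OF that, of "t *\<^sub>R y"] partial_deriv_linear[OF that, of y]
    by (simp add: sum_distrib_left mult.assoc)
  then show ?thesis
    using assms unfolding weak_partial_def by (simp add: mult.left_commute[of _ t] mult.assoc)
qed

text \<open>For almost every base point the increments are known for almost every position on the segment at
once, with one common density: the exceptional set depends on the position at first,
and Fubini exchanges the two quantifiers.\<close>

lemma weak_partial_increments:
  fixes u g :: "'a::euclidean_space \<Rightarrow> real"
  assumes \<Omega>: "open \<Omega>" and w: "weak_partial \<Omega> y u g"
  shows "AE x in lborel. AE r in unit_interval. x \<in> line_domain \<Omega> y \<longrightarrow>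
    u (x + r *\<^sub>R y) = u x + (\<integral>s. g (x + s *\<^sub>R y) * indicator {..r} s \<partial>unit_interval)"
proof -
  have u: "integrable lborel u" and g: "integrable lborel g" using w by (auto simp: weak_partial_def)
  note [measurable] = borel_measurable_integrable[OF u] borel_measurable_integrable[OF g]
  note [measurable] = borel_open[OF open_line_domain[OF \<Omega>], of y]
  have [measurable]: "(\<lambda>z. \<integral>s. g (fst z + s *\<^sub>R y) * indicator {..snd z} s \<partial>unit_interval)
      \<in> borel_measurable (lborel \<Otimes>\<^sub>M unit_interval)"
    unfolding indicator_def atMost_iff by measurable
  have "AE x in lborel. x \<in> line_domain \<Omega> y \<longrightarrow>
     u (x + r *\<^sub>R y) = u x + (\<integral>s. g (x + s *\<^sub>R y) * indicator {..r} s \<partial>unit_interval)" if r: "0 < r" "r \<le> 1" for r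
    using weak_partial_lines[OF \<Omega> weak_partial_scale[OF w, of r]]
  proof eventually_elim
    case (elim x)
    have "(\<integral>s. r * g (x + s *\<^sub>R r *\<^sub>R y) \<partial>unit_interval) =
        (\<integral>s. g (x + s *\<^sub>R y) * indicator {..r} s \<partial>unit_interval)"
      using rescale_unit_interval[of "\<lambda>s. g (x + s *\<^sub>R y)" r] r by simp
    then show ?case using elim line_domain_scale[of r \<Omega> y] r by auto
  qed
  then have "AE r in unit_interval. AE x in lborel. x \<in> line_domain \<Omega> y \<longrightarrow>
     u (x + r *\<^sub>R y) = u x + (\<integral>s. g (x + s *\<^sub>R y) * indicator {..r} s \<partial>unit_interval)"
    unfolding AE_unit_interval using AE_lborel_singleton[of 0]
    by (auto elim!: eventually_mono)
  then show ?thesis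
    by (subst line.AE_commute) measurable
qed

text \<open>On almost every segment both factors are indefinite integrals of integrable functions, so the
one-dimensional Leibniz rule gives the increments of the product. The integrability hypotheses on
the product and on its derivative are what turns these increments back into a weak derivative.\<close>

proposition weak_partial_mult:
  fixes u v g h :: "'a::euclidean_space \<Rightarrow> real"
  assumes \<Omega>: "open \<Omega>" and wu: "weak_partial \<Omega> y u g" and wv: "weak_partial \<Omega> y v h"
    and uv: "integrable lborel (\<lambda>x. u x * v x)" and gh: "integrable lborel (\<lambda>x. u x * h x + g x * v x)"
  shows "weak_partial \<Omega> y (\<lambda>x. u x * v x) (\<lambda>x. u x * h x + g x * v x)"
proof (rule weak_partial_if_lines[OF \<Omega> uv gh])
  fix t :: real assume "0 < t" "t \<le> 1"
  let ?z = "t *\<^sub>R y"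
  define G where "G x = t * g x" for x
  define H where "H x = t * h x" for x
  have wu': "weak_partial \<Omega> ?z u G" and wv': "weak_partial \<Omega> ?z v H"
    unfolding G_def H_def by (intro weak_partial_scale wu wv)+
  have int: "integrable lborel u" "integrable lborel v" "integrable lborel G" "integrable lborel H"
    using wu' wv' by (auto simp: weak_partial_def)
  note [measurable] = int[THEN borel_measurable_integrable]
  show "AE x in lborel. x \<in> line_domain \<Omega> ?z \<longrightarrow>
      u (x + ?z) * v (x + ?z) - u x * v x =
      (\<integral>s. t * (u (x + s *\<^sub>R ?z) * h (x + s *\<^sub>R ?z) + g (x + s *\<^sub>R ?z) * v (x + s *\<^sub>R ?z)) \<partial>unit_interval)"
    using weak_partial_increments[OF \<Omega> wu'] weak_partial_increments[OF \<Omega> wv']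
      weak_partial_lines[OF \<Omega> wu'] weak_partial_lines[OF \<Omega> wv']
      integrable_line_average(2)[OF int(3), of ?z] integrable_line_average(2)[OF int(4), of ?z]
  proof eventually_elim
    case (elim x)
    show ?case
    proof
      assume x: "x \<in> line_domain \<Omega> ?z"
      have e: "t * (u p * h p + g p * v p) = u p * H p + G p * v p" for p
        by (simp add: G_def H_def algebra_simps)
      have "(u x + (\<integral>s. G (x + s *\<^sub>R ?z) \<partial>unit_interval)) * (v x + (\<integral>s. H (x + s *\<^sub>R ?z) \<partial>unit_interval)) - u x * v x =
        (\<integral>s. u (x + s *\<^sub>R ?z) * H (x + s *\<^sub>R ?z) + G (x + s *\<^sub>R ?z) * v (x + s *\<^sub>R ?z) \<partial>unit_interval)"
        by (rule product_rule_unit_interval) (use elim x in \<open>simp_all del: scaleR_scaleR\<close>)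
      moreover have "u x + (\<integral>s. G (x + s *\<^sub>R ?z) \<partial>unit_interval) = u (x + ?z)"
          "v x + (\<integral>s. H (x + s *\<^sub>R ?z) \<partial>unit_interval) = v (x + ?z)"
        using elim x by (simp_all del: scaleR_scaleR)
      ultimately show "u (x + ?z) * v (x + ?z) - u x * v x =
        (\<integral>s. t * (u (x + s *\<^sub>R ?z) * h (x + s *\<^sub>R ?z) + g (x + s *\<^sub>R ?z) * v (x + s *\<^sub>R ?z)) \<partial>unit_interval)"
        unfolding e by simp
    qed
  qed
qed

section \<open>A potential estimate on cones\<close>

text \<open>The tangent to \<open>a \<mapsto> a\<^bsup>n+1\<^esup>\<close> at \<open>c\<close> lies below the graph.\<close>

lemma young_power:
  fixes a c :: real
  assumes "0 \<le> a" "0 \<le> c"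
  shows "real (Suc n) * c ^ n * a \<le> a ^ Suc n + real n * c ^ Suc n"
proof (induction n)
  case (Suc n)
  have "a * (real (Suc n) * c ^ n * a) \<le> a * (a ^ Suc n + real n * c ^ Suc n)"
    using Suc assms by (intro mult_left_mono) auto
  moreover have "0 \<le> real (Suc n) * c ^ n * (a - c)\<^sup>2" using assms by simp
  ultimately show ?case by (simp add: algebra_simps power2_eq_square)
qed simp

text \<open>Jensen's inequality for the powers, on a measure space of total mass \<open>m\<close> and for functions with
values in \<open>[0, \<infinity>]\<close>: integrate the tangent inequality at the mean value \<open>c\<close>.\<close>

lemma nn_integral_power_le:
  fixes f :: "'a \<Rightarrow> ennreal"
  assumes [measurable]: "f \<in> borel_measurable M" and m: "emeasure M (space M) = ennreal m"
  shows "(\<integral>\<^sup>+x. f x \<partial>M) ^ Suc n \<le> ennreal m ^ n * (\<integral>\<^sup>+x. f x ^ Suc n \<partial>M)"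
proof (cases "m \<le> 0")
  case True
  then have "ennreal m = 0" by (simp add: ennreal_neg)
  then have "AE x in M. False"
    using m by (intro AE_I[of _ _ "space M"]) auto
  then have "AE x in M. f x = 0" by eventually_elim simp
  then have "(\<integral>\<^sup>+x. f x \<partial>M) = 0" by (simp add: nn_integral_0_iff_AE)
  then show ?thesis by simp
next
  case False
  then have m0: "m > 0" by simp
  show ?thesis
  proof (cases "(\<integral>\<^sup>+x. f x \<partial>M) = \<infinity>")
    case True
    have "f x \<le> 1 + f x ^ Suc n" for x
    proof (cases "f x \<le> 1")
      case True then show ?thesis by (simp add: add_increasing2)
    next
      case False
      then have "1 \<le> f x ^ n" by (intro one_le_power) auto
      then have "f x * 1 \<le> f x * f x ^ n" by (intro mult_left_mono) auto
      then show ?thesis by (simp add: add_increasing)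
    qed
    then have "(\<integral>\<^sup>+x. f x \<partial>M) \<le> (\<integral>\<^sup>+x. 1 + f x ^ Suc n \<partial>M)" by (intro nn_integral_mono)
    also have "\<dots> = ennreal m + (\<integral>\<^sup>+x. f x ^ Suc n \<partial>M)" by (subst nn_integral_add) (auto simp: m)
    finally have "(\<integral>\<^sup>+x. f x ^ Suc n \<partial>M) = \<infinity>"
      using True by (simp add: top_unique)
    then show ?thesis using m0 by (simp add: ennreal_mult_top ennreal_power)
  next
    case fin: False
    then obtain A where A: "(\<integral>\<^sup>+x. f x \<partial>M) = ennreal A" "A \<ge> 0"
      by (cases "\<integral>\<^sup>+x. f x \<partial>M") auto
    show ?thesis
    proof (cases "(\<integral>\<^sup>+x. f x ^ Suc n \<partial>M) = \<infinity>")
      case True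
      then show ?thesis using m0 by (simp add: ennreal_mult_top ennreal_power)
    next
      case False
      then obtain B where B: "(\<integral>\<^sup>+x. f x ^ Suc n \<partial>M) = ennreal B" "B \<ge> 0"
        by (cases "\<integral>\<^sup>+x. f x ^ Suc n \<partial>M") auto
      define c where "c = A / m"
      have c0: "c \<ge> 0" using A m0 by (simp add: c_def)
      have "ennreal (real (Suc n) * c ^ n) * f x \<le> f x ^ Suc n + ennreal (real n * c ^ Suc n)" for x
      proof (cases "f x")
        case (real a)
        then show ?thesis
          using young_power[of a c n] c0
          by (simp add: ennreal_mult[symmetric] ennreal_power ennreal_plus[symmetric] del: ennreal_plus power_Suc of_nat_Suc)
      next
        case top
        then show ?thesis by (simp add: ennreal_top_mult)
      qed
      then have "(\<integral>\<^sup>+x. ennreal (real (Suc n) * c ^ n) * f x \<partial>M) \<le>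
          (\<integral>\<^sup>+x. f x ^ Suc n + ennreal (real n * c ^ Suc n) \<partial>M)" by (intro nn_integral_mono)
      also have "\<dots> = ennreal B + ennreal (real n * c ^ Suc n) * ennreal m"
        using m by (subst nn_integral_add) (auto simp: B simp del: power_Suc)
      also have "\<dots> = ennreal (B + real n * c ^ Suc n * m)"
        using m0 c0 B by (simp add: ennreal_mult)
      also have "(\<integral>\<^sup>+x. ennreal (real (Suc n) * c ^ n) * f x \<partial>M) = ennreal (real (Suc n) * c ^ n * A)"
        using c0 A by (simp add: nn_integral_cmult ennreal_mult del: of_nat_Suc)
      finally have "real (Suc n) * c ^ n * A \<le> B + real n * c ^ Suc n * m"
        using m0 c0 B by (subst (asm) ennreal_le_iff) (auto simp del: of_nat_Suc)
      moreover have "A = c * m" using m0 by (simp add: c_def)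
      ultimately have "c ^ Suc n * m \<le> B" by (simp add: algebra_simps)
      then have "m ^ n * (c ^ Suc n * m) \<le> m ^ n * B" using m0 by (intro mult_left_mono) auto
      then have "A ^ Suc n \<le> m ^ n * B"
        unfolding \<open>A = c * m\<close> by (simp add: power_mult_distrib algebra_simps)
      then show ?thesis using A B m0
        by (simp add: ennreal_power ennreal_mult[symmetric] del: power_Suc)
    qed
  qed
qed

definition ball_measure :: "'a::euclidean_space \<Rightarrow> real \<Rightarrow> 'a measure" where
  "ball_measure c \<rho> = density lborel (indicator (ball c \<rho>))"

lemma sets_ball_measure [measurable_cong, simp]: "sets (ball_measure c \<rho>) = sets borel"
  by (simp add: ball_measure_def)

lemma space_ball_measure [simp]: "space (ball_measure c \<rho>) = UNIV"
  by (simp add: ball_measure_def)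

lemma AE_ball_measure:
  "(AE p in ball_measure c \<rho>. P p) \<longleftrightarrow> (AE p in lborel. p \<in> ball c \<rho> \<longrightarrow> P p)"
  unfolding ball_measure_def by (subst AE_density) (auto intro!: AE_cong borel_measurable_indicator simp: indicator_def split: if_splits)

lemma emeasure_ball_measure: "emeasure (ball_measure c \<rho>) UNIV = emeasure lborel (ball c \<rho>)"
  unfolding ball_measure_def by (subst emeasure_density) (auto intro!: borel_measurable_indicator)

lemma ball_measure_mass:
  assumes "\<rho> > 0"
  obtains m where "m > 0" "emeasure (ball_measure c \<rho>) (space (ball_measure c \<rho>)) = ennreal m"
proof
  show "measure lborel (ball c \<rho>) > 0" using assms content_ball_pos[of \<rho> c] by simp
  show "emeasure (ball_measure c \<rho>) (space (ball_measure c \<rho>)) = ennreal (measure lborel (ball c \<rho>))"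
    using emeasure_lborel_ball_finite[of c \<rho>]
    by (simp add: emeasure_ball_measure emeasure_eq_ennreal_measure less_top)
qed

interpretation ball: finite_measure "ball_measure c \<rho>" for c \<rho>
  using emeasure_lborel_ball_finite[of c \<rho>]
  by (intro finite_measureI) (simp add: emeasure_ball_measure less_top)

interpretation ball_pair: pair_sigma_finite lborel "ball_measure c \<rho>" for c \<rho> ..
interpretation ball_unit: pair_sigma_finite "ball_measure c \<rho>" unit_interval for c \<rho> ..

text \<open>An average over a ball shrunk by the factor \<open>t\<close> costs the Jacobian \<open>t\<^sup>-\<^sup>n\<close>, \<open>n\<close> the dimension. Stated
without division, so that \<open>t = 0\<close> is included.\<close>

lemma nn_integral_ball_measure_scale:
  fixes H :: "'a::euclidean_space \<Rightarrow> ennreal"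
  assumes [measurable]: "H \<in> borel_measurable borel" and "t \<ge> 0"
  shows "ennreal (t ^ DIM('a)) * (\<integral>\<^sup>+p. H (x + t *\<^sub>R p) \<partial>ball_measure c \<rho>) \<le> (\<integral>\<^sup>+p. H p \<partial>lborel)"
proof (cases "t = 0")
  case True then show ?thesis by (simp add: zero_power)
next
  case False
  have "(\<integral>\<^sup>+p. H (x + t *\<^sub>R p) \<partial>ball_measure c \<rho>) \<le> (\<integral>\<^sup>+p. H (x + t *\<^sub>R p) \<partial>lborel)"
    unfolding ball_measure_def
    by (subst nn_integral_density) (auto intro!: nn_integral_mono borel_measurable_indicator simp: indicator_def)
  then have "ennreal (t ^ DIM('a)) * (\<integral>\<^sup>+p. H (x + t *\<^sub>R p) \<partial>ball_measure c \<rho>) \<le>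
      ennreal (t ^ DIM('a)) * (\<integral>\<^sup>+p. H (x + t *\<^sub>R p) \<partial>lborel)"
    by (rule mult_left_mono) simp
  also have "\<dots> = (\<integral>\<^sup>+p. H p \<partial>lborel)"
    using assms(2) by (subst (2) lborel_affine[OF False, of x])
      (simp add: nn_integral_density nn_integral_distr nn_integral_cmult)
  finally show ?thesis .
qed

text \<open>The integral of \<open>G\<close> over the segments from \<open>x\<close> to the points \<open>x + p\<close> with \<open>p\<close> in the ball around \<open>c\<close>,
which fill a cone with vertex \<open>x\<close>, or a ball if \<open>0\<close> is among the \<open>p\<close>. It is a truncated Riesz potential of order one, but the
singular kernel is hidden: the position \<open>t\<close> on the segment is written as \<open>s\<^sup>2\<close>, and the weight \<open>2 s\<close>
of this substitution is exactly what makes the two estimates below work in dimension three.\<close>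

definition cone_potential :: "'a::euclidean_space \<Rightarrow> real \<Rightarrow> ('a \<Rightarrow> ennreal) \<Rightarrow> 'a \<Rightarrow> ennreal" where
  "cone_potential c \<rho> G x =
    (\<integral>\<^sup>+s. ennreal (2 * s) * (\<integral>\<^sup>+p. G (x + s\<^sup>2 *\<^sub>R p) \<partial>ball_measure c \<rho>) \<partial>unit_interval)"

lemma cone_potential_power_le:
  fixes G :: "'a::euclidean_space \<Rightarrow> ennreal"
  assumes [measurable]: "G \<in> borel_measurable borel"
  shows "cone_potential c \<rho> G x ^ 6 \<le>
    (\<integral>\<^sup>+s. ennreal (64 * s ^ 6) * (\<integral>\<^sup>+p. G (x + s\<^sup>2 *\<^sub>R p) \<partial>ball_measure c \<rho>) ^ 6 \<partial>unit_interval)"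
proof -
  have "cone_potential c \<rho> G x ^ Suc 5 \<le> ennreal 1 ^ 5 *
    (\<integral>\<^sup>+s. (ennreal (2 * s) * (\<integral>\<^sup>+p. G (x + s\<^sup>2 *\<^sub>R p) \<partial>ball_measure c \<rho>)) ^ Suc 5 \<partial>unit_interval)"
    unfolding cone_potential_def
    by (rule nn_integral_power_le) (measurable, simp add: emeasure_unit_interval_UNIV)
  also have "\<dots> = (\<integral>\<^sup>+s. ennreal (64 * s ^ 6) * (\<integral>\<^sup>+p. G (x + s\<^sup>2 *\<^sub>R p) \<partial>ball_measure c \<rho>) ^ 6 \<partial>unit_interval)"
  proof -
    have "(\<integral>\<^sup>+s. (ennreal (2 * s) * (\<integral>\<^sup>+p. G (x + s\<^sup>2 *\<^sub>R p) \<partial>ball_measure c \<rho>)) ^ Suc 5 \<partial>unit_interval) =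
      (\<integral>\<^sup>+s. ennreal (64 * s ^ 6) * (\<integral>\<^sup>+p. G (x + s\<^sup>2 *\<^sub>R p) \<partial>ball_measure c \<rho>) ^ 6 \<partial>unit_interval)"
      by (intro nn_integral_cong_AE)
       (auto simp: AE_unit_interval power_mult_distrib ennreal_power eval_nat_numeral(3)[symmetric] simp del: power_Suc)
    then show ?thesis by simp
  qed
  finally show ?thesis by simp
qed

text \<open>Sixth powers: Jensen in \<open>s\<close> and in \<open>p\<close> leaves the weight \<open>s\<^sup>6\<close>, and the scaling of the ball by \<open>s\<^sup>2\<close>
costs \<open>(s\<^sup>2)\<^sup>-\<^sup>3 = s\<^sup>-\<^sup>6\<close>. So the potential of an \<open>L\<^sup>6\<close> function is bounded, which is Morrey's estimate.\<close>

lemma cone_potential_bounded: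
  fixes G :: "'a::euclidean_space \<Rightarrow> ennreal"
  assumes [measurable]: "G \<in> borel_measurable borel" and dim: "DIM('a) = 3"
    and m: "emeasure (ball_measure c \<rho>) (space (ball_measure c \<rho>)) = ennreal m"
  shows "cone_potential c \<rho> G x ^ 6 \<le> 64 * ennreal m ^ 5 * (\<integral>\<^sup>+x. G x ^ 6 \<partial>lborel)"
proof -
  note cone_potential_power_le[OF assms(1)]
  also have "(\<integral>\<^sup>+s. ennreal (64 * s ^ 6) * (\<integral>\<^sup>+p. G (x + s\<^sup>2 *\<^sub>R p) \<partial>ball_measure c \<rho>) ^ 6 \<partial>unit_interval)
      \<le> (\<integral>\<^sup>+s. 64 * ennreal m ^ 5 * (\<integral>\<^sup>+x. G x ^ 6 \<partial>lborel) \<partial>unit_interval)"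
  proof (rule nn_integral_mono)
    fix s :: real
    have "(\<integral>\<^sup>+p. G (x + s\<^sup>2 *\<^sub>R p) \<partial>ball_measure c \<rho>) ^ Suc 5 \<le>
        ennreal m ^ 5 * (\<integral>\<^sup>+p. G (x + s\<^sup>2 *\<^sub>R p) ^ Suc 5 \<partial>ball_measure c \<rho>)"
      by (rule nn_integral_power_le[OF _ m]) simp
    then have "ennreal (s ^ 6) * (\<integral>\<^sup>+p. G (x + s\<^sup>2 *\<^sub>R p) \<partial>ball_measure c \<rho>) ^ 6 \<le>
        ennreal (s ^ 6) * (ennreal m ^ 5 * (\<integral>\<^sup>+p. G (x + s\<^sup>2 *\<^sub>R p) ^ 6 \<partial>ball_measure c \<rho>))"
      by (intro mult_left_mono) (simp_all add: eval_nat_numeral(3)[symmetric] del: power_Suc)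
    also have "\<dots> = ennreal m ^ 5 * (ennreal ((s\<^sup>2) ^ DIM('a)) * (\<integral>\<^sup>+p. G (x + s\<^sup>2 *\<^sub>R p) ^ 6 \<partial>ball_measure c \<rho>))"
      by (simp add: dim mult_ac flip: power_mult)
    also have "\<dots> \<le> ennreal m ^ 5 * (\<integral>\<^sup>+x. G x ^ 6 \<partial>lborel)"
      by (intro mult_left_mono nn_integral_ball_measure_scale[of "\<lambda>x. G x ^ 6"]) auto
    finally have "64 * (ennreal (s ^ 6) * (\<integral>\<^sup>+p. G (x + s\<^sup>2 *\<^sub>R p) \<partial>ball_measure c \<rho>) ^ 6) \<le> 64 * (ennreal m ^ 5 * (\<integral>\<^sup>+x. G x ^ 6 \<partial>lborel))"
      by (rule mult_left_mono) simp
    then show "ennreal (64 * s ^ 6) * (\<integral>\<^sup>+p. G (x + s\<^sup>2 *\<^sub>R p) \<partial>ball_measure c \<rho>) ^ 6 \<le> 64 * ennreal m ^ 5 * (\<integral>\<^sup>+x. G x ^ 6 \<partial>lborel)"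
      by (simp add: ennreal_mult mult.assoc)
  qed
  also have "\<dots> = 64 * ennreal m ^ 5 * (\<integral>\<^sup>+x. G x ^ 6 \<partial>lborel)"
    by (simp add: emeasure_unit_interval_UNIV)
  finally show ?thesis .
qed

text \<open>For \<open>G\<close> in \<open>L\<^sup>3\<close> the sixth power of the average over the ball is split into two third powers. One of
them absorbs the weight \<open>s\<^sup>6\<close> as before and is bounded by the norm of \<open>G\<close>, the other one is integrated
over \<open>x\<close> without loss. So the potential of an \<open>L\<^sup>3\<close> function is in \<open>L\<^sup>6\<close>.\<close>

lemma cone_potential_L6:
  fixes G :: "'a::euclidean_space \<Rightarrow> ennreal"
  assumes [measurable]: "G \<in> borel_measurable borel" and dim: "DIM('a) = 3"
    and m: "emeasure (ball_measure c \<rho>) (space (ball_measure c \<rho>)) = ennreal m"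
  shows "(\<integral>\<^sup>+x. cone_potential c \<rho> G x ^ 6 \<partial>lborel) \<le> 64 * ennreal m ^ 5 * (\<integral>\<^sup>+x. G x ^ 3 \<partial>lborel)\<^sup>2"
proof -
  let ?I = "\<integral>\<^sup>+x. G x ^ 3 \<partial>lborel"
  let ?T = "\<lambda>s x. \<integral>\<^sup>+p. G (x + s\<^sup>2 *\<^sub>R p) ^ 3 \<partial>ball_measure c \<rho>"
  have "cone_potential c \<rho> G x ^ 6 \<le> (\<integral>\<^sup>+s. 64 * ennreal m ^ 4 * ?I * ?T s x \<partial>unit_interval)" for x
  proof -
    note cone_potential_power_le[OF assms(1)]
    also have "(\<integral>\<^sup>+s. ennreal (64 * s ^ 6) * (\<integral>\<^sup>+p. G (x + s\<^sup>2 *\<^sub>R p) \<partial>ball_measure c \<rho>) ^ 6 \<partial>unit_interval)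
        \<le> (\<integral>\<^sup>+s. 64 * ennreal m ^ 4 * ?I * ?T s x \<partial>unit_interval)"
    proof (rule nn_integral_mono)
      fix s :: real
      have "(\<integral>\<^sup>+p. G (x + s\<^sup>2 *\<^sub>R p) \<partial>ball_measure c \<rho>) ^ Suc 2 \<le>
          ennreal m ^ 2 * (\<integral>\<^sup>+p. G (x + s\<^sup>2 *\<^sub>R p) ^ Suc 2 \<partial>ball_measure c \<rho>)"
        by (rule nn_integral_power_le[OF _ m]) simp
      then have "(\<integral>\<^sup>+p. G (x + s\<^sup>2 *\<^sub>R p) \<partial>ball_measure c \<rho>) ^ 3 \<le> ennreal m ^ 2 * ?T s x"
        by (simp add: eval_nat_numeral(3)[symmetric] del: power_Suc)
      then have "((\<integral>\<^sup>+p. G (x + s\<^sup>2 *\<^sub>R p) \<partial>ball_measure c \<rho>) ^ 3)\<^sup>2 \<le> (ennreal m ^ 2 * ?T s x)\<^sup>2"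
        unfolding power2_eq_square by (intro mult_mono) auto
      then have "(\<integral>\<^sup>+p. G (x + s\<^sup>2 *\<^sub>R p) \<partial>ball_measure c \<rho>) ^ 6 \<le> ennreal m ^ 4 * (?T s x * ?T s x)"
        by (simp add: power_mult_distrib power2_eq_square[of "?T s x"] flip: power_mult)
      then have "ennreal (64 * s ^ 6) * (\<integral>\<^sup>+p. G (x + s\<^sup>2 *\<^sub>R p) \<partial>ball_measure c \<rho>) ^ 6 \<le>
          ennreal (64 * s ^ 6) * (ennreal m ^ 4 * (?T s x * ?T s x))"
        by (intro mult_left_mono) auto
      also have "\<dots> = 64 * ennreal m ^ 4 * (ennreal ((s\<^sup>2) ^ DIM('a)) * ?T s x) * ?T s x"
        by (simp add: dim ennreal_mult mult_ac flip: power_mult)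
      also have "\<dots> \<le> 64 * ennreal m ^ 4 * ?I * ?T s x"
        by (intro mult_left_mono mult_right_mono nn_integral_ball_measure_scale[of "\<lambda>x. G x ^ 3"]) auto
      finally show "ennreal (64 * s ^ 6) * (\<integral>\<^sup>+p. G (x + s\<^sup>2 *\<^sub>R p) \<partial>ball_measure c \<rho>) ^ 6 \<le> 64 * ennreal m ^ 4 * ?I * ?T s x" .
    qed
    finally show ?thesis .
  qed
  then have "(\<integral>\<^sup>+x. cone_potential c \<rho> G x ^ 6 \<partial>lborel) \<le>
      (\<integral>\<^sup>+x. \<integral>\<^sup>+s. 64 * ennreal m ^ 4 * ?I * ?T s x \<partial>unit_interval \<partial>lborel)"
    by (rule nn_integral_mono)
  also have "\<dots> = (\<integral>\<^sup>+s. \<integral>\<^sup>+x. 64 * ennreal m ^ 4 * ?I * ?T s x \<partial>lborel \<partial>unit_interval)"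
    by (rule line.Fubini'[symmetric]) measurable
  also have "\<dots> = (\<integral>\<^sup>+s. 64 * ennreal m ^ 4 * ?I * (\<integral>\<^sup>+x. ?T s x \<partial>lborel) \<partial>unit_interval)"
    by (intro nn_integral_cong nn_integral_cmult) measurable
  also have "\<dots> = (\<integral>\<^sup>+s. 64 * ennreal m ^ 4 * ?I * (ennreal m * ?I) \<partial>unit_interval)"
  proof -
    have "(\<integral>\<^sup>+x. ?T s x \<partial>lborel) = ennreal m * ?I" for s
    proof -
      have "(\<integral>\<^sup>+x. ?T s x \<partial>lborel) = (\<integral>\<^sup>+p. \<integral>\<^sup>+x. G (x + s\<^sup>2 *\<^sub>R p) ^ 3 \<partial>lborel \<partial>ball_measure c \<rho>)"
        by (rule ball_pair.Fubini'[symmetric]) measurable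
      also have "\<dots> = (\<integral>\<^sup>+p. ?I \<partial>ball_measure c \<rho>)"
        by (subst nn_integral_translate[of "\<lambda>x. G x ^ 3"]) auto
      finally show ?thesis using m by (simp add: mult.commute)
    qed
    then show ?thesis by simp
  qed
  also have "\<dots> = 64 * ennreal m ^ 5 * ?I\<^sup>2"
  proof -
    have "ennreal m ^ 5 = ennreal m ^ 4 * ennreal m"
      by (simp add: power_Suc2[symmetric] del: power_Suc2 power_Suc)
    then show ?thesis by (simp add: emeasure_unit_interval_UNIV power2_eq_square mult_ac)
  qed
  finally show ?thesis .
qed

section \<open>Pointwise representation by cone averages\<close>

lemma weak_partial_direction:
  assumes w: "\<And>i. i \<in> Basis \<Longrightarrow> weak_partial \<Omega> i u (g i)"
  shows "weak_partial \<Omega> p u (\<lambda>x. \<Sum>i\<in>Basis. (p \<bullet> i) * g i x)"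
  unfolding weak_partial_def
proof (intro conjI ballI)
  obtain j :: 'a where "j \<in> Basis" using nonempty_Basis by blast
  then have u: "integrable lborel u" using w[of j] by (simp add: weak_partial_def)
  have g: "i \<in> Basis \<Longrightarrow> integrable lborel (g i)" for i using w[of i] by (simp add: weak_partial_def)
  show "integrable lborel u" by (rule u)
  show "integrable lborel (\<lambda>x. \<Sum>i\<in>Basis. (p \<bullet> i) * g i x)"
    using g by (intro Bochner_Integration.integrable_sum integrable_mult_right)
  fix \<phi> assume \<phi>: "\<phi> \<in> test_functions \<Omega>"
  have int: "integrable lborel (\<lambda>x. f x * \<psi> x)"
    if "integrable lborel f" "\<psi> = \<phi> \<or> \<psi> = partial_deriv i \<phi>" for f \<psi> i
  proof -
    obtain C where "\<And>x. \<bar>\<phi> x\<bar> \<le> C" "\<And>x. \<bar>partial_deriv i \<phi> x\<bar> \<le> C"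
      by (rule bounded_test[OF \<phi>, of i]) (rule that)
    then show ?thesis
      using that measurable_test(1)[OF \<phi>] measurable_test(2)[OF \<phi>, of i] by (intro integrable_bounded_mult) auto
  qed
  have "(\<integral>x. u x * partial_deriv p \<phi> x \<partial>lborel) =
      (\<integral>x. (\<Sum>i\<in>Basis. (p \<bullet> i) * (u x * partial_deriv i \<phi> x)) \<partial>lborel)"
    by (rule Bochner_Integration.integral_cong[OF refl])
      (simp add: partial_deriv_linear[OF \<phi>, of p] sum_distrib_left mult_ac)
  also have "\<dots> = (\<Sum>i\<in>Basis. (p \<bullet> i) * (\<integral>x. u x * partial_deriv i \<phi> x \<partial>lborel))"
    using int[OF u] by (subst Bochner_Integration.integral_sum) auto
  also have "\<dots> = (\<Sum>i\<in>Basis. (p \<bullet> i) * - (\<integral>x. g i x * \<phi> x \<partial>lborel))"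
    using w \<phi> by (intro sum.cong) (auto simp: weak_partial_def)
  also have "\<dots> = - (\<integral>x. (\<Sum>i\<in>Basis. (p \<bullet> i) * (g i x * \<phi> x)) \<partial>lborel)"
    using int[OF g] by (subst Bochner_Integration.integral_sum) (auto simp: sum_negf)
  also have "\<dots> = - (\<integral>x. (\<Sum>i\<in>Basis. (p \<bullet> i) * g i x) * \<phi> x \<partial>lborel)"
    by (simp add: sum_distrib_right mult.assoc)
  finally show "(\<integral>x. u x * partial_deriv p \<phi> x \<partial>lborel) =
      - (\<integral>x. (\<Sum>i\<in>Basis. (p \<bullet> i) * g i x) * \<phi> x \<partial>lborel)" .
qed

lemma nn_integral_unit_interval_square:
  fixes f :: "real \<Rightarrow> real"
  assumes [measurable]: "f \<in> borel_measurable borel" and nn: "\<And>s. 0 \<le> f s"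
  shows "(\<integral>\<^sup>+s. ennreal (f s) \<partial>unit_interval) = (\<integral>\<^sup>+s. ennreal (2 * s) * ennreal (f (s\<^sup>2)) \<partial>unit_interval)"
proof -
  have "(\<integral>\<^sup>+s. ennreal (f s) \<partial>unit_interval) = (\<integral>\<^sup>+s. ennreal (f s * indicator {0\<^sup>2..1\<^sup>2} s) \<partial>lborel)"
    by (subst nn_integral_unit_interval) (auto intro!: nn_integral_cong simp: indicator_def)
  also have "\<dots> = (\<integral>\<^sup>+s. ennreal (f (s\<^sup>2) * (2 * s) * indicator {0..1} s) \<partial>lborel)"
    by (rule nn_integral_substitution)
      (auto intro!: derivative_eq_intros continuous_intros simp: set_borel_measurable_def)
  also have "\<dots> = (\<integral>\<^sup>+s. ennreal (2 * s) * ennreal (f (s\<^sup>2)) * indicator {0..1} s \<partial>lborel)"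
    using nn by (intro nn_integral_cong) (auto simp: indicator_def ennreal_mult'' mult.commute)
  also have "\<dots> = (\<integral>\<^sup>+s. ennreal (2 * s) * ennreal (f (s\<^sup>2)) \<partial>unit_interval)"
    by (subst nn_integral_unit_interval) auto
  finally show ?thesis .
qed

lemma ennreal_abs_integral_le: "ennreal \<bar>\<integral>x. f x \<partial>M\<bar> \<le> (\<integral>\<^sup>+x. ennreal \<bar>f x\<bar> \<partial>M)" for f :: "'a \<Rightarrow> real"
  by (cases "integrable M f") (use integral_norm_bound_ennreal[of M f] in \<open>auto simp: not_integrable_integral_eq\<close>)

text \<open>Compare \<open>u x\<close> with \<open>u (x + p)\<close> along the segment between them and integrate over all \<open>p\<close> in the ball.
The values \<open>u (x + p)\<close> contribute at most the \<open>L\<^sup>1\<close> norm of \<open>u\<close>, the increments at most a multiple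
of the potential of the gradient.\<close>

lemma cone_representation:
  fixes u :: "'a::euclidean_space \<Rightarrow> real"
  assumes \<Omega>: "open \<Omega>" and D[measurable]: "D \<in> sets borel" and \<rho>: "\<rho> > 0"
    and cone: "\<And>x p. x \<in> D \<Longrightarrow> p \<in> ball c \<rho> \<Longrightarrow> x \<in> line_domain \<Omega> p"
    and w: "\<And>i. i \<in> Basis \<Longrightarrow> weak_partial \<Omega> i u (g i)"
    and m: "emeasure (ball_measure c \<rho>) (space (ball_measure c \<rho>)) = ennreal m"
  shows "AE x in lborel. x \<in> D \<longrightarrow> ennreal \<bar>u x\<bar> * ennreal m \<le>
    (\<integral>\<^sup>+x. ennreal \<bar>u x\<bar> \<partial>lborel) +
    ennreal (norm c + \<rho>) * cone_potential c \<rho> (\<lambda>x. ennreal (\<Sum>i\<in>Basis. \<bar>g i x\<bar>)) x"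
proof -
  have [measurable]: "u \<in> borel_measurable borel" "i \<in> Basis \<Longrightarrow> g i \<in> borel_measurable borel" for i
  proof -
    obtain j :: 'a where "j \<in> Basis" using nonempty_Basis by blast
    then show "u \<in> borel_measurable borel"
      using w[of j] borel_measurable_integrable[of lborel u] by (simp add: weak_partial_def)
    show "i \<in> Basis \<Longrightarrow> g i \<in> borel_measurable borel"
      using w[of i] borel_measurable_integrable[of lborel "g i"] by (simp add: weak_partial_def)
  qed
  define G where "G x = (\<Sum>i\<in>Basis. \<bar>g i x\<bar>)" for x
  have [measurable]: "G \<in> borel_measurable borel" unfolding G_def[abs_def] by measurable
  have G0: "G x \<ge> 0" for x by (simp add: G_def sum_nonneg)
  define R where "R = norm c + \<rho>"
  have R0: "R \<ge> 0" using \<rho> by (simp add: R_def)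
  have "AE p in ball_measure c \<rho>. AE x in lborel. x \<in> D \<longrightarrow>
      u (x + p) - u x = (\<integral>s. (\<Sum>i\<in>Basis. (p \<bullet> i) * g i (x + s *\<^sub>R p)) \<partial>unit_interval)"
    unfolding AE_ball_measure
  proof (rule AE_I2, rule impI)
    fix p assume p: "p \<in> ball c \<rho>"
    have "weak_partial \<Omega> p u (\<lambda>x. \<Sum>i\<in>Basis. (p \<bullet> i) * g i x)"
      by (rule weak_partial_direction[OF w])
    from weak_partial_lines[OF \<Omega> this]
    show "AE x in lborel. x \<in> D \<longrightarrow>
      u (x + p) - u x = (\<integral>s. (\<Sum>i\<in>Basis. (p \<bullet> i) * g i (x + s *\<^sub>R p)) \<partial>unit_interval)"
      by eventually_elim (use cone p in blast)
  qed
  then have "AE x in lborel. AE p in ball_measure c \<rho>. x \<in> D \<longrightarrow>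
      u (x + p) - u x = (\<integral>s. (\<Sum>i\<in>Basis. (p \<bullet> i) * g i (x + s *\<^sub>R p)) \<partial>unit_interval)"
    by (subst ball_pair.AE_commute) measurable
  then show ?thesis
  proof eventually_elim
    case (elim x)
    show ?case
    proof
      assume x: "x \<in> D"
      have "AE p in ball_measure c \<rho>. p \<in> ball c \<rho>" by (simp add: AE_ball_measure)
      with elim have "AE p in ball_measure c \<rho>. ennreal \<bar>u x\<bar> \<le>
          ennreal \<bar>u (x + 1 *\<^sub>R p)\<bar> + ennreal R * (\<integral>\<^sup>+s. ennreal (G (x + s *\<^sub>R p)) \<partial>unit_interval)"
      proof eventually_elim
        case (elim p)
        have np: "norm p \<le> R" using elim(2) norm_triangle_ineq2[of p c] by (auto simp: R_def dist_norm norm_minus_commute)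
        have "\<bar>\<Sum>i\<in>Basis. (p \<bullet> i) * g i y\<bar> \<le> R * G y" for y
        proof -
          have "\<bar>\<Sum>i\<in>Basis. (p \<bullet> i) * g i y\<bar> \<le> (\<Sum>i\<in>Basis. \<bar>(p \<bullet> i) * g i y\<bar>)" by (rule sum_abs)
          also have "\<dots> \<le> (\<Sum>i\<in>Basis. R * \<bar>g i y\<bar>)"
            using Basis_le_norm[of _ p] np by (intro sum_mono) (force simp: abs_mult intro!: mult_right_mono)
          finally show ?thesis by (simp add: G_def sum_distrib_left)
        qed
        then have "(\<integral>\<^sup>+s. ennreal \<bar>\<Sum>i\<in>Basis. (p \<bullet> i) * g i (x + s *\<^sub>R p)\<bar> \<partial>unit_interval)
            \<le> (\<integral>\<^sup>+s. ennreal R * ennreal (G (x + s *\<^sub>R p)) \<partial>unit_interval)"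
          using R0 G0 by (intro nn_integral_mono) (simp add: ennreal_mult[symmetric] ennreal_leI)
        also have "\<dots> = ennreal R * (\<integral>\<^sup>+s. ennreal (G (x + s *\<^sub>R p)) \<partial>unit_interval)"
          by (rule nn_integral_cmult) measurable
        finally have int: "ennreal \<bar>u (x + p) - u x\<bar> \<le> ennreal R * (\<integral>\<^sup>+s. ennreal (G (x + s *\<^sub>R p)) \<partial>unit_interval)"
          using elim(1) x ennreal_abs_integral_le[of unit_interval "\<lambda>s. \<Sum>i\<in>Basis. (p \<bullet> i) * g i (x + s *\<^sub>R p)"] by simp
        have "ennreal \<bar>u x\<bar> \<le> ennreal (\<bar>u (x + p)\<bar> + \<bar>u (x + p) - u x\<bar>)" by (rule ennreal_leI) linarith
        also have "\<dots> = ennreal \<bar>u (x + p)\<bar> + ennreal \<bar>u (x + p) - u x\<bar>" by simp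
        also have "\<dots> \<le> ennreal \<bar>u (x + p)\<bar> + ennreal R * (\<integral>\<^sup>+s. ennreal (G (x + s *\<^sub>R p)) \<partial>unit_interval)"
          by (intro add_left_mono int)
        finally show ?case by simp
      qed
      then have "(\<integral>\<^sup>+p. ennreal \<bar>u x\<bar> \<partial>ball_measure c \<rho>) \<le>
          (\<integral>\<^sup>+p. ennreal \<bar>u (x + 1 *\<^sub>R p)\<bar> + ennreal R * (\<integral>\<^sup>+s. ennreal (G (x + s *\<^sub>R p)) \<partial>unit_interval) \<partial>ball_measure c \<rho>)"
        by (rule nn_integral_mono_AE)
      also have "\<dots> = (\<integral>\<^sup>+p. ennreal \<bar>u (x + 1 *\<^sub>R p)\<bar> \<partial>ball_measure c \<rho>) +
          ennreal R * (\<integral>\<^sup>+p. (\<integral>\<^sup>+s. ennreal (G (x + s *\<^sub>R p)) \<partial>unit_interval) \<partial>ball_measure c \<rho>)"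
        by (subst nn_integral_add) (measurable, simp add: nn_integral_cmult)
      also have "(\<integral>\<^sup>+p. (\<integral>\<^sup>+s. ennreal (G (x + s *\<^sub>R p)) \<partial>unit_interval) \<partial>ball_measure c \<rho>) =
          (\<integral>\<^sup>+p. (\<integral>\<^sup>+s. ennreal (2 * s) * ennreal (G (x + s\<^sup>2 *\<^sub>R p)) \<partial>unit_interval) \<partial>ball_measure c \<rho>)"
        using nn_integral_unit_interval_square[of "\<lambda>s. G (x + s *\<^sub>R p)" for p] G0 by simp
      also have "\<dots> = (\<integral>\<^sup>+s. (\<integral>\<^sup>+p. ennreal (2 * s) * ennreal (G (x + s\<^sup>2 *\<^sub>R p)) \<partial>ball_measure c \<rho>) \<partial>unit_interval)"
        by (rule ball_unit.Fubini'[symmetric]) measurable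
      also have "\<dots> = cone_potential c \<rho> (\<lambda>x. ennreal (G x)) x"
        unfolding cone_potential_def by (intro nn_integral_cong nn_integral_cmult) measurable
      also have "(\<integral>\<^sup>+p. ennreal \<bar>u (x + 1 *\<^sub>R p)\<bar> \<partial>ball_measure c \<rho>) \<le> (\<integral>\<^sup>+x. ennreal \<bar>u x\<bar> \<partial>lborel)"
        using nn_integral_ball_measure_scale[where H = "\<lambda>x. ennreal \<bar>u x\<bar>" and t = 1 and x = x and c = c and \<rho> = \<rho>] by simp
      finally show "ennreal \<bar>u x\<bar> * ennreal m \<le> (\<integral>\<^sup>+x. ennreal \<bar>u x\<bar> \<partial>lborel) +
          ennreal (norm c + \<rho>) * cone_potential c \<rho> (\<lambda>x. ennreal (\<Sum>i\<in>Basis. \<bar>g i x\<bar>)) x"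
        using m unfolding R_def G_def by (simp add: add_right_mono del: ennreal_plus)
    qed
  qed
qed

section \<open>Functions with an integrable power\<close>

definition power_integrable :: "nat \<Rightarrow> ('a::euclidean_space \<Rightarrow> real) \<Rightarrow> bool" where
  "power_integrable n f \<longleftrightarrow> f \<in> borel_measurable borel \<and> integrable lborel (\<lambda>x. \<bar>f x\<bar> ^ n)"

lemma power_add_le:
  fixes a b :: real
  assumes "0 \<le> a" "0 \<le> b"
  shows "(a + b) ^ n \<le> 2 ^ n * (a ^ n + b ^ n)"
proof -
  have "(a + b) ^ n \<le> (2 * max a b) ^ n" using assms by (intro power_mono) auto
  also have "\<dots> = 2 ^ n * max a b ^ n" by (simp add: power_mult_distrib)
  also have "max a b ^ n \<le> a ^ n + b ^ n" using assms by (simp add: max_def)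
  finally show ?thesis by simp
qed

lemma power_integrable_bound:
  assumes "power_integrable n f" "g \<in> borel_measurable borel" "AE x in lborel. \<bar>g x\<bar> \<le> C * \<bar>f x\<bar>"
  shows "power_integrable n g"
  unfolding power_integrable_def
proof (rule conjI[OF assms(2)], rule Bochner_Integration.integrable_bound)
  show "integrable lborel (\<lambda>x. C ^ n * \<bar>f x\<bar> ^ n)" using assms(1) by (simp add: power_integrable_def)
  show "AE x in lborel. norm (\<bar>g x\<bar> ^ n) \<le> norm (C ^ n * \<bar>f x\<bar> ^ n)"
    using assms(3)
  proof eventually_elim
    case (elim x)
    have "\<bar>g x\<bar> ^ n \<le> (C * \<bar>f x\<bar>) ^ n" using elim by (intro power_mono) auto
    also have "\<dots> \<le> \<bar>(C * \<bar>f x\<bar>) ^ n\<bar>" by simp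
    finally show ?case by (simp add: power_mult_distrib)
  qed
  have "g \<in> borel_measurable lborel" using assms(2) by simp
  then show "(\<lambda>x. \<bar>g x\<bar> ^ n) \<in> borel_measurable lborel"
    by (intro borel_measurable_power borel_measurable_abs)
qed

lemma power_integrable_add:
  assumes "power_integrable n f" "power_integrable n g"
  shows "power_integrable n (\<lambda>x. f x + g x)"
  unfolding power_integrable_def
proof (rule conjI)
  have [measurable]: "f \<in> borel_measurable borel" "g \<in> borel_measurable borel"
    using assms by (auto simp: power_integrable_def)
  show "(\<lambda>x. f x + g x) \<in> borel_measurable borel" by measurable
  have bound: "integrable lborel (\<lambda>x. 2 ^ n * (\<bar>f x\<bar> ^ n + \<bar>g x\<bar> ^ n))"
    using assms by (simp add: power_integrable_def)
  have "\<bar>f x + g x\<bar> ^ n \<le> 2 ^ n * (\<bar>f x\<bar> ^ n + \<bar>g x\<bar> ^ n)" for x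
    using power_mono[OF abs_triangle_ineq[of "f x" "g x"] abs_ge_zero, of n] power_add_le[of "\<bar>f x\<bar>" "\<bar>g x\<bar>" n] by linarith
  then have "AE x in lborel. norm (\<bar>f x + g x\<bar> ^ n) \<le> norm (2 ^ n * (\<bar>f x\<bar> ^ n + \<bar>g x\<bar> ^ n))"
    by (intro AE_I2) simp
  then show "integrable lborel (\<lambda>x. \<bar>f x + g x\<bar> ^ n)"
    by (intro Bochner_Integration.integrable_bound[OF bound]) measurable
qed

lemma power_integrable_zero: "n > 0 \<Longrightarrow> power_integrable n (\<lambda>x. 0)"
  by (simp add: power_integrable_def zero_power)

lemma power_integrable_cmult:
  assumes "power_integrable n f"
  shows "power_integrable n (\<lambda>x. c * f x)"
  using assms by (auto simp: power_integrable_def abs_mult power_mult_distrib)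

lemma power_integrable_sum:
  assumes "finite I" "n > 0" "\<And>i. i \<in> I \<Longrightarrow> power_integrable n (f i)"
  shows "power_integrable n (\<lambda>x. \<Sum>i\<in>I. f i x)"
  using assms(1,3) by (induction I rule: finite_induct)
    (auto intro: power_integrable_zero[OF assms(2)] power_integrable_add)

lemma power_integrable_abs: "power_integrable n f \<Longrightarrow> power_integrable n (\<lambda>x. \<bar>f x\<bar>)"
  by (auto simp: power_integrable_def)

lemma nn_integral_power_integrable:
  assumes "power_integrable n f" "\<And>x. 0 \<le> f x"
  shows "(\<integral>\<^sup>+x. ennreal (f x) ^ n \<partial>lborel) < \<infinity>"
  using assms by (simp add: power_integrable_def integrable_iff_bounded ennreal_power)

lemma power_integrable_iff_nn_integral:
  "power_integrable n f \<longleftrightarrow> f \<in> borel_measurable borel \<and> (\<integral>\<^sup>+x. ennreal \<bar>f x\<bar> ^ n \<partial>lborel) < \<infinity>"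
  by (auto simp: power_integrable_def integrable_iff_bounded ennreal_power)

section \<open>Sobolev embeddings under the cone property\<close>

text \<open>A local uniform interior cone condition: near each point of the closure, the segments from \<open>x\<close> to
\<open>x + p\<close>, with \<open>p\<close> in a fixed ball, stay in \<open>\<Omega>\<close>. The ball may be centred at the origin, which is
the natural choice at interior points.\<close>

definition cone_property :: "'a::euclidean_space set \<Rightarrow> bool" where
  "cone_property \<Omega> \<longleftrightarrow> (\<forall>z\<in>closure \<Omega>. \<exists>r>0. \<exists>c. \<exists>\<rho>>0. \<forall>x\<in>\<Omega> \<inter> ball z r. \<forall>p\<in>ball c \<rho>. x \<in> line_domain \<Omega> p)"

lemma bounded_local_to_global:
  fixes \<Omega> :: "'a::euclidean_space set"
  assumes "bounded \<Omega>" and "P {}" and Un: "\<And>A B. P A \<Longrightarrow> P B \<Longrightarrow> P (A \<union> B)"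
    and loc: "\<And>z. z \<in> closure \<Omega> \<Longrightarrow> \<exists>r>0. P (\<Omega> \<inter> ball z r)"
  shows "P \<Omega>"
proof -
  have "\<forall>z\<in>closure \<Omega>. \<exists>r. r > 0 \<and> P (\<Omega> \<inter> ball z r)" using loc by blast
  from bchoice[OF this] obtain r where r: "\<And>z. z \<in> closure \<Omega> \<Longrightarrow> r z > 0 \<and> P (\<Omega> \<inter> ball z (r z))"
    by blast
  have "compact (closure \<Omega>)" using assms(1) by (simp add: compact_closure)
  moreover have "closure \<Omega> \<subseteq> (\<Union>z\<in>closure \<Omega>. ball z (r z))" using r by force
  ultimately obtain Z where Z: "Z \<subseteq> closure \<Omega>" "finite Z" "closure \<Omega> \<subseteq> (\<Union>z\<in>Z. ball z (r z))"
    using compactE_image[of "closure \<Omega>" "closure \<Omega>" "\<lambda>z. ball z (r z)"] open_ball by blast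
  have "P (\<Union>z\<in>Z. \<Omega> \<inter> ball z (r z))"
    using Z(2,1) by (induction Z rule: finite_induct) (auto intro: assms(2) Un simp: r)
  moreover have "(\<Union>z\<in>Z. \<Omega> \<inter> ball z (r z)) = \<Omega>" using Z(3) closure_subset[of \<Omega>] by blast
  ultimately show ?thesis by simp
qed

lemma ennreal_power_add_le:
  fixes a b :: ennreal
  shows "(a + b) ^ n \<le> 2 ^ n * (a ^ n + b ^ n)"
proof (cases "a \<le> b")
  case True
  then have "(a + b) ^ n \<le> (2 * b) ^ n" by (intro power_mono) (auto simp: mult_2 add_right_mono)
  also have "\<dots> \<le> 2 ^ n * (a ^ n + b ^ n)" by (auto simp: power_mult_distrib intro!: mult_left_mono)
  finally show ?thesis .
next
  case False
  then have "(a + b) ^ n \<le> (2 * a) ^ n" by (intro power_mono) (auto simp: mult_2 add_left_mono)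
  also have "\<dots> \<le> 2 ^ n * (a ^ n + b ^ n)" by (auto simp: power_mult_distrib intro!: mult_left_mono)
  finally show ?thesis .
qed

lemma cone_potential_measurable [measurable]:
  assumes [measurable]: "G \<in> borel_measurable borel"
  shows "cone_potential c \<rho> G \<in> borel_measurable borel"
  unfolding cone_potential_def[abs_def] by measurable

text \<open>The representation by cones near a given point of the closure, with the geometric data reduced to
the constants that matter for the estimates.\<close>

lemma local_cone_estimate:
  fixes u :: "'a::euclidean_space \<Rightarrow> real"
  assumes \<Omega>: "open \<Omega>" "cone_property \<Omega>"
    and w: "\<And>i. i \<in> Basis \<Longrightarrow> weak_partial \<Omega> i u (g i)"
    and z: "z \<in> closure \<Omega>"
  shows "\<exists>r>0. \<exists>c \<rho> m R. m > 0 \<and> R < \<infinity> \<and>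
      emeasure (ball_measure c \<rho>) (space (ball_measure c \<rho>)) = ennreal m \<and>
      (AE x in lborel. x \<in> \<Omega> \<inter> ball z r \<longrightarrow> ennreal \<bar>u x\<bar> * ennreal m \<le>
        (\<integral>\<^sup>+x. ennreal \<bar>u x\<bar> \<partial>lborel) + R * cone_potential c \<rho> (\<lambda>x. ennreal (\<Sum>i\<in>Basis. \<bar>g i x\<bar>)) x)"
proof -
  obtain r c \<rho> where r: "r > 0" "\<rho> > 0" and cone: "\<forall>x\<in>\<Omega> \<inter> ball z r. \<forall>p\<in>ball c \<rho>. x \<in> line_domain \<Omega> p"
    using \<Omega>(2) z unfolding cone_property_def by blast
  obtain m where m: "m > 0" "emeasure (ball_measure c \<rho>) (space (ball_measure c \<rho>)) = ennreal m"
    using ball_measure_mass[OF r(2), of c] .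
  have D: "\<Omega> \<inter> ball z r \<in> sets borel" using \<Omega>(1) by (intro borel_open open_Int) auto
  have "AE x in lborel. x \<in> \<Omega> \<inter> ball z r \<longrightarrow> ennreal \<bar>u x\<bar> * ennreal m \<le> (\<integral>\<^sup>+x. ennreal \<bar>u x\<bar> \<partial>lborel) + ennreal (norm c + \<rho>) * cone_potential c \<rho> (\<lambda>x. ennreal (\<Sum>i\<in>Basis. \<bar>g i x\<bar>)) x"
    using cone by (intro cone_representation[OF \<Omega>(1) D r(2) _ w m(2)]) simp_all
  note est = this
  show ?thesis
    by (rule exI[of _ r], rule conjI[OF r(1)], rule exI[of _ c], rule exI[of _ \<rho>], rule exI[of _ m],
      rule exI[of _ "ennreal (norm c + \<rho>)"], intro conjI m est) simp
qed

text \<open>Near each point of the closure \<open>u\<close> is bounded by a constant plus a multiple of the potential of an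
\<open>L\<^sup>3\<close> function, which is in \<open>L\<^sup>6\<close>; finitely many such neighbourhoods cover the bounded set \<open>\<Omega>\<close>.\<close>

lemma sobolev_embedding_L6:
  fixes u :: "'a::euclidean_space \<Rightarrow> real"
  assumes dim: "DIM('a) = 3" and \<Omega>: "open \<Omega>" "bounded \<Omega>" "cone_property \<Omega>"
    and w: "\<And>i. i \<in> Basis \<Longrightarrow> weak_partial \<Omega> i u (g i)"
    and zero: "\<And>x. x \<notin> \<Omega> \<Longrightarrow> u x = 0"
    and g: "\<And>i. i \<in> Basis \<Longrightarrow> power_integrable 3 (g i)"
  shows "power_integrable 6 u"
proof -
  obtain j :: 'a where "j \<in> Basis" using nonempty_Basis by blast
  then have u: "integrable lborel u" using w[of j] by (simp add: weak_partial_def)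
  note [measurable] = borel_measurable_integrable[OF u]
  have [measurable]: "i \<in> Basis \<Longrightarrow> g i \<in> borel_measurable borel" for i
    using w[of i] borel_measurable_integrable[of lborel "g i"] by (simp add: weak_partial_def)
  define a where "a = (\<integral>\<^sup>+x. ennreal \<bar>u x\<bar> \<partial>lborel)"
  have a: "a < \<infinity>" using u by (simp add: a_def integrable_iff_bounded)
  define G where "G x = ennreal (\<Sum>i\<in>Basis. \<bar>g i x\<bar>)" for x
  have [measurable]: "G \<in> borel_measurable borel" unfolding G_def[abs_def] by measurable
  have G: "(\<integral>\<^sup>+x. G x ^ n \<partial>lborel) < \<infinity>" if "n > 0" "\<And>i. i \<in> Basis \<Longrightarrow> power_integrable n (g i)" for n
    unfolding G_def using that
    by (intro nn_integral_power_integrable power_integrable_sum power_integrable_abs) (auto intro: sum_nonneg)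
  have local_est: "\<exists>r>0. \<exists>c \<rho> m R. m > 0 \<and> R < \<infinity> \<and>
      emeasure (ball_measure c \<rho>) (space (ball_measure c \<rho>)) = ennreal m \<and>
      (AE x in lborel. x \<in> \<Omega> \<inter> ball z r \<longrightarrow> ennreal \<bar>u x\<bar> * ennreal m \<le> a + R * cone_potential c \<rho> G x)"
    if z: "z \<in> closure \<Omega>" for z
    unfolding a_def G_def by (rule local_cone_estimate[OF \<Omega>(1,3) w z])
  \<comment> \<open>Measurability is part of the property that is patched together, because additivity of the
    integral over a union needs it.\<close>
  have "\<Omega> \<in> sets borel \<and> (\<integral>\<^sup>+x. ennreal \<bar>u x\<bar> ^ 6 * indicator \<Omega> x \<partial>lborel) < \<infinity>"
  proof (rule bounded_local_to_global[OF \<Omega>(2), where P = "\<lambda>A. A \<in> sets borel \<and> (\<integral>\<^sup>+x. ennreal \<bar>u x\<bar> ^ 6 * indicator A x \<partial>lborel) < \<infinity>"])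
    show "{} \<in> sets borel \<and> (\<integral>\<^sup>+x. ennreal \<bar>u x\<bar> ^ 6 * indicator {} x \<partial>lborel) < \<infinity>"
      by simp
    show "A \<union> B \<in> sets borel \<and> (\<integral>\<^sup>+x. ennreal \<bar>u x\<bar> ^ 6 * indicator (A \<union> B) x \<partial>lborel) < \<infinity>"
      if A: "A \<in> sets borel \<and> (\<integral>\<^sup>+x. ennreal \<bar>u x\<bar> ^ 6 * indicator A x \<partial>lborel) < \<infinity>"
        and B: "B \<in> sets borel \<and> (\<integral>\<^sup>+x. ennreal \<bar>u x\<bar> ^ 6 * indicator B x \<partial>lborel) < \<infinity>" for A B
    proof -
      have [measurable]: "A \<in> sets borel" "B \<in> sets borel" using A B by auto
      have "(\<integral>\<^sup>+x. ennreal \<bar>u x\<bar> ^ 6 * indicator (A \<union> B) x \<partial>lborel) \<le>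
        (\<integral>\<^sup>+x. ennreal \<bar>u x\<bar> ^ 6 * indicator A x + ennreal \<bar>u x\<bar> ^ 6 * indicator B x \<partial>lborel)"
        by (intro nn_integral_mono) (auto simp: indicator_def)
      also have "\<dots> < \<infinity>" using A B by (subst nn_integral_add) auto
      finally show ?thesis by simp
    qed
    fix z assume "z \<in> closure \<Omega>"
    from local_est[OF this] obtain r c \<rho> m R where r: "r > 0" and m: "m > 0" and R: "R < \<infinity>"
      and mass: "emeasure (ball_measure c \<rho>) (space (ball_measure c \<rho>)) = ennreal m"
      and est: "AE x in lborel. x \<in> \<Omega> \<inter> ball z r \<longrightarrow> ennreal \<bar>u x\<bar> * ennreal m \<le> a + R * cone_potential c \<rho> G x"
      by (elim exE conjE) (rule that)
    define D where "D = \<Omega> \<inter> ball z r"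
    have D[measurable]: "D \<in> sets borel" using \<Omega>(1) unfolding D_def by (intro borel_open open_Int) auto
    have Dfin: "emeasure lborel D < \<infinity>"
      by (rule emeasure_bounded_finite) (auto simp: D_def intro: bounded_subset[OF bounded_ball])
    have K: "(\<integral>\<^sup>+x. cone_potential c \<rho> G x ^ 6 \<partial>lborel) < \<infinity>"
    proof (rule le_less_trans[OF cone_potential_L6[OF _ dim mass]])
      show "64 * ennreal m ^ 5 * (\<integral>\<^sup>+x. G x ^ 3 \<partial>lborel)\<^sup>2 < \<infinity>"
        using G[of 3] g by (simp add: ennreal_mult_less_top power_less_top_ennreal)
    qed simp
    have "ennreal m ^ 6 * (\<integral>\<^sup>+x. ennreal \<bar>u x\<bar> ^ 6 * indicator D x \<partial>lborel) =
        (\<integral>\<^sup>+x. ennreal m ^ 6 * (ennreal \<bar>u x\<bar> ^ 6 * indicator D x) \<partial>lborel)"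
      by (subst nn_integral_cmult) auto
    also have "\<dots> \<le> (\<integral>\<^sup>+x. 2 ^ 6 * a ^ 6 * indicator D x + 2 ^ 6 * R ^ 6 * cone_potential c \<rho> G x ^ 6 \<partial>lborel)"
    proof (rule nn_integral_mono_AE)
      show "AE x in lborel. ennreal m ^ 6 * (ennreal \<bar>u x\<bar> ^ 6 * indicator D x) \<le>
          2 ^ 6 * a ^ 6 * indicator D x + 2 ^ 6 * R ^ 6 * cone_potential c \<rho> G x ^ 6"
        using est
      proof eventually_elim
        case (elim x)
        show ?case
        proof (cases "x \<in> D")
          case True
          have "ennreal m ^ 6 * ennreal \<bar>u x\<bar> ^ 6 = (ennreal \<bar>u x\<bar> * ennreal m) ^ 6"
            by (simp add: power_mult_distrib mult.commute)
          also have "\<dots> \<le> (a + R * cone_potential c \<rho> G x) ^ 6"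
            using elim True by (intro power_mono) (auto simp: D_def)
          also have "\<dots> \<le> 2 ^ 6 * (a ^ 6 + (R * cone_potential c \<rho> G x) ^ 6)"
            by (rule ennreal_power_add_le)
          finally show ?thesis using True by (simp add: power_mult_distrib distrib_left mult.assoc)
        qed simp
      qed
    qed
    also have "\<dots> = 2 ^ 6 * a ^ 6 * emeasure lborel D + 2 ^ 6 * R ^ 6 * (\<integral>\<^sup>+x. cone_potential c \<rho> G x ^ 6 \<partial>lborel)"
      by (subst nn_integral_add) (auto simp: nn_integral_cmult)
    also have "\<dots> < \<infinity>"
      using a R K Dfin by (auto simp: ennreal_mult_less_top power_less_top_ennreal)
    finally have "(\<integral>\<^sup>+x. ennreal \<bar>u x\<bar> ^ 6 * indicator D x \<partial>lborel) < \<infinity>"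
      using m by (auto simp: ennreal_mult_less_top ennreal_power)
    then show "\<exists>r>0. \<Omega> \<inter> ball z r \<in> sets borel \<and> (\<integral>\<^sup>+x. ennreal \<bar>u x\<bar> ^ 6 * indicator (\<Omega> \<inter> ball z r) x \<partial>lborel) < \<infinity>"
      using r D unfolding D_def by blast
  qed
  moreover have "ennreal \<bar>u x\<bar> ^ 6 * indicator \<Omega> x = ennreal \<bar>u x\<bar> ^ 6" for x
    using zero[of x] by (cases "x \<in> \<Omega>") auto
  ultimately show ?thesis by (simp add: power_integrable_iff_nn_integral)
qed

text \<open>The same covering argument, now with the pointwise bound on the potential of an \<open>L\<^sup>6\<close> function.\<close>

lemma sobolev_embedding_bounded:
  fixes u :: "'a::euclidean_space \<Rightarrow> real"
  assumes dim: "DIM('a) = 3" and \<Omega>: "open \<Omega>" "bounded \<Omega>" "cone_property \<Omega>"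
    and w: "\<And>i. i \<in> Basis \<Longrightarrow> weak_partial \<Omega> i u (g i)"
    and zero: "\<And>x. x \<notin> \<Omega> \<Longrightarrow> u x = 0"
    and g: "\<And>i. i \<in> Basis \<Longrightarrow> power_integrable 6 (g i)"
  shows "\<exists>C. AE x in lborel. \<bar>u x\<bar> \<le> C"
proof -
  obtain j :: 'a where "j \<in> Basis" using nonempty_Basis by blast
  then have u: "integrable lborel u" using w[of j] by (simp add: weak_partial_def)
  note [measurable] = borel_measurable_integrable[OF u]
  have [measurable]: "i \<in> Basis \<Longrightarrow> g i \<in> borel_measurable borel" for i
    using w[of i] borel_measurable_integrable[of lborel "g i"] by (simp add: weak_partial_def)
  define a where "a = (\<integral>\<^sup>+x. ennreal \<bar>u x\<bar> \<partial>lborel)"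
  have a: "a < \<infinity>" using u by (simp add: a_def integrable_iff_bounded)
  define G where "G x = ennreal (\<Sum>i\<in>Basis. \<bar>g i x\<bar>)" for x
  have [measurable]: "G \<in> borel_measurable borel" unfolding G_def[abs_def] by measurable
  have G: "(\<integral>\<^sup>+x. G x ^ n \<partial>lborel) < \<infinity>" if "n > 0" "\<And>i. i \<in> Basis \<Longrightarrow> power_integrable n (g i)" for n
    unfolding G_def using that
    by (intro nn_integral_power_integrable power_integrable_sum power_integrable_abs) (auto intro: sum_nonneg)
  have local_est: "\<exists>r>0. \<exists>c \<rho> m R. m > 0 \<and> R < \<infinity> \<and>
      emeasure (ball_measure c \<rho>) (space (ball_measure c \<rho>)) = ennreal m \<and>
      (AE x in lborel. x \<in> \<Omega> \<inter> ball z r \<longrightarrow> ennreal \<bar>u x\<bar> * ennreal m \<le> a + R * cone_potential c \<rho> G x)"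
    if z: "z \<in> closure \<Omega>" for z
    unfolding a_def G_def by (rule local_cone_estimate[OF \<Omega>(1,3) w z])
  have "\<exists>C. AE x in lborel. x \<in> \<Omega> \<longrightarrow> \<bar>u x\<bar> \<le> C"
  proof (rule bounded_local_to_global[OF \<Omega>(2), where P = "\<lambda>A. \<exists>C. AE x in lborel. x \<in> A \<longrightarrow> \<bar>u x\<bar> \<le> C"])
    show "\<exists>C. AE x in lborel. x \<in> {} \<longrightarrow> \<bar>u x\<bar> \<le> C" by simp
    show "\<exists>C. AE x in lborel. x \<in> A \<union> B \<longrightarrow> \<bar>u x\<bar> \<le> C"
      if A: "\<exists>C. AE x in lborel. x \<in> A \<longrightarrow> \<bar>u x\<bar> \<le> C" and B: "\<exists>C. AE x in lborel. x \<in> B \<longrightarrow> \<bar>u x\<bar> \<le> C" for A B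
    proof -
      obtain C1 where C1: "AE x in lborel. x \<in> A \<longrightarrow> \<bar>u x\<bar> \<le> C1" using A by blast
      obtain C2 where C2: "AE x in lborel. x \<in> B \<longrightarrow> \<bar>u x\<bar> \<le> C2" using B by blast
      have "AE x in lborel. x \<in> A \<union> B \<longrightarrow> \<bar>u x\<bar> \<le> max C1 C2" using C1 C2 by eventually_elim auto
      then show ?thesis by blast
    qed
    fix z assume "z \<in> closure \<Omega>"
    from local_est[OF this] obtain r c \<rho> m R where r: "r > 0" and m: "m > 0" and R: "R < \<infinity>"
      and mass: "emeasure (ball_measure c \<rho>) (space (ball_measure c \<rho>)) = ennreal m"
      and est: "AE x in lborel. x \<in> \<Omega> \<inter> ball z r \<longrightarrow> ennreal \<bar>u x\<bar> * ennreal m \<le> a + R * cone_potential c \<rho> G x"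
      by (elim exE conjE) (rule that)
    define B where "B = 64 * ennreal m ^ 5 * (\<integral>\<^sup>+x. G x ^ 6 \<partial>lborel)"
    have "B < \<infinity>" using G[of 6] g by (simp add: B_def ennreal_mult_less_top power_less_top_ennreal)
    then have "a + R * (1 + B) < \<infinity>" using a R by (simp add: ennreal_mult_less_top)
    then obtain C where C: "a + R * (1 + B) = ennreal C" "C \<ge> 0" by (cases "a + R * (1 + B)") auto
    \<comment> \<open>This avoids taking a sixth root of \<open>B\<close>.\<close>
    have K: "cone_potential c \<rho> G x \<le> 1 + B" for x
    proof (cases "cone_potential c \<rho> G x \<le> 1")
      case True then show ?thesis by (simp add: add_increasing2)
    next
      case False
      then have "cone_potential c \<rho> G x ^ 1 \<le> cone_potential c \<rho> G x ^ 6" by (intro power_increasing) auto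
      also have "\<dots> \<le> B" unfolding B_def by (rule cone_potential_bounded[OF _ dim mass]) simp
      finally show ?thesis by (simp add: add_increasing)
    qed
    have "AE x in lborel. x \<in> \<Omega> \<inter> ball z r \<longrightarrow> \<bar>u x\<bar> \<le> C / m"
      using est
    proof eventually_elim
      case (elim x)
      show ?case
      proof
        assume "x \<in> \<Omega> \<inter> ball z r"
        then have "ennreal \<bar>u x\<bar> * ennreal m \<le> a + R * cone_potential c \<rho> G x" using elim by blast
        also have "\<dots> \<le> ennreal C" unfolding C(1)[symmetric] by (intro add_left_mono mult_left_mono K) simp
        finally have "\<bar>u x\<bar> * m \<le> C" using m C(2) by (simp add: ennreal_mult[symmetric])
        then show "\<bar>u x\<bar> \<le> C / m" using m by (simp add: field_simps)
      qed
    qed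
    then show "\<exists>r>0. \<exists>C. AE x in lborel. x \<in> \<Omega> \<inter> ball z r \<longrightarrow> \<bar>u x\<bar> \<le> C" using r by blast
  qed
  then obtain C where "AE x in lborel. x \<in> \<Omega> \<longrightarrow> \<bar>u x\<bar> \<le> C" by blast
  then have "AE x in lborel. \<bar>u x\<bar> \<le> max 0 C"
  proof eventually_elim
    case (elim x) then show ?case using zero[of x] by (cases "x \<in> \<Omega>") auto
  qed
  then show ?thesis by blast
qed

section \<open>Smooth boundaries have the cone property\<close>

lemma smooth_lipschitz:
  fixes \<gamma> :: "'a::euclidean_space \<Rightarrow> real"
  assumes \<gamma>: "smooth \<gamma>"
  obtains L where "L \<ge> 0" "\<And>x q. x \<in> cball z R \<Longrightarrow> x + q \<in> cball z R \<Longrightarrow> \<bar>\<gamma> (x + q) - \<gamma> x\<bar> \<le> L * norm q"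
proof -
  have "\<forall>b. \<exists>C. \<forall>x\<in>cball z R. \<bar>partial_deriv b \<gamma> x\<bar> \<le> C"
  proof
    fix b
    have "bounded (partial_deriv b \<gamma> ` cball z R)"
      by (intro compact_imp_bounded compact_continuous_image continuous_smooth[OF \<gamma>] compact_cball)
    then show "\<exists>C. \<forall>x\<in>cball z R. \<bar>partial_deriv b \<gamma> x\<bar> \<le> C"
      unfolding bounded_iff by simp
  qed
  from choice[OF this] obtain C where "\<forall>b. \<forall>x\<in>cball z R. \<bar>partial_deriv b \<gamma> x\<bar> \<le> C b"
    by (rule exE)
  then have C: "\<bar>partial_deriv b \<gamma> x\<bar> \<le> C b" if "x \<in> cball z R" for b x using that by blast
  define L where "L = (\<Sum>b\<in>(Basis::'a set). \<bar>C b\<bar>)"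
  have L: "L \<ge> 0" unfolding L_def by (rule sum_nonneg) simp
  have bound: "\<bar>partial_deriv q \<gamma> x\<bar> \<le> L * norm q" if "x \<in> cball z R" for x q
  proof -
    have "\<bar>partial_deriv q \<gamma> x\<bar> \<le> (\<Sum>b\<in>Basis. \<bar>(q \<bullet> b) * partial_deriv b \<gamma> x\<bar>)"
      unfolding partial_deriv_smooth_linear[OF \<gamma>, of q] by (rule sum_abs)
    also have "\<dots> \<le> (\<Sum>b\<in>Basis. norm q * \<bar>C b\<bar>)"
    proof (rule sum_mono)
      fix b :: 'a assume b: "b \<in> Basis"
      have "\<bar>q \<bullet> b\<bar> * \<bar>partial_deriv b \<gamma> x\<bar> \<le> norm q * \<bar>C b\<bar>"
        using Basis_le_norm[OF b, of q] C[OF that, of b] by (intro mult_mono) auto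
      then show "\<bar>(q \<bullet> b) * partial_deriv b \<gamma> x\<bar> \<le> norm q * \<bar>C b\<bar>" by (simp add: abs_mult)
    qed
    also have "\<dots> = L * norm q" by (simp add: L_def sum_distrib_left[symmetric] mult.commute)
    finally show ?thesis .
  qed
  show ?thesis
  proof (rule that[OF L])
    fix x q assume x: "x \<in> cball z R" "x + q \<in> cball z R"
    have "norm (\<gamma> (x + q) - \<gamma> x) \<le> L * norm (x + q - x)"
    proof (rule differentiable_bound[where f' = "\<lambda>x h. partial_deriv h \<gamma> x", OF convex_cball[of z R]])
      show "(\<gamma> has_derivative (\<lambda>h. partial_deriv h \<gamma> y)) (at y within cball z R)" for y
        by (rule has_derivative_at_withinI[OF has_derivative_smooth[OF \<gamma>]])
      show "onorm (\<lambda>h. partial_deriv h \<gamma> y) \<le> L" if "y \<in> cball z R" for y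
        using bound[OF that] L by (intro onorm_bound) auto
    qed (use x in auto)
    then show "\<bar>\<gamma> (x + q) - \<gamma> x\<bar> \<le> L * norm q" by simp
  qed
qed

text \<open>At a boundary point \<open>\<Omega>\<close> is the region above a graph that has some Lipschitz constant \<open>L\<close> nearby. A
step that rises by \<open>\<tau>\<close> and moves sideways by less than \<open>\<rho>\<close> stays above the graph if
\<open>\<tau> \<ge> (L + 1) \<rho>\<close>, because the graph rises by at most \<open>L \<rho>\<close> and the sideways move, which need not
be horizontal, loses at most \<open>\<rho>\<close> of height.\<close>

lemma smooth_boundary_cone_property:
  fixes \<Omega> :: "'a::euclidean_space set"
  assumes \<Omega>: "open \<Omega>" and sb: "smooth_boundary \<Omega>"
  shows "cone_property \<Omega>"
  unfolding cone_property_def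
proof
  fix z assume z: "z \<in> closure \<Omega>"
  show "\<exists>r>0. \<exists>c. \<exists>\<rho>>0. \<forall>x\<in>\<Omega> \<inter> ball z r. \<forall>p\<in>ball c \<rho>. x \<in> line_domain \<Omega> p"
  proof (cases "z \<in> \<Omega>")
    case True
    then obtain d where d: "d > 0" "ball z d \<subseteq> \<Omega>" using \<Omega> by (auto simp: open_contains_ball)
    have "x \<in> line_domain \<Omega> p" if x: "x \<in> \<Omega> \<inter> ball z (d / 2)" and p: "p \<in> ball 0 (d / 2)" for x p
      unfolding line_domain_def
    proof safe
      fix s :: real assume s: "s \<in> {0..1}"
      have "norm (s *\<^sub>R p) \<le> norm p" using s by (auto intro: mult_left_le_one_le)
      moreover have "norm (x - z) < d / 2" "norm p < d / 2" using x p by (auto simp: dist_norm norm_minus_commute)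
      moreover have "norm (x + s *\<^sub>R p - z) \<le> norm (x - z) + norm (s *\<^sub>R p)"
        using norm_triangle_ineq[of "x - z" "s *\<^sub>R p"] by (simp add: algebra_simps)
      ultimately have "x + s *\<^sub>R p \<in> ball z d" unfolding mem_ball dist_norm norm_minus_commute[of z] by linarith
      then show "x + s *\<^sub>R p \<in> \<Omega>" using d by blast
    qed
    moreover have "d / 2 > 0" using d by simp
    ultimately have d2: "d / 2 > 0" and all: "\<forall>x\<in>\<Omega> \<inter> ball z (d / 2). \<forall>p\<in>ball 0 (d / 2). x \<in> line_domain \<Omega> p"
      by blast+
    show ?thesis
      by (rule exI[of _ "d / 2"], rule conjI[OF d2], rule exI[of _ 0], rule exI[of _ "d / 2"], rule conjI[OF d2 all])
  next
    case False
    then have "z \<in> frontier \<Omega>" using z \<Omega> by (simp add: frontier_def interior_open)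
    then obtain R e \<gamma> where R: "R > 0" and e: "norm e = 1" and \<gamma>: "smooth \<gamma>"
      and inv: "\<And>x t. \<gamma> (x + t *\<^sub>R e) = \<gamma> x" and graph: "\<Omega> \<inter> ball z R = {x \<in> ball z R. \<gamma> x < x \<bullet> e}"
      using sb unfolding smooth_boundary_def by blast
    obtain L where L: "L \<ge> 0" and lip: "\<And>x q. x \<in> cball z R \<Longrightarrow> x + q \<in> cball z R \<Longrightarrow> \<bar>\<gamma> (x + q) - \<gamma> x\<bar> \<le> L * norm q"
      by (rule smooth_lipschitz[OF \<gamma>, of z R]) (rule that)
    \<comment> \<open>With this choice \<open>\<rho> + \<tau> = R / 2\<close>, so a step from the ball of radius \<open>R / 2\<close> stays in the ball
      of radius \<open>R\<close>, where \<open>\<Omega>\<close> is described by the graph.\<close>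
    define \<rho> where "\<rho> = R / (2 * (L + 2))"
    define \<tau> where "\<tau> = (L + 1) * \<rho>"
    have \<rho>: "\<rho> > 0" using R L by (simp add: \<rho>_def)
    have \<tau>: "\<tau> \<ge> 0" using \<rho> L by (simp add: \<tau>_def)
    have "\<rho> * (2 * (L + 2)) = R" using L by (simp add: \<rho>_def)
    then have \<rho>\<tau>: "\<rho> + \<tau> = R / 2" by (simp add: \<tau>_def algebra_simps)
    have "x \<in> line_domain \<Omega> p" if x: "x \<in> \<Omega> \<inter> ball z (R / 2)" and p: "p \<in> ball (\<tau> *\<^sub>R e) \<rho>" for x p
      unfolding line_domain_def
    proof safe
      fix s :: real assume s: "s \<in> {0..1}"
      define q where "q = p - \<tau> *\<^sub>R e"
      have pq: "p = q + \<tau> *\<^sub>R e" by (simp add: q_def)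
      have nq: "norm q < \<rho>" using p by (simp add: q_def dist_norm norm_minus_commute)
      have xz: "norm (x - z) < R / 2" using x by (simp add: dist_norm norm_minus_commute)
      have sq: "norm (s *\<^sub>R q) = s * norm q" "s * norm q \<le> norm q" using s by (auto intro: mult_left_le_one_le)
      have "norm (x + s *\<^sub>R q - z) \<le> norm (x - z) + norm (s *\<^sub>R q)"
        using norm_triangle_ineq[of "x - z" "s *\<^sub>R q"] by (simp add: algebra_simps)
      then have xq: "x + s *\<^sub>R q \<in> cball z R"
        using sq nq xz \<rho>\<tau> \<tau> unfolding mem_cball dist_norm norm_minus_commute[of z] by linarith
      have xR: "x \<in> ball z R" using xz R unfolding mem_ball dist_norm norm_minus_commute[of z] by linarith
      have st: "norm ((s * \<tau>) *\<^sub>R e) \<le> \<tau>" using s \<tau> e by (simp add: abs_mult mult_left_le_one_le)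
      have eq: "x + s *\<^sub>R p = (x + s *\<^sub>R q) + (s * \<tau>) *\<^sub>R e" by (simp add: pq algebra_simps)
      have "norm (x + s *\<^sub>R p - z) \<le> norm (x - z) + norm (s *\<^sub>R q) + norm ((s * \<tau>) *\<^sub>R e)"
        using norm_triangle_ineq[of "x - z" "s *\<^sub>R q"] norm_triangle_ineq[of "x - z + s *\<^sub>R q" "(s * \<tau>) *\<^sub>R e"]
        unfolding eq by (simp add: algebra_simps)
      then have inball: "x + s *\<^sub>R p \<in> ball z R"
        using sq nq xz \<rho>\<tau> st unfolding mem_ball dist_norm norm_minus_commute[of z] by linarith
      have "\<gamma> (x + s *\<^sub>R p) = \<gamma> (x + s *\<^sub>R q)" unfolding eq by (rule inv)
      also have "\<dots> \<le> \<gamma> x + L * (s * norm q)"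
      proof -
        have "\<bar>\<gamma> (x + s *\<^sub>R q) - \<gamma> x\<bar> \<le> L * norm (s *\<^sub>R q)"
          by (rule lip[OF _ xq]) (use xR in simp)
        then show ?thesis unfolding sq(1) by linarith
      qed
      also have "\<dots> < x \<bullet> e + L * (s * norm q)"
      proof -
        have "x \<in> {x \<in> ball z R. \<gamma> x < x \<bullet> e}" unfolding graph[symmetric] using x xR by blast
        then show ?thesis by simp
      qed
      also have "\<dots> \<le> (x + s *\<^sub>R p) \<bullet> e"
      proof -
        have "\<bar>q \<bullet> e\<bar> \<le> norm q" using Cauchy_Schwarz_ineq2[of q e] e by simp
        moreover have "(L + 1) * norm q \<le> \<tau>" unfolding \<tau>_def using nq L by (intro mult_left_mono) auto
        ultimately have "L * norm q \<le> \<tau> + q \<bullet> e" by (simp add: algebra_simps)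
        then have "s * (L * norm q) \<le> s * (\<tau> + q \<bullet> e)" using s by (intro mult_left_mono) auto
        moreover have "e \<bullet> e = 1" using e by (simp add: dot_square_norm)
        moreover have "(x + s *\<^sub>R p) \<bullet> e = x \<bullet> e + s * (q \<bullet> e) + s * \<tau> * (e \<bullet> e)"
          by (simp add: pq inner_add_left distrib_left)
        ultimately show ?thesis by (simp add: distrib_left mult.left_commute)
      qed
      finally have "x + s *\<^sub>R p \<in> {x \<in> ball z R. \<gamma> x < x \<bullet> e}" using inball by blast
      then show "x + s *\<^sub>R p \<in> \<Omega>" unfolding graph[symmetric] by blast
    qed
    then have all: "\<forall>x\<in>\<Omega> \<inter> ball z (R / 2). \<forall>p\<in>ball (\<tau> *\<^sub>R e) \<rho>. x \<in> line_domain \<Omega> p"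
      by blast
    have R2: "R / 2 > 0" using R by simp
    show ?thesis
      by (rule exI[of _ "R / 2"], rule conjI[OF R2], rule exI[of _ "\<tau> *\<^sub>R e"], rule exI[of _ \<rho>], rule conjI[OF \<rho> all])
  qed
qed

section \<open>Products of functions with two weak derivatives\<close>

lemma power_integrable_imp_integrable:
  fixes f :: "'a::euclidean_space \<Rightarrow> real"
  assumes f: "power_integrable n f" and "n > 0" and \<Omega>: "bounded \<Omega>" "open \<Omega>" and zero: "\<And>x. x \<notin> \<Omega> \<Longrightarrow> f x = 0"
  shows "integrable lborel f"
proof (rule Bochner_Integration.integrable_bound)
  have "integrable lborel (indicator \<Omega> :: 'a \<Rightarrow> real)"
    using \<Omega> emeasure_bounded_finite[OF \<Omega>(1)] by (auto simp: integrable_indicator_iff)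
  then show "integrable lborel (\<lambda>x. indicator \<Omega> x + \<bar>f x\<bar> ^ n)"
    using f by (simp add: power_integrable_def)
  show "f \<in> borel_measurable lborel" using f by (simp add: power_integrable_def)
  have "\<bar>f x\<bar> \<le> indicator \<Omega> x + \<bar>f x\<bar> ^ n" for x
  proof (cases "x \<in> \<Omega>")
    case True
    have "\<bar>f x\<bar> \<le> 1 + \<bar>f x\<bar> ^ n"
    proof (cases "\<bar>f x\<bar> \<le> 1")
      case False
      then have "\<bar>f x\<bar> ^ 1 \<le> \<bar>f x\<bar> ^ n" using \<open>n > 0\<close> by (intro power_increasing) auto
      then show ?thesis by simp
    qed (simp add: add_increasing2)
    then show ?thesis using True by simp
  qed (simp add: zero)
  then show "AE x in lborel. norm (f x) \<le> norm (indicator \<Omega> x + \<bar>f x\<bar> ^ n)"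
    by (intro AE_I2) (simp add: order_trans[OF _ abs_ge_self])
qed

lemma power_integrable_mult:
  assumes "power_integrable (2 * n) f" "power_integrable (2 * n) g"
  shows "power_integrable n (\<lambda>x. f x * g x)"
proof -
  have [measurable]: "f \<in> borel_measurable borel" "g \<in> borel_measurable borel"
    using assms by (auto simp: power_integrable_def)
  have "integrable lborel (\<lambda>x. \<bar>f x * g x\<bar> ^ n)"
  proof (rule Bochner_Integration.integrable_bound)
    show "integrable lborel (\<lambda>x. \<bar>f x\<bar> ^ (2 * n) + \<bar>g x\<bar> ^ (2 * n))"
      using assms by (simp add: power_integrable_def)
    have "\<bar>f x * g x\<bar> ^ n \<le> \<bar>f x\<bar> ^ (2 * n) + \<bar>g x\<bar> ^ (2 * n)" for x
    proof -
      have "2 * (\<bar>f x\<bar> ^ n * \<bar>g x\<bar> ^ n) \<le> (\<bar>f x\<bar> ^ n)\<^sup>2 + (\<bar>g x\<bar> ^ n)\<^sup>2"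
        using sum_squares_bound[of "\<bar>f x\<bar> ^ n" "\<bar>g x\<bar> ^ n"] by (simp add: mult.assoc)
      moreover have "0 \<le> \<bar>f x\<bar> ^ n * \<bar>g x\<bar> ^ n" by simp
      ultimately show ?thesis by (simp only: abs_mult power_mult_distrib power_mult mult.commute[of 2 n])
    qed
    then show "AE x in lborel. norm (\<bar>f x * g x\<bar> ^ n) \<le> norm (\<bar>f x\<bar> ^ (2 * n) + \<bar>g x\<bar> ^ (2 * n))"
      by (intro AE_I2) (simp add: order_trans[OF _ abs_ge_self])
  qed measurable
  then show ?thesis by (simp add: power_integrable_def)
qed

text \<open>Second order Sobolev functions with exponent three, as Borel functions that vanish outside \<open>\<Omega>\<close>, with
their first and second derivatives made explicit. The second derivatives are first derivatives of
first derivatives, which is the form in which the embeddings and the product rule are used.\<close>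

definition sobolev23 :: "'a::euclidean_space set \<Rightarrow> ('a \<Rightarrow> real) \<Rightarrow> ('a \<Rightarrow> 'a \<Rightarrow> real) \<Rightarrow> ('a \<Rightarrow> 'a \<Rightarrow> 'a \<Rightarrow> real) \<Rightarrow> bool" where
  "sobolev23 \<Omega> u g h \<longleftrightarrow> power_integrable 3 u \<and> (\<forall>x. x \<notin> \<Omega> \<longrightarrow> u x = 0) \<and>
    (\<forall>i\<in>Basis. power_integrable 3 (g i) \<and> (\<forall>x. x \<notin> \<Omega> \<longrightarrow> g i x = 0) \<and> weak_partial \<Omega> i u (g i) \<and>
      (\<forall>j\<in>Basis. power_integrable 3 (h i j) \<and> weak_partial \<Omega> j (g i) (h i j)))"

lemma sobolev23D:
  assumes "sobolev23 \<Omega> u g h"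
  shows "power_integrable 3 u" "\<And>x. x \<notin> \<Omega> \<Longrightarrow> u x = 0"
    "\<And>i. i \<in> Basis \<Longrightarrow> power_integrable 3 (g i)" "\<And>i x. i \<in> Basis \<Longrightarrow> x \<notin> \<Omega> \<Longrightarrow> g i x = 0"
    "\<And>i. i \<in> Basis \<Longrightarrow> weak_partial \<Omega> i u (g i)"
    "\<And>i j. i \<in> Basis \<Longrightarrow> j \<in> Basis \<Longrightarrow> power_integrable 3 (h i j)"
    "\<And>i j. i \<in> Basis \<Longrightarrow> j \<in> Basis \<Longrightarrow> weak_partial \<Omega> j (g i) (h i j)"
  using assms unfolding sobolev23_def by blast+

lemma weak_partial_add:
  assumes "weak_partial \<Omega> y u g" "weak_partial \<Omega> y v h"
  shows "weak_partial \<Omega> y (\<lambda>x. u x + v x) (\<lambda>x. g x + h x)"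
  unfolding weak_partial_def
proof (intro conjI ballI)
  have int: "integrable lborel u" "integrable lborel g" "integrable lborel v" "integrable lborel h"
    using assms by (auto simp: weak_partial_def)
  then show "integrable lborel (\<lambda>x. u x + v x)" "integrable lborel (\<lambda>x. g x + h x)" by simp_all
  fix \<phi> assume \<phi>: "\<phi> \<in> test_functions \<Omega>"
  obtain C where C: "\<And>x. \<bar>\<phi> x\<bar> \<le> C" "\<And>x. \<bar>partial_deriv y \<phi> x\<bar> \<le> C"
    by (rule bounded_test[OF \<phi>, of y]) (rule that)
  have m: "\<phi> \<in> borel_measurable lborel" "partial_deriv y \<phi> \<in> borel_measurable lborel"
    using measurable_test(1)[OF \<phi>] measurable_test(2)[OF \<phi>, of y] by simp_all
  note i1 = int[THEN integrable_bounded_mult[OF _ m(1) C(1)]]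
    and i2 = int[THEN integrable_bounded_mult[OF _ m(2) C(2)]]
  have "(\<integral>x. u x * partial_deriv y \<phi> x \<partial>lborel) = - (\<integral>x. g x * \<phi> x \<partial>lborel)"
     "(\<integral>x. v x * partial_deriv y \<phi> x \<partial>lborel) = - (\<integral>x. h x * \<phi> x \<partial>lborel)"
    using assms \<phi> by (auto simp: weak_partial_def)
  then show "(\<integral>x. (u x + v x) * partial_deriv y \<phi> x \<partial>lborel) = - (\<integral>x. (g x + h x) * \<phi> x \<partial>lborel)"
    using i1 i2 by (simp add: distrib_right)
qed

lemma weak_partial_cmult:
  assumes "weak_partial \<Omega> y u g"
  shows "weak_partial \<Omega> y (\<lambda>x. c * u x) (\<lambda>x. c * g x)"
  using assms by (auto simp: weak_partial_def mult.assoc)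

lemma sobolev23_add:
  assumes "sobolev23 \<Omega> u g h" "sobolev23 \<Omega> v g' h'"
  shows "sobolev23 \<Omega> (\<lambda>x. u x + v x) (\<lambda>i x. g i x + g' i x) (\<lambda>i j x. h i j x + h' i j x)"
  unfolding sobolev23_def using sobolev23D[OF assms(1)] sobolev23D[OF assms(2)]
  by (auto intro!: power_integrable_add weak_partial_add)

lemma sobolev23_cmult:
  assumes "sobolev23 \<Omega> u g h"
  shows "sobolev23 \<Omega> (\<lambda>x. c * u x) (\<lambda>i x. c * g i x) (\<lambda>i j x. c * h i j x)"
  unfolding sobolev23_def using sobolev23D[OF assms]
  by (auto intro!: power_integrable_cmult weak_partial_cmult)

lemma power_integrable_mult_bounded:
  assumes "f \<in> borel_measurable borel" "AE x in lborel. \<bar>f x\<bar> \<le> C" "power_integrable n g"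
  shows "power_integrable n (\<lambda>x. f x * g x)"
proof (rule power_integrable_bound[OF assms(3)])
  have "g \<in> borel_measurable borel" using assms(3) by (simp add: power_integrable_def)
  then show "(\<lambda>x. f x * g x) \<in> borel_measurable borel" using assms(1) by measurable
  show "AE x in lborel. \<bar>f x * g x\<bar> \<le> C * \<bar>g x\<bar>"
    using assms(2) by eventually_elim (auto simp: abs_mult intro: mult_right_mono)
qed

text \<open>The gradients are in \<open>L\<^sup>6\<close> since they have gradients in \<open>L\<^sup>3\<close>, and then the functions are bounded since
they have gradients in \<open>L\<^sup>6\<close>. In the second derivatives of the product the terms with two derivatives
on one factor are bounded times \<open>L\<^sup>3\<close>, and the products of two gradients are \<open>L\<^sup>6\<close> times \<open>L\<^sup>6\<close>, hence
in \<open>L\<^sup>3\<close>.\<close>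

proposition sobolev23_mult:
  fixes u v :: "'a::euclidean_space \<Rightarrow> real"
  assumes dim: "DIM('a) = 3" and \<Omega>: "open \<Omega>" "bounded \<Omega>" "cone_property \<Omega>"
    and su: "sobolev23 \<Omega> u g h" and sv: "sobolev23 \<Omega> v g' h'"
  shows "sobolev23 \<Omega> (\<lambda>x. u x * v x) (\<lambda>i x. u x * g' i x + g i x * v x)
    (\<lambda>i j x. (u x * h' i j x + g j x * g' i x) + (g i x * g' j x + h i j x * v x))"
proof -
  note u = sobolev23D[OF su] and v = sobolev23D[OF sv]
  have g6: "power_integrable 6 (g i)" "power_integrable 6 (g' i)" if "i \<in> Basis" for i
    using sobolev_embedding_L6[OF dim \<Omega>, of "g i" "h i"] sobolev_embedding_L6[OF dim \<Omega>, of "g' i" "h' i"]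
      u(4,6,7) v(4,6,7) that by blast+
  obtain Cu where Cu: "AE x in lborel. \<bar>u x\<bar> \<le> Cu"
    using sobolev_embedding_bounded[OF dim \<Omega>, of u g] u(2,5) g6 by blast
  obtain Cv where Cv: "AE x in lborel. \<bar>v x\<bar> \<le> Cv"
    using sobolev_embedding_bounded[OF dim \<Omega>, of v g'] v(2,5) g6 by blast
  have m: "u \<in> borel_measurable borel" "v \<in> borel_measurable borel"
    using u(1) v(1) by (simp_all add: power_integrable_def)
  have bu: "power_integrable 3 (\<lambda>x. u x * f x)" and bv: "power_integrable 3 (\<lambda>x. f x * v x)"
    if "power_integrable 3 f" for f
    using power_integrable_mult_bounded[OF m(1) Cu that] power_integrable_mult_bounded[OF m(2) Cv that]
    by (simp_all add: mult.commute)
  have gg: "power_integrable 3 (\<lambda>x. g i x * g' j x)" if "i \<in> Basis" "j \<in> Basis" for i j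
    using power_integrable_mult[of 3 "g i" "g' j"] g6 that by simp
  have int: "integrable lborel f" if "power_integrable 3 f" "\<And>x. x \<notin> \<Omega> \<Longrightarrow> f x = 0" for f
    by (rule power_integrable_imp_integrable[OF that(1) zero_less_numeral \<Omega>(2,1) that(2)])
  have W1: "weak_partial \<Omega> i (\<lambda>x. u x * v x) (\<lambda>x. u x * g' i x + g i x * v x)" if i: "i \<in> Basis" for i
    by (rule weak_partial_mult[OF \<Omega>(1) u(5)[OF i] v(5)[OF i]])
      (intro int power_integrable_add bu bv u(1) v(1) u(3) v(3) i, simp add: u(2) v(2))+
  have W2: "weak_partial \<Omega> j (\<lambda>x. u x * g' i x) (\<lambda>x. u x * h' i j x + g j x * g' i x)" if ij: "i \<in> Basis" "j \<in> Basis" for i j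
    by (rule weak_partial_mult[OF \<Omega>(1) u(5)[OF ij(2)] v(7)[OF ij]])
      (intro int power_integrable_add bu gg v(3) v(6) ij, simp add: u(2) u(4) v(4) ij)+
  have W3: "weak_partial \<Omega> j (\<lambda>x. g i x * v x) (\<lambda>x. g i x * g' j x + h i j x * v x)" if ij: "i \<in> Basis" "j \<in> Basis" for i j
    by (rule weak_partial_mult[OF \<Omega>(1) u(7)[OF ij] v(5)[OF ij(2)]])
      (intro int power_integrable_add bv gg u(3) u(6) ij, simp add: v(2) u(4) v(4) ij)+
  show ?thesis
    unfolding sobolev23_def
  proof (intro conjI ballI allI impI)
    show "power_integrable 3 (\<lambda>x. u x * v x)" by (rule bu[OF v(1)])
    show "u x * v x = 0" if "x \<notin> \<Omega>" for x using u(2)[OF that] by simp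
    fix i :: 'a assume i: "i \<in> Basis"
    show "power_integrable 3 (\<lambda>x. u x * g' i x + g i x * v x)"
      by (intro power_integrable_add bu bv u(3) v(3) i)
    show "u x * g' i x + g i x * v x = 0" if "x \<notin> \<Omega>" for x using u(2)[OF that] v(2)[OF that] by simp
    show "weak_partial \<Omega> i (\<lambda>x. u x * v x) (\<lambda>x. u x * g' i x + g i x * v x)" by (rule W1[OF i])
    fix j :: 'a assume j: "j \<in> Basis"
    show "power_integrable 3 (\<lambda>x. (u x * h' i j x + g j x * g' i x) + (g i x * g' j x + h i j x * v x))"
      by (intro power_integrable_add bu bv gg u(6) v(6) i j)
    show "weak_partial \<Omega> j (\<lambda>x. u x * g' i x + g i x * v x)
        (\<lambda>x. (u x * h' i j x + g j x * g' i x) + (g i x * g' j x + h i j x * v x))"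
      by (rule weak_partial_add[OF W2[OF i j] W3[OF i j]])
  qed
qed

section \<open>Borel representatives of Sobolev functions\<close>

text \<open>The function spaces consist of Lebesgue measurable functions with arbitrary values outside \<open>\<Omega>\<close>.
A Borel version on the whole space makes translations, product measures and Fubini available.\<close>

definition borel_version :: "'a::euclidean_space set \<Rightarrow> ('a \<Rightarrow> real) \<Rightarrow> ('a \<Rightarrow> real) \<Rightarrow> bool" where
  "borel_version \<Omega> u v \<longleftrightarrow> v \<in> borel_measurable borel \<and> (\<forall>x. x \<notin> \<Omega> \<longrightarrow> v x = 0) \<and>
    (AE x in lborel. x \<in> \<Omega> \<longrightarrow> u x = v x)"

lemma borel_version_exists:
  assumes "open \<Omega>" "u \<in> borel_measurable (lebesgue_on \<Omega>)"
  obtains v where "borel_version \<Omega> u v"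
proof -
  have "\<Omega> \<in> sets lebesgue" using assms(1) by (intro sets_completionI_sets) simp
  then have "(\<lambda>x. if x \<in> \<Omega> then u x else 0) \<in> borel_measurable lebesgue"
    using assms(2) by (subst borel_measurable_if)
  from completion_ex_borel_measurable_real[OF this]
  obtain w where w: "w \<in> borel_measurable lborel" "AE x in lborel. (if x \<in> \<Omega> then u x else 0) = w x"
    by blast
  have "\<Omega> \<in> sets borel" using assms(1) by simp
  then have "(\<lambda>x. indicator \<Omega> x * w x) \<in> borel_measurable borel" using w(1) by simp
  moreover have "AE x in lborel. x \<in> \<Omega> \<longrightarrow> u x = indicator \<Omega> x * w x"
    using w(2) by eventually_elim auto
  ultimately have "borel_version \<Omega> u (\<lambda>x. indicator \<Omega> x * w x)"
    by (simp add: borel_version_def)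
  then show ?thesis by (rule that)
qed

lemma AE_lebesgue_on_iff:
  assumes "\<Omega> \<in> sets lebesgue"
  shows "(AE x in lebesgue_on \<Omega>. P x) \<longleftrightarrow> (AE x in lborel. x \<in> \<Omega> \<longrightarrow> P x)"
  using assms by (subst AE_restrict_space_iff) (auto simp: AE_completion_iff)

lemma borel_version_measurable:
  assumes "open \<Omega>" "borel_version \<Omega> u v"
  shows "u \<in> borel_measurable (lebesgue_on \<Omega>)"
proof (rule borel_measurable_if_D, rule measurableI)
  fix S :: "real set" assume S: "S \<in> sets borel"
  let ?u = "\<lambda>x. if x \<in> \<Omega> then u x else 0"
  have "AE x in lborel. ?u x = v x"
    using assms(2) unfolding borel_version_def by (auto elim: eventually_mono)
  then have "AE x in lebesgue. x \<in> v -` S \<longleftrightarrow> x \<in> ?u -` S"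
    unfolding AE_completion_iff by eventually_elim auto
  moreover have "v -` S \<in> sets lebesgue"
    using assms(2) S measurable_sets[of v borel borel S] by (intro sets_completionI_sets) (auto simp: borel_version_def)
  ultimately have "?u -` S \<in> sets lebesgue" by (rule completion.in_sets_AE) simp
  then show "?u -` S \<inter> space lebesgue \<in> sets lebesgue" by simp
qed simp

lemma
  fixes K \<Omega> :: "'a::euclidean_space set" and \<psi> :: "'a \<Rightarrow> real" and F :: "real \<Rightarrow> real"
  assumes K: "K \<in> sets borel" "K \<subseteq> \<Omega>" and \<Omega>: "open \<Omega>" and uv: "borel_version \<Omega> u v"
    and \<psi>: "\<psi> \<in> borel_measurable borel" and F: "F \<in> borel_measurable (borel :: real measure)" "F 0 = 0"
  shows integrable_borel_version:
      "integrable (lebesgue_on K) (\<lambda>x. F (u x) * \<psi> x) \<longleftrightarrow> integrable lborel (\<lambda>x. indicator K x * (F (v x) * \<psi> x))"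
    and integral_borel_version:
      "(LINT x|lebesgue_on K. F (u x) * \<psi> x) = (\<integral>x. indicator K x * (F (v x) * \<psi> x) \<partial>lborel)"
proof -
  have v[measurable]: "v \<in> borel_measurable borel" using uv by (simp add: borel_version_def)
  note [measurable] = \<psi> F(1) K(1)
  have K': "K \<in> sets lebesgue" using K(1) by (intro sets_completionI_sets) simp
  have u: "u \<in> borel_measurable (lebesgue_on K)"
    by (rule measurable_restrict_mono[OF borel_version_measurable[OF \<Omega> uv] K(2)])
  have leb: "f \<in> borel_measurable (lebesgue_on K)" if "f \<in> borel_measurable borel" for f :: "'a \<Rightarrow> real"
    using that by (intro measurable_restrict_space1 measurable_completion) simp
  have AE: "AE x in lebesgue_on K. F (u x) * \<psi> x = F (v x) * \<psi> x"
    unfolding AE_lebesgue_on_iff[OF K'] using uv K(2) unfolding borel_version_def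
    by (auto elim: eventually_mono)
  have mu: "(\<lambda>x. F (u x) * \<psi> x) \<in> borel_measurable (lebesgue_on K)"
    by (rule borel_measurable_times[OF measurable_compose[OF u F(1)] leb[OF \<psi>]])
  have mv: "(\<lambda>x. F (v x) * \<psi> x) \<in> borel_measurable (lebesgue_on K)" by (rule leb) measurable
  have m: "(\<lambda>x. indicator K x * (F (v x) * \<psi> x)) \<in> borel_measurable lborel" by measurable
  have "integrable (lebesgue_on K) (\<lambda>x. F (u x) * \<psi> x) \<longleftrightarrow> integrable (lebesgue_on K) (\<lambda>x. F (v x) * \<psi> x)"
    by (rule integrable_cong_AE[OF mu mv AE])
  also have "\<dots> \<longleftrightarrow> integrable lborel (\<lambda>x. indicator K x * (F (v x) * \<psi> x))"
    using K' m by (subst integrable_restrict_space) (simp_all add: integrable_completion)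
  finally show "integrable (lebesgue_on K) (\<lambda>x. F (u x) * \<psi> x) \<longleftrightarrow> integrable lborel (\<lambda>x. indicator K x * (F (v x) * \<psi> x))" .
  have "(LINT x|lebesgue_on K. F (u x) * \<psi> x) = (LINT x|lebesgue_on K. F (v x) * \<psi> x)"
    by (rule integral_cong_AE[OF mu mv AE])
  also have "\<dots> = (\<integral>x. indicator K x * (F (v x) * \<psi> x) \<partial>lborel)"
    using K' m by (subst integral_restrict_space) (simp_all add: integral_completion)
  finally show "(LINT x|lebesgue_on K. F (u x) * \<psi> x) = (\<integral>x. indicator K x * (F (v x) * \<psi> x) \<partial>lborel)" .
qed

lemma Lp_space_3_iff:
  assumes \<Omega>: "open \<Omega>" and uv: "borel_version \<Omega> u v"
  shows "u \<in> Lp_space 3 \<Omega> \<longleftrightarrow> power_integrable 3 v"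
proof -
  have *: "\<bar>a\<bar> powr 3 = \<bar>a\<bar> ^ 3" for a :: real by (cases "a = 0") simp_all
  have zero: "\<And>x. x \<notin> \<Omega> \<Longrightarrow> v x = 0" using uv by (simp add: borel_version_def)
  have eq: "indicator \<Omega> x * (\<bar>v x\<bar> ^ 3 * 1) = \<bar>v x\<bar> ^ 3" for x
    using zero[of x] by (cases "x \<in> \<Omega>") simp_all
  have "integrable (lebesgue_on \<Omega>) (\<lambda>x. \<bar>u x\<bar> ^ 3 * 1) \<longleftrightarrow>
      integrable lborel (\<lambda>x. indicator \<Omega> x * (\<bar>v x\<bar> ^ 3 * 1))"
    by (rule integrable_borel_version[OF borel_open[OF \<Omega>] subset_refl \<Omega> uv]) simp_all
  then have "integrable (lebesgue_on \<Omega>) (\<lambda>x. \<bar>u x\<bar> ^ 3) \<longleftrightarrow> integrable lborel (\<lambda>x. \<bar>v x\<bar> ^ 3)"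
    unfolding eq by simp
  then show ?thesis
    using borel_version_measurable[OF \<Omega> uv] uv
    by (simp add: Lp_space_def * power_integrable_def borel_version_def)
qed

lemma locally_integrable_borel_version:
  assumes \<Omega>: "open \<Omega>" and uv: "borel_version \<Omega> u v" and v: "integrable lborel v"
  shows "locally_integrable \<Omega> u"
  unfolding locally_integrable_def
proof (intro allI impI)
  fix K assume "compact K \<and> K \<subseteq> \<Omega>"
  then have K: "compact K" "K \<subseteq> \<Omega>" by simp_all
  have b: "K \<in> sets borel" by (rule borel_closed[OF compact_imp_closed[OF K(1)]])
  have "integrable lborel (\<lambda>x. v x * indicator K x)"
    using v b by (intro integrable_real_mult_indicator) auto
  moreover have "integrable (lebesgue_on K) (\<lambda>x. u x * 1) \<longleftrightarrow> integrable lborel (\<lambda>x. indicator K x * (v x * 1))"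
    by (rule integrable_borel_version[OF b K(2) \<Omega> uv, where F = "\<lambda>t. t"]) simp_all
  ultimately show "integrable (lebesgue_on K) u"
    by (simp add: mult.commute[of "indicator K _"])
qed

lemma integral_test_borel_version:
  fixes \<psi> :: "'a::euclidean_space \<Rightarrow> real"
  assumes \<Omega>: "open \<Omega>" and uv: "borel_version \<Omega> u v" and \<psi>: "\<psi> \<in> borel_measurable borel"
  shows "(LINT x|lebesgue_on \<Omega>. u x * \<psi> x) = (\<integral>x. v x * \<psi> x \<partial>lborel)"
proof -
  have zero: "\<And>x. x \<notin> \<Omega> \<Longrightarrow> v x = 0" using uv by (simp add: borel_version_def)
  have eq: "indicator \<Omega> x * (v x * \<psi> x) = v x * \<psi> x" for x
    using zero[of x] by (cases "x \<in> \<Omega>") simp_all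
  have "(LINT x|lebesgue_on \<Omega>. u x * \<psi> x) = (\<integral>x. indicator \<Omega> x * (v x * \<psi> x) \<partial>lborel)"
    by (rule integral_borel_version[OF borel_open[OF \<Omega>] subset_refl \<Omega> uv \<psi>, where F = "\<lambda>t. t"]) simp_all
  then show ?thesis unfolding eq .
qed

lemma iterated_partial_test:
  assumes "\<phi> \<in> test_functions \<Omega>" "bs \<in> lists Basis"
  shows "iterated_partial bs \<phi> \<in> test_functions \<Omega>"
  using assms(2)
proof (induction bs)
  case Nil then show ?case using assms(1) by simp
next
  case (Cons b bs) then show ?case using partial_deriv_test[of "iterated_partial bs \<phi>" \<Omega> b] by simp
qed

lemma weak_derivative_borel_version:
  assumes \<Omega>: "open \<Omega>" and u: "borel_version \<Omega> u u'" "integrable lborel u'"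
    and v: "borel_version \<Omega> v v'" "integrable lborel v'" and bs: "bs \<in> lists Basis"
  shows "weak_derivative \<Omega> bs u v \<longleftrightarrow> (\<forall>\<phi>\<in>test_functions \<Omega>.
    (\<integral>x. u' x * iterated_partial bs \<phi> x \<partial>lborel) = (-1) ^ length bs * (\<integral>x. v' x * \<phi> x \<partial>lborel))"
proof -
  have "(LINT x|lebesgue_on \<Omega>. u x * iterated_partial bs \<phi> x) = (\<integral>x. u' x * iterated_partial bs \<phi> x \<partial>lborel)"
    "(LINT x|lebesgue_on \<Omega>. v x * \<phi> x) = (\<integral>x. v' x * \<phi> x \<partial>lborel)" if "\<phi> \<in> test_functions \<Omega>" for \<phi>
    using integral_test_borel_version[OF \<Omega> u(1) measurable_test(1)[OF iterated_partial_test[OF that bs]]]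
      integral_test_borel_version[OF \<Omega> v(1) measurable_test(1)[OF that]] by simp_all
  then show ?thesis
    using locally_integrable_borel_version[OF \<Omega> u] locally_integrable_borel_version[OF \<Omega> v]
    by (simp add: weak_derivative_def)
qed

text \<open>The derivatives are given as one function for each list of directions. That the function for
\<open>[i, j]\<close> is the derivative in direction \<open>j\<close> of the one for \<open>[i]\<close> follows by testing the latter
against \<open>\<partial>\<^sub>j \<phi>\<close>, since the outermost derivative stands first in a list.\<close>

lemma sobolev_space_2_3D:
  fixes \<Omega> :: "'a::euclidean_space set"
  assumes \<Omega>: "open \<Omega>" "bounded \<Omega>" and u: "u \<in> sobolev_space 2 3 \<Omega>"
  obtains v g h where "borel_version \<Omega> u v" "sobolev23 \<Omega> v g h"
proof -
  have rep: "\<exists>w. borel_version \<Omega> v w \<and> power_integrable 3 w \<and> integrable lborel w" if v: "v \<in> Lp_space 3 \<Omega>" for v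
  proof -
    have "v \<in> borel_measurable (lebesgue_on \<Omega>)" using v by (simp add: Lp_space_def)
    then obtain w where w: "borel_version \<Omega> v w" by (rule borel_version_exists[OF \<Omega>(1)])
    then have "power_integrable 3 w" using Lp_space_3_iff[OF \<Omega>(1) w] v by simp
    moreover from this have "integrable lborel w"
      by (rule power_integrable_imp_integrable[OF _ zero_less_numeral \<Omega>(2,1)]) (use w in \<open>simp add: borel_version_def\<close>)
    ultimately show ?thesis using w by blast
  qed
  have uL: "u \<in> Lp_space 3 \<Omega>" using u by (simp add: sobolev_space_def)
  from rep[OF uL] obtain u' where u': "borel_version \<Omega> u u'" "power_integrable 3 u'" "integrable lborel u'" by blast
  have "\<exists>w. borel_version \<Omega> w w \<and> power_integrable 3 w \<and> integrable lborel w \<and>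
      (\<forall>\<phi>\<in>test_functions \<Omega>. (\<integral>x. u' x * iterated_partial bs \<phi> x \<partial>lborel) = (-1) ^ length bs * (\<integral>x. w x * \<phi> x \<partial>lborel))"
    if bs: "bs \<in> lists Basis" "length bs \<le> 2" for bs
  proof -
    obtain v where v: "v \<in> Lp_space 3 \<Omega>" "weak_derivative \<Omega> bs u v" using u bs unfolding sobolev_space_def by blast
    from rep[OF v(1)] obtain w where w: "borel_version \<Omega> v w" "power_integrable 3 w" "integrable lborel w" by blast
    have "borel_version \<Omega> w w" using w(1) by (simp add: borel_version_def)
    then show ?thesis using w(2,3) v(2) weak_derivative_borel_version[OF \<Omega>(1) u'(1,3) w(1,3) bs(1)] by blast
  qed
  then have "\<forall>bs\<in>{bs \<in> lists Basis. length bs \<le> 2}. \<exists>w. borel_version \<Omega> w w \<and> power_integrable 3 w \<and> integrable lborel w \<and>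
      (\<forall>\<phi>\<in>test_functions \<Omega>. (\<integral>x. u' x * iterated_partial bs \<phi> x \<partial>lborel) = (-1) ^ length bs * (\<integral>x. w x * \<phi> x \<partial>lborel))"
    by blast
  from bchoice[OF this] obtain W where "\<forall>bs\<in>{bs \<in> lists Basis. length bs \<le> 2}. borel_version \<Omega> (W bs) (W bs) \<and> power_integrable 3 (W bs) \<and> integrable lborel (W bs) \<and>
      (\<forall>\<phi>\<in>test_functions \<Omega>. (\<integral>x. u' x * iterated_partial bs \<phi> x \<partial>lborel) = (-1) ^ length bs * (\<integral>x. W bs x * \<phi> x \<partial>lborel))"
    by (rule exE)
  then have W: "borel_version \<Omega> (W bs) (W bs)" "power_integrable 3 (W bs)" "integrable lborel (W bs)"
      "\<And>\<phi>. \<phi> \<in> test_functions \<Omega> \<Longrightarrow> (\<integral>x. u' x * iterated_partial bs \<phi> x \<partial>lborel) = (-1) ^ length bs * (\<integral>x. W bs x * \<phi> x \<partial>lborel)"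
    if "bs \<in> lists Basis" "length bs \<le> 2" for bs
    using that by simp_all
  have "sobolev23 \<Omega> u' (\<lambda>i. W [i]) (\<lambda>i j. W [i, j])"
    unfolding sobolev23_def
  proof (intro conjI ballI allI impI u'(2))
    show "u' x = 0" if "x \<notin> \<Omega>" for x using u'(1) that by (simp add: borel_version_def)
    fix i :: 'a assume i: "i \<in> Basis"
    note Wi = W[of "[i]"]
    show "power_integrable 3 (W [i])" using Wi i by simp
    show "W [i] x = 0" if "x \<notin> \<Omega>" for x using Wi(1) i that by (simp add: borel_version_def)
    show "weak_partial \<Omega> i u' (W [i])" using Wi i u'(3) by (simp add: weak_partial_def)
    fix j :: 'a assume j: "j \<in> Basis"
    note Wij = W[of "[i, j]"]
    show "power_integrable 3 (W [i, j])" using Wij i j by simp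
    show "weak_partial \<Omega> j (W [i]) (W [i, j])"
      unfolding weak_partial_def
    proof (intro conjI ballI)
      show "integrable lborel (W [i])" "integrable lborel (W [i, j])" using Wi Wij i j by simp_all
      fix \<phi> assume \<phi>: "\<phi> \<in> test_functions \<Omega>"
      have "(\<integral>x. u' x * partial_deriv i (partial_deriv j \<phi>) x \<partial>lborel) = - (\<integral>x. W [i] x * partial_deriv j \<phi> x \<partial>lborel)"
        using Wi(4)[OF _ _ partial_deriv_test[OF \<phi> j]] i by simp
      moreover have "(\<integral>x. u' x * partial_deriv i (partial_deriv j \<phi>) x \<partial>lborel) = (\<integral>x. W [i, j] x * \<phi> x \<partial>lborel)"
        using Wij(4)[OF _ _ \<phi>] i j by simp
      ultimately show "(\<integral>x. W [i] x * partial_deriv j \<phi> x \<partial>lborel) = - (\<integral>x. W [i, j] x * \<phi> x \<partial>lborel)" by simp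
    qed
  qed
  with u'(1) show ?thesis by (rule that)
qed

lemma sobolev_space_2_3I:
  fixes \<Omega> :: "'a::euclidean_space set"
  assumes \<Omega>: "open \<Omega>" "bounded \<Omega>" and uv: "borel_version \<Omega> u v" and s: "sobolev23 \<Omega> v g h"
  shows "u \<in> sobolev_space 2 3 \<Omega>"
proof -
  note D = sobolev23D[OF s]
  have uL: "u \<in> Lp_space 3 \<Omega>" using Lp_space_3_iff[OF \<Omega>(1) uv] D(1) by simp
  have cut: "borel_version \<Omega> w (\<lambda>x. indicator \<Omega> x * w x)" "w \<in> Lp_space 3 \<Omega>" "integrable lborel (\<lambda>x. indicator \<Omega> x * w x)"
    "\<And>\<phi>. \<phi> \<in> test_functions \<Omega> \<Longrightarrow> (\<integral>x. indicator \<Omega> x * w x * \<phi> x \<partial>lborel) = (\<integral>x. w x * \<phi> x \<partial>lborel)"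
    if w: "power_integrable 3 w" for w
  proof -
    have [measurable]: "w \<in> borel_measurable borel" "\<Omega> \<in> sets borel" using w \<Omega>(1) by (simp_all add: power_integrable_def)
    show bv: "borel_version \<Omega> w (\<lambda>x. indicator \<Omega> x * w x)" by (simp add: borel_version_def)
    have p: "power_integrable 3 (\<lambda>x. indicator \<Omega> x * w x)"
      by (rule power_integrable_bound[OF w, where C = 1]) (auto simp: indicator_def)
    show "w \<in> Lp_space 3 \<Omega>" using Lp_space_3_iff[OF \<Omega>(1) bv] p by simp
    show "integrable lborel (\<lambda>x. indicator \<Omega> x * w x)"
      by (rule power_integrable_imp_integrable[OF p zero_less_numeral \<Omega>(2,1)]) simp
    fix \<phi> assume \<phi>: "\<phi> \<in> test_functions \<Omega>"
    have eq: "indicator \<Omega> x * w x * \<phi> x = w x * \<phi> x" for x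
    proof (cases "x \<in> \<Omega>")
      case False
      then have "\<phi> x = 0" using \<phi> closure_subset[of "{x. \<phi> x \<noteq> 0}"] unfolding test_functions_def by blast
      then show ?thesis by simp
    qed simp
    show "(\<integral>x. indicator \<Omega> x * w x * \<phi> x \<partial>lborel) = (\<integral>x. w x * \<phi> x \<partial>lborel)"
      unfolding eq ..
  qed
  have vi: "integrable lborel v" by (rule power_integrable_imp_integrable[OF D(1) zero_less_numeral \<Omega>(2,1) D(2)])
  have wd: "\<exists>w\<in>Lp_space 3 \<Omega>. weak_derivative \<Omega> bs u w"
    if bs: "bs \<in> lists Basis" and w: "power_integrable 3 w"
      and eq: "\<And>\<phi>. \<phi> \<in> test_functions \<Omega> \<Longrightarrow> (\<integral>x. v x * iterated_partial bs \<phi> x \<partial>lborel) = (-1) ^ length bs * (\<integral>x. w x * \<phi> x \<partial>lborel)"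
    for bs w
    using weak_derivative_borel_version[OF \<Omega>(1) uv vi cut(1,3)[OF w] bs] cut(2,4)[OF w] eq
    by (intro bexI[of _ w]) simp_all
  show "u \<in> sobolev_space 2 3 \<Omega>"
    unfolding sobolev_space_def
  proof (intro CollectI conjI ballI impI uL)
    fix bs :: "'a list" assume bs: "bs \<in> lists Basis" "length bs \<le> 2"
    consider "bs = []" | i where "bs = [i]" | i j where "bs = [i, j]"
      using bs(2) by (cases bs; cases "tl bs"; auto)
    then show "\<exists>w\<in>Lp_space 3 \<Omega>. weak_derivative \<Omega> bs u w"
    proof cases
      case 1 then show ?thesis using wd[OF bs(1) D(1)] by simp
    next
      case (2 i)
      then have i: "i \<in> Basis" using bs by simp
      show ?thesis using wd[OF bs(1) D(3)[OF i]] D(5)[OF i] 2 by (simp add: weak_partial_def)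
    next
      case (3 i j)
      then have ij: "i \<in> Basis" "j \<in> Basis" using bs by simp_all
      have "(\<integral>x. v x * partial_deriv i (partial_deriv j \<phi>) x \<partial>lborel) = (\<integral>x. h i j x * \<phi> x \<partial>lborel)"
        if \<phi>: "\<phi> \<in> test_functions \<Omega>" for \<phi>
        using D(5)[OF ij(1)] D(7)[OF ij] \<phi> partial_deriv_test[OF \<phi> ij(2)] by (simp add: weak_partial_def)
      then show ?thesis using wd[OF bs(1) D(6)[OF ij]] 3 by simp
    qed
  qed
qed

section \<open>The inverse of a matrix of determinant one\<close>

text \<open>Arithmetic in the index type \<open>3\<close> is modulo three.\<close>

lemma numeral_3_wrap: "(4::3) = 1" "(5::3) = 2" by simp_all

text \<open>Because indices wrap around, the cyclic minors carry the signs of the cofactors.\<close>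

definition adjugate3 :: "real^3^3 \<Rightarrow> real^3^3" where
  "adjugate3 A = (\<chi> i j. A $ (j+1) $ (i+1) * A $ (j+2) $ (i+2) - A $ (j+1) $ (i+2) * A $ (j+2) $ (i+1))"

lemma matrix_mult_adjugate3: "A ** adjugate3 A = det A *\<^sub>R mat 1"
  unfolding vec_eq_iff forall_3 matrix_matrix_mult_def adjugate3_def mat_def det_3
  by (simp add: sum_3 numeral_3_wrap algebra_simps)

lemma matrix_inv_eq_adjugate3:
  fixes A :: "real^3^3"
  assumes "det A = 1"
  shows "matrix_inv A = adjugate3 A"
proof -
  have 1: "A ** adjugate3 A = mat 1" using matrix_mult_adjugate3[of A] assms by simp
  then have 2: "adjugate3 A ** A = mat 1" by (simp add: matrix_left_right_inverse)
  then have "A ** matrix_inv A = mat 1"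
    using someI[of "\<lambda>A'. A ** A' = mat 1 \<and> A' ** A = mat 1" "adjugate3 A"] 1 unfolding matrix_inv_def by blast
  then have "adjugate3 A ** (A ** matrix_inv A) = adjugate3 A" by simp
  then show ?thesis by (simp add: matrix_mul_assoc 2)
qed

section \<open>The algebra property and the response function\<close>

lemma borel_version_combine:
  fixes F :: "real \<Rightarrow> real \<Rightarrow> real"
  assumes u: "borel_version \<Omega> u u'" and v: "borel_version \<Omega> v v'"
    and F: "continuous_on UNIV (\<lambda>p. F (fst p) (snd p))" "F 0 0 = 0"
  shows "borel_version \<Omega> (\<lambda>x. F (u x) (v x)) (\<lambda>x. F (u' x) (v' x))"
proof -
  have "(\<lambda>x. (u' x, v' x)) \<in> borel_measurable borel"
    using u v by (intro borel_measurable_Pair) (simp_all add: borel_version_def)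
  from measurable_compose[OF this borel_measurable_continuous_onI[OF F(1)]] have "(\<lambda>x. F (u' x) (v' x)) \<in> borel_measurable borel" by simp
  moreover have "AE x in lborel. x \<in> \<Omega> \<longrightarrow> u x = u' x" "AE x in lborel. x \<in> \<Omega> \<longrightarrow> v x = v' x"
    using u v by (simp_all add: borel_version_def)
  then have "AE x in lborel. x \<in> \<Omega> \<longrightarrow> F (u x) (v x) = F (u' x) (v' x)" by eventually_elim simp
  ultimately show ?thesis using u v F(2) by (simp add: borel_version_def)
qed

lemma sobolev_space_2_3_cong:
  assumes \<Omega>: "open \<Omega>" "bounded \<Omega>" and u: "u \<in> sobolev_space 2 3 \<Omega>"
    and eq: "AE x in lebesgue_on \<Omega>. v x = u x"
  shows "v \<in> sobolev_space 2 3 \<Omega>"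
proof -
  obtain w g h where w: "borel_version \<Omega> u w" "sobolev23 \<Omega> w g h" by (rule sobolev_space_2_3D[OF \<Omega> u])
  have "\<Omega> \<in> sets lebesgue" using \<Omega>(1) by (intro sets_completionI_sets) simp
  from eq[unfolded AE_lebesgue_on_iff[OF this]] have eq': "AE x in lborel. x \<in> \<Omega> \<longrightarrow> v x = u x" .
  have "AE x in lborel. x \<in> \<Omega> \<longrightarrow> u x = w x" using w(1) by (simp add: borel_version_def)
  with eq' have "AE x in lborel. x \<in> \<Omega> \<longrightarrow> v x = w x" by eventually_elim simp
  with w(1) have "borel_version \<Omega> v w" by (simp add: borel_version_def)
  from sobolev_space_2_3I[OF \<Omega> this w(2)] show ?thesis .
qed

lemma sobolev_space_2_3_add:
  assumes \<Omega>: "open \<Omega>" "bounded \<Omega>" and u: "u \<in> sobolev_space 2 3 \<Omega>" and v: "v \<in> sobolev_space 2 3 \<Omega>"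
  shows "(\<lambda>x. u x + v x) \<in> sobolev_space 2 3 \<Omega>"
proof -
  obtain u' g h where u': "borel_version \<Omega> u u'" "sobolev23 \<Omega> u' g h" by (rule sobolev_space_2_3D[OF \<Omega> u])
  obtain v' k l where v': "borel_version \<Omega> v v'" "sobolev23 \<Omega> v' k l" by (rule sobolev_space_2_3D[OF \<Omega> v])
  have "borel_version \<Omega> (\<lambda>x. u x + v x) (\<lambda>x. u' x + v' x)"
    by (rule borel_version_combine[OF u'(1) v'(1)]) (auto intro!: continuous_intros)
  from sobolev_space_2_3I[OF \<Omega> this sobolev23_add[OF u'(2) v'(2)]] show ?thesis .
qed

lemma sobolev_space_2_3_cmult:
  assumes \<Omega>: "open \<Omega>" "bounded \<Omega>" and u: "u \<in> sobolev_space 2 3 \<Omega>"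
  shows "(\<lambda>x. c * u x) \<in> sobolev_space 2 3 \<Omega>"
proof -
  obtain u' g h where u': "borel_version \<Omega> u u'" "sobolev23 \<Omega> u' g h" by (rule sobolev_space_2_3D[OF \<Omega> u])
  have "borel_version \<Omega> (\<lambda>x. c * u x) (\<lambda>x. c * u' x)"
    by (rule borel_version_combine[OF u'(1) u'(1), where F = "\<lambda>s t. c * s"]) (auto intro!: continuous_intros)
  from sobolev_space_2_3I[OF \<Omega> this sobolev23_cmult[OF u'(2)]] show ?thesis .
qed

lemma sobolev_space_2_3_diff:
  assumes \<Omega>: "open \<Omega>" "bounded \<Omega>" and u: "u \<in> sobolev_space 2 3 \<Omega>" and v: "v \<in> sobolev_space 2 3 \<Omega>"
  shows "(\<lambda>x. u x - v x) \<in> sobolev_space 2 3 \<Omega>"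
  using sobolev_space_2_3_add[OF \<Omega> u sobolev_space_2_3_cmult[OF \<Omega> v, of "-1"]] by simp

proposition sobolev_space_2_3_mult:
  fixes \<Omega> :: "'a::euclidean_space set"
  assumes dim: "DIM('a) = 3" and \<Omega>: "open \<Omega>" "bounded \<Omega>" "cone_property \<Omega>"
    and u: "u \<in> sobolev_space 2 3 \<Omega>" and v: "v \<in> sobolev_space 2 3 \<Omega>"
  shows "(\<lambda>x. u x * v x) \<in> sobolev_space 2 3 \<Omega>"
proof -
  obtain u' g h where u': "borel_version \<Omega> u u'" "sobolev23 \<Omega> u' g h" by (rule sobolev_space_2_3D[OF \<Omega>(1,2) u])
  obtain v' k l where v': "borel_version \<Omega> v v'" "sobolev23 \<Omega> v' k l" by (rule sobolev_space_2_3D[OF \<Omega>(1,2) v])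
  have "borel_version \<Omega> (\<lambda>x. u x * v x) (\<lambda>x. u' x * v' x)"
    by (rule borel_version_combine[OF u'(1) v'(1)]) (auto intro!: continuous_intros)
  from sobolev_space_2_3I[OF \<Omega>(1,2) this sobolev23_mult[OF dim \<Omega> u'(2) v'(2)]] show ?thesis .
qed

theorem proposition5p5:
  fixes \<Omega> :: "(real^3) set" and B :: "real^3 \<Rightarrow> real^3^3"
  assumes "domain \<Omega>" and "bounded \<Omega>" and "smooth_boundary \<Omega>"
    and "B \<in> sobolev_matrix_space 2 3 \<Omega>"
    and "AE x in lebesgue_on \<Omega>. det (B x) = 1"
  shows "(\<lambda>x. matrix_inv (B x)) \<in> sobolev_matrix_space 2 3 \<Omega> \<and>
    (\<forall>\<mu>\<^sub>1 \<mu>\<^sub>2 \<mu>\<^sub>3.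
       \<mu>\<^sub>1 \<in> sobolev_space 1 \<infinity> \<Omega> \<inter> sobolev_space 2 3 \<Omega> \<longrightarrow>
       \<mu>\<^sub>2 \<in> sobolev_space 1 \<infinity> \<Omega> \<inter> sobolev_space 2 3 \<Omega> \<longrightarrow>
       \<mu>\<^sub>3 \<in> sobolev_space 1 \<infinity> \<Omega> \<inter> sobolev_space 2 3 \<Omega> \<longrightarrow>
       response \<mu>\<^sub>1 \<mu>\<^sub>2 \<mu>\<^sub>3 B \<in> sobolev_matrix_space 2 3 \<Omega>)"
proof -
  have \<Omega>: "open \<Omega>" "bounded \<Omega>" using assms(1,2) by (simp_all add: domain_def)
  have cone: "cone_property \<Omega>" by (rule smooth_boundary_cone_property[OF \<Omega>(1) assms(3)])
  note mult = sobolev_space_2_3_mult[OF _ \<Omega> cone]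
  have dim: "DIM(real^3) = 3" by simp
  have B: "(\<lambda>x. B x $ i $ j) \<in> sobolev_space 2 3 \<Omega>" for i j
    using assms(4) by (simp add: sobolev_matrix_space_def)
  have inv: "(\<lambda>x. matrix_inv (B x) $ i $ j) \<in> sobolev_space 2 3 \<Omega>" for i j
  proof (rule sobolev_space_2_3_cong[OF \<Omega>])
    show "(\<lambda>x. B x $ (j+1) $ (i+1) * B x $ (j+2) $ (i+2) - B x $ (j+1) $ (i+2) * B x $ (j+2) $ (i+1)) \<in> sobolev_space 2 3 \<Omega>"
      by (intro sobolev_space_2_3_diff[OF \<Omega>] mult[OF dim] B)
    show "AE x in lebesgue_on \<Omega>. matrix_inv (B x) $ i $ j =
        B x $ (j+1) $ (i+1) * B x $ (j+2) $ (i+2) - B x $ (j+1) $ (i+2) * B x $ (j+2) $ (i+1)"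
      using assms(5) by eventually_elim (simp add: matrix_inv_eq_adjugate3 adjugate3_def)
  qed
  have "response \<mu>\<^sub>1 \<mu>\<^sub>2 \<mu>\<^sub>3 B \<in> sobolev_matrix_space 2 3 \<Omega>"
    if \<mu>: "\<mu>\<^sub>1 \<in> sobolev_space 2 3 \<Omega>" "\<mu>\<^sub>2 \<in> sobolev_space 2 3 \<Omega>" "\<mu>\<^sub>3 \<in> sobolev_space 2 3 \<Omega>" for \<mu>\<^sub>1 \<mu>\<^sub>2 \<mu>\<^sub>3
  proof -
    have "(\<lambda>x. response \<mu>\<^sub>1 \<mu>\<^sub>2 \<mu>\<^sub>3 B x $ i $ j) \<in> sobolev_space 2 3 \<Omega>" for i j
    proof -
      have "(\<lambda>x. (mat 1 :: real^3^3) $ i $ j * \<mu>\<^sub>1 x + \<mu>\<^sub>2 x * B x $ i $ j + \<mu>\<^sub>3 x * matrix_inv (B x) $ i $ j) \<in> sobolev_space 2 3 \<Omega>"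
        by (intro sobolev_space_2_3_add[OF \<Omega>] sobolev_space_2_3_cmult[OF \<Omega>] mult[OF dim] \<mu> B inv)
      then show ?thesis by (simp add: response_def mult.commute)
    qed
    then show ?thesis by (simp add: sobolev_matrix_space_def)
  qed
  then show ?thesis using inv by (simp add: sobolev_matrix_space_def)
qed

end
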